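(* Let $K\subseteq\mathbb{R}^n$ be a centrally symmetric convex body in John's position, let $H$ be a $k$-dimensional linear subspace of $\mathbb{R}^n$ and let $(c_j,v_j)_{j=1}^m\subseteq(0,1]\times(\partial K\cap S^{n-1})$ be the associated decomposition of the identity of $K$. Let $J=\{1\le j\le m:P_Hv_j\neq0\}$, let $m_0$ be its cardinality and, for $j\in J$, let $\tilde c_j=c_j\|P_Hv_j\|_2^2$ and $t_j=\frac{1}{\|P_Hv_j\|_2}$. For $\lambda>0$ and $j\in J$ with $\tilde c_j\neq1$ let, for $s\in\mathbb{R}\setminus\{0\}$, $$h_{\lambda,j}(s)=\left|\frac{2\sin(\lambda\sqrt{\tilde c_j}t_js)}{s}+\cos(\lambda\sqrt{\tilde c_j}t_js)e^{-\frac{s^2}{4\pi}}-2\sin(\lambda\sqrt{\tilde c_j}t_js)\int_0^\infty e^{-\pi y^2}\sin(ys)\,dy\right|^{\frac{1}{1-\tilde c_j}},$$ and $h_{\lambda,j}(0)=(2\lambda\sqrt{\tilde c_j}t_j+1)^{\frac{1}{1-\tilde c_j}}$. Then, for any $\lambda>0$, $$\mathcal{W}(\lambda(K\cap H))\le\frac{1}{(2\pi)^{m_0-k}}\prod_{j\in J}\left(\frac{\int_{\mathbb{R}}h_{\lambda,j}(s)\,ds}{\sqrt{1-\tilde c_j}}\right)^{1-\tilde c_j},$$ where, for every $j\in J$ such that $\tilde c_j=1$, necessarily $c_j=\|P_Hv_j\|_2=1$ and the corresponding factor is understood as $2\lambda\sqrt{\tilde c_j}t_j+1=2\lambda+1$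.
   Context: A convex body $K\subseteq\mathbb{R}^n$ is in John's position if the maximal volume ellipsoid contained in $K$ is the Euclidean unit ball $B_2^n$. A centrally symmetric convex body $K$ is in John's position if and only if $B_2^n\subseteq K$ and there exist contact points $v_1,\dots,v_m\in\partial K\cap S^{n-1}$ and $c_1,\dots,c_m\in(0,1]$ with $\mathrm{Id}_n=\sum_{j=1}^mc_j\,v_j\otimes v_j$; such a family $(c_j,v_j)_{j=1}^m$ is called an associated decomposition of the identity. $P_H$ is the orthogonal projection onto $H$. The Wills functional of a compact convex set $A$ is the sum of its intrinsic volumes, $\mathcal{W}(A)=\sum_iV_i(A)$; for a convex body $A$ in a $k$-dimensional Euclidean space $H$ it equals $\mathcal{W}(A)=\int_He^{-\pi d^2(x,A)}dx$, where $d(\cdot,A)$ is the Euclidean distance to $A$. *)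

theory Defs
  imports "HOL-Analysis.Analysis"
begin

definition convex_body :: "'a::euclidean_space set \<Rightarrow> bool" where
  "convex_body K \<longleftrightarrow> compact K \<and> convex K \<and> interior K \<noteq> {}"

definition centrally_symmetric :: "'a::real_vector set \<Rightarrow> bool" where
  "centrally_symmetric K \<longleftrightarrow> uminus ` K = K"

definition ellipsoid :: "(real ^ 'n) set \<Rightarrow> bool" where
  "ellipsoid E \<longleftrightarrow>
     (\<exists>(A :: real ^ 'n ^ 'n) a. invertible A \<and> E = (\<lambda>x. a + A *v x) ` cball 0 1)"

text \<open>Only maximality of the volume is required; for a convex body the maximal ellipsoid is
  unique by John's theorem, so requiring uniqueness as well would not change the notion.\<close>

definition john_position :: "(real ^ 'n) set \<Rightarrow> bool" where
  "john_position K \<longleftrightarrow>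
     cball 0 1 \<subseteq> K \<and>
     (\<forall>E. ellipsoid E \<and> E \<subseteq> K \<longrightarrow> measure lebesgue E \<le> measure lebesgue (cball (0 :: real ^ 'n) 1))"

definition tensor :: "real ^ 'n \<Rightarrow> real ^ 'm \<Rightarrow> real ^ 'm ^ 'n"  (infixr \<open>\<otimes>\<^sub>v\<close> 72) where
  "u \<otimes>\<^sub>v w = (\<chi> i j. u $ i * w $ j)"

definition decomposition_of_identity ::
  "(real ^ 'n) set \<Rightarrow> nat \<Rightarrow> (nat \<Rightarrow> real) \<Rightarrow> (nat \<Rightarrow> real ^ 'n) \<Rightarrow> bool" where
  "decomposition_of_identity K m c v \<longleftrightarrow>
     (\<forall>j\<in>{1..m}. 0 < c j \<and> c j \<le> 1 \<and> v j \<in> frontier K \<inter> sphere 0 1) \<and>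
     mat 1 = (\<Sum>j=1..m. c j *\<^sub>R (v j \<otimes>\<^sub>v v j))"

definition orth_proj :: "'a::euclidean_space set \<Rightarrow> 'a \<Rightarrow> 'a" where
  "orth_proj H x = (THE y. y \<in> H \<and> (\<forall>z\<in>H. orthogonal (x - y) z))"

text \<open>The intrinsic volumes \<open>V 0, \<dots>, V n\<close> of a compact convex set \<open>A\<close> are the normalised
  coefficients in Steiner's formula
  \<open>vol (A + r B) = (\<Sum>i\<le>n. \<kappa> (n - i) * V i * r ^ (n - i))\<close> for \<open>r \<ge> 0\<close>,
  where \<open>B\<close> is the unit ball and \<open>\<kappa> d\<close> is the volume of the \<open>d\<close>-dimensional unit ball.
  The union of the balls below is \<open>A + r B\<close>. The normalisation makes the intrinsic volumes
  independent of the dimension of the ambient space, so for subsets of a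
  subspace it does not matter that they are computed in the whole space.\<close>

definition steiner_formula :: "'a::euclidean_space set \<Rightarrow> (nat \<Rightarrow> real) \<Rightarrow> bool" where
  "steiner_formula A V \<longleftrightarrow>
     (\<forall>r\<ge>0. measure lebesgue (\<Union>x\<in>A. cball x r) =
        (\<Sum>i\<le>DIM('a). unit_ball_vol (real (DIM('a) - i)) * V i * r ^ (DIM('a) - i)))"

definition intrinsic_volume :: "nat \<Rightarrow> 'a::euclidean_space set \<Rightarrow> real" where
  "intrinsic_volume i A =
     (THE V. steiner_formula A V \<and> (\<forall>l>DIM('a). V l = 0)) i"

lemma steiner_formula_unique:
  fixes A :: "'a::euclidean_space set"
  assumes "steiner_formula A V" "steiner_formula A W" "i \<le> DIM('a)"
  shows "V i = W i"
proof -
  let ?n = "DIM('a)"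
  define a where "a d = unit_ball_vol (real d) * (V (?n - d) - W (?n - d))" for d
  have zero: "(\<Sum>d\<le>?n. a d * r ^ d) = 0" if "r \<ge> 0" for r
  proof -
    have "(\<Sum>d\<le>?n. a d * r ^ d) = (\<Sum>i\<le>?n. a (?n - i) * r ^ (?n - i))"
      by (rule sum.nat_diff_reindex[where n = "Suc ?n", simplified lessThan_Suc_atMost, simplified, symmetric])
    also have "\<dots> = (\<Sum>i\<le>?n. unit_ball_vol (real (?n - i)) * V i * r ^ (?n - i))
                    - (\<Sum>i\<le>?n. unit_ball_vol (real (?n - i)) * W i * r ^ (?n - i))"
      unfolding sum_subtractf[symmetric] a_def
      by (intro sum.cong) (auto simp: algebra_simps)
    also have "\<dots> = 0"
      using assms(1,2) that by (simp add: steiner_formula_def)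
    finally show ?thesis .
  qed
  have "a d = 0" if "d \<le> ?n" for d
  proof (rule ccontr)
    assume "a d \<noteq> 0"
    then have "finite {r. (\<Sum>d\<le>?n. a d * r ^ d) = 0}"
      using that by (intro polyfun_roots_finite)
    then have "finite {0::real..}"
      by (rule finite_subset[rotated]) (use zero in auto)
    then show False by (simp add: infinite_Ici)
  qed
  from this[of "?n - i"] show ?thesis
    using assms(3) less_imp_neq[OF unit_ball_vol_pos[OF of_nat_0_le_iff[of "?n - i"]]]
    by (auto simp: a_def simp del: of_nat_diff)
qed

lemma intrinsic_volume_eq:
  fixes A :: "'a::euclidean_space set"
  assumes "steiner_formula A V" "i \<le> DIM('a)"
  shows "intrinsic_volume i A = V i"
proof -
  define V' where "V' l = (if l \<le> DIM('a) then V l else 0)" for l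
  have "steiner_formula A V'"
    using assms(1) by (simp add: steiner_formula_def V'_def)
  then have "(THE W. steiner_formula A W \<and> (\<forall>l>DIM('a). W l = 0)) = V'"
    by (intro the_equality)
       (auto simp: V'_def fun_eq_iff not_le dest: steiner_formula_unique[OF _ assms(1)])
  then show ?thesis
    using assms(2) by (simp add: intrinsic_volume_def V'_def)
qed

definition wills :: "'a::euclidean_space set \<Rightarrow> real" where
  "wills A = (\<Sum>i\<le>DIM('a). intrinsic_volume i A)"

definition wills_h :: "real \<Rightarrow> real \<Rightarrow> real \<Rightarrow> real \<Rightarrow> real" where
  "wills_h l c t s =
     (if s = 0 then (2 * l * sqrt c * t + 1) powr (1 / (1 - c))
      else \<bar>2 * sin (l * sqrt c * t * s) / s
            + cos (l * sqrt c * t * s) * exp (- (s\<^sup>2 / (4 * pi)))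
            - 2 * sin (l * sqrt c * t * s) *
                (LINT y:{0..}|lborel. exp (- pi * y\<^sup>2) * sin (y * s))\<bar> powr (1 / (1 - c)))"

end

theory Submission
  imports Defs "HOL-Probability.Probability"
begin

text \<open>
  For a convex body \<open>A\<close> the Wills functional is the integral of \<open>exp (- pi d\<^sup>2)\<close>, where \<open>d\<close> is the distance to
  \<open>A\<close> (\<open>wills_eq_integral\<close>). This rests on Steiner's formula: contraction towards the nearest point is
  piecewise affine for a polytope, which makes the parallel volume a polynomial, and general bodies
  are limits of polytopes.

  Let \<open>P\<close> be the projection onto \<open>H\<close>. The vectors \<open>w\<^sub>j = sqrt (c\<^sub>j) P v\<^sub>j\<close> satisfy \<open>\<Sum>j. (w\<^sub>j \<bullet> x) w\<^sub>j = x\<close> on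
  \<open>H\<close>, and together with an orthonormal basis of the complement they do so on the whole space. Each
  \<open>v\<^sub>j\<close> is a contact point, so the section \<open>\<lambda> (K \<inter> H)\<close> lies in slabs \<open>\<bar>w\<^sub>j \<bullet> x\<bar> \<le> a\<^sub>j\<close>. By Parseval's identity the
  squared distance to the section is at least the sum of the squared distances of \<open>w\<^sub>j \<bullet> x\<close> to
  \<open>[- a\<^sub>j, a\<^sub>j]\<close>. Hence the Wills functional is at most the integral of a product of one-dimensional
  functions \<open>g\<^sub>j (w\<^sub>j \<bullet> x)\<close>, where \<open>g\<^sub>j\<close> is 1 on the interval and has Gaussian tails
  (\<open>wills_le_frame\<close>).

  By Fourier inversion this integral is \<open>(2 pi) ^ (n - |J|)\<close> times the integral of the product of the
  Fourier transforms of the \<open>g\<^sub>j\<close> over the coefficient vectors \<open>\<xi>\<close> with \<open>\<Sum>j. \<xi>\<^sub>j w\<^sub>j = 0\<close>. On this subspace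
  the coordinate functionals have squared norms \<open>1 - |w\<^sub>j|\<^sup>2\<close>, and the Brascamp-Lieb inequality with
  these exponents gives the bound: \<open>h\<^sub>j\<close> is the modulus of the transform of \<open>g\<^sub>j\<close> to the power
  \<open>1 / (1 - |w\<^sub>j|\<^sup>2)\<close>. Instead of restricting to the subspace, Gaussian factors regularise both sides
  (\<open>smooth_product_le_fourier\<close>), and the inequality is proved on the full coefficient space with a
  kernel that depends on \<open>\<Sum>j. \<xi>\<^sub>j w\<^sub>j\<close> (\<open>brascamp_lieb_kernel\<close>). Its constant does not depend on the
  kernel except through the total mass, so the regularisation can be removed at the end.

  The Brascamp-Lieb inequality is proved by monotone transport of Gaussians to the given
  densities. Its geometric input is the determinant inequality \<open>det_weighted_frame_ge\<close>, applied in
  the original space of dimension \<open>n\<close> to a change of variables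
  (\<open>frame_transport_inequality\<close>).
\<close>

section \<open>The parallel volume of a polytope\<close>

text \<open>All points of the ray that starts at the nearest point and runs through \<open>x\<close> share that
  nearest point, because the obtuse-angle condition is invariant under scaling.\<close>

lemma closest_point_ray:
  fixes A :: "'a::euclidean_space set"
  assumes "convex A" "closed A" "A \<noteq> {}" "0 \<le> s"
  shows "closest_point A (closest_point A x + s *\<^sub>R (x - closest_point A x)) = closest_point A x"
proof -
  define p where "p = closest_point A x"
  define q where "q = p + s *\<^sub>R (x - p)"
  have pA: "p \<in> A"
    unfolding p_def using assms by (simp add: closest_point_in_set)
  have "dist q p \<le> dist q z" if "z \<in> A" for z
  proof -
    have "(x - p) \<bullet> (z - p) \<le> 0"
      unfolding p_def using assms that by (intro closest_point_dot) auto
    then have "(q - p) \<bullet> (z - p) \<le> 0"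
      using assms(4) by (simp add: q_def mult_nonneg_nonpos)
    moreover have "(norm (q - z))\<^sup>2 = (norm (q - p))\<^sup>2 + (norm (z - p))\<^sup>2 - 2 * ((q - p) \<bullet> (z - p))"
      by (simp add: power2_norm_eq_inner algebra_simps inner_commute)
    ultimately have "(norm (q - p))\<^sup>2 \<le> (norm (q - z))\<^sup>2"
      using zero_le_power2[of "norm (z - p)"] by linarith
    then show ?thesis
      by (simp add: dist_norm norm_le_square power2_norm_eq_inner norm_le)
  qed
  then have "p = closest_point A q"
    using assms pA by (intro closest_point_unique) auto
  then show ?thesis
    by (simp add: p_def q_def)
qed

lemma infdist_closest_point:
  fixes A :: "'a::euclidean_space set"
  assumes "closed A" "A \<noteq> {}"
  shows "infdist x A = dist x (closest_point A x)"
proof -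
  have "infdist x A \<le> dist x (closest_point A x)"
    using assms by (intro infdist_le closest_point_in_set)
  moreover have "dist x (closest_point A x) \<le> infdist x A"
    unfolding infdist_notempty[OF assms(2)]
    using assms by (intro cINF_greatest) (auto intro: closest_point_le)
  ultimately show ?thesis by simp
qed

lemma orthonormal_projection_eq:
  fixes B :: "'a::euclidean_space set"
  assumes "finite B" "pairwise orthogonal B" "\<And>b. b \<in> B \<Longrightarrow> norm b = 1"
    and "y \<in> span B" "\<And>b. b \<in> B \<Longrightarrow> orthogonal (x - y) b"
  shows "(\<Sum>b\<in>B. (x \<bullet> b) *\<^sub>R b) = y"
proof -
  define z where "z = (\<Sum>b\<in>B. (x \<bullet> b) *\<^sub>R b) - y"
  have zB: "z \<in> span B"
    unfolding z_def using assms(4) by (intro span_diff span_sum span_scale) (auto intro: span_base)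
  have "orthogonal z b" if "b \<in> B" for b
  proof -
    have "(\<Sum>c\<in>B. (x \<bullet> c) *\<^sub>R c) \<bullet> b = (\<Sum>c\<in>B. if c = b then x \<bullet> b else 0)"
      unfolding inner_sum_left
      using assms(2,3) that
      by (intro sum.cong) (auto simp: pairwise_def orthogonal_def power2_norm_eq_inner[symmetric] norm_eq_1)
    also have "\<dots> = x \<bullet> b"
      using assms(1) that by simp
    also have "x \<bullet> b = y \<bullet> b"
      using assms(5)[OF that] by (simp add: orthogonal_def inner_diff_left)
    finally show ?thesis
      by (simp add: z_def orthogonal_def inner_diff_left)
  qed
  then have "orthogonal z z"
    using zB by (meson orthogonal_to_span orthogonal_commute)
  then show ?thesis
    by (simp add: z_def orthogonal_self)
qed

lemma linear_orthonormal_projection: "linear (\<lambda>x. \<Sum>b\<in>B. (x \<bullet> b) *\<^sub>R b)"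
  by (intro linearI)
    (simp_all add: inner_add_left scaleR_add_left sum.distrib scaleR_sum_right)

text \<open>If the nearest point is relatively interior to \<open>T\<close>, the obtuse-angle inequality holds in
  both directions along \<open>T\<close>; hence on the set of these \<open>x\<close> the nearest-point
  map is the orthogonal projection onto the affine hull of \<open>T\<close>.\<close>

lemma closest_point_relative_interior_orthogonal:
  fixes A :: "'a::euclidean_space set"
  assumes "convex A" "closed A" "T \<subseteq> A" "closest_point A x \<in> rel_interior T" "y \<in> affine hull T"
  shows "(x - closest_point A x) \<bullet> (y - closest_point A x) = 0"
proof -
  define p where "p = closest_point A x"
  have p: "p \<in> rel_interior T" and pT: "p \<in> T"
    using assms rel_interior_subset unfolding p_def by auto
  obtain e where e: "e > 0" "ball p e \<inter> affine hull T \<subseteq> T"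
    using p by (auto simp: mem_rel_interior_ball)
  have *: "(x - p) \<bullet> (z - p) \<le> 0" if z: "z \<in> affine hull T" for z
  proof (cases "z = p")
    case False
    define t where "t = e / (2 * norm (z - p))"
    have t: "t > 0" using False e by (simp add: t_def)
    have "p + t *\<^sub>R (z - p) = (1 - t) *\<^sub>R p + t *\<^sub>R z"
      by (simp add: algebra_simps)
    also have "\<dots> \<in> affine hull T"
      using z hull_inc[OF pT, of affine] by (intro mem_affine affine_affine_hull) auto
    moreover have "p + t *\<^sub>R (z - p) \<in> ball p e"
      using False e by (simp add: dist_norm t_def)
    ultimately have "p + t *\<^sub>R (z - p) \<in> A"
      using e assms(3) by auto
    then have "(x - p) \<bullet> ((p + t *\<^sub>R (z - p)) - p) \<le> 0"
      unfolding p_def using assms by (intro closest_point_dot) auto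
    then show ?thesis
      using t by (simp add: mult_le_0_iff)
  qed simp
  have "2 *\<^sub>R p - y \<in> affine hull T"
    using mem_affine[OF affine_affine_hull hull_inc[OF pT, of affine] assms(5), of 2 "-1"]
    by simp
  from *[OF this] *[OF assms(5)] show ?thesis
    by (simp add: p_def[symmetric] algebra_simps scaleR_2)
qed

text \<open>A minimal face containing the point cannot have it on its relative boundary, since that boundary is a
  union of smaller faces.\<close>

lemma polytope_point_in_face:
  fixes S :: "'a::euclidean_space set"
  assumes "polytope S" "x \<in> S"
  obtains T where "T face_of S" "x \<in> rel_interior T"
proof -
  let ?F = "{T. T face_of S \<and> x \<in> T}"
  have "finite ?F"
    using finite_polytope_faces[OF assms(1)] by (rule finite_subset[rotated]) auto
  moreover have "S \<in> ?F"
    using assms by (simp add: face_of_refl polytope_imp_convex)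
  ultimately obtain T where T: "T \<in> ?F" and min: "\<And>U. U \<in> ?F \<Longrightarrow> U \<subseteq> T \<Longrightarrow> U = T"
    using finite_has_minimal[of ?F] by (metis empty_iff)
  have "x \<in> rel_interior T"
  proof (rule ccontr)
    assume "x \<notin> rel_interior T"
    moreover have "polyhedron T"
      using T assms(1) face_of_polytope_polytope polytope_imp_polyhedron by blast
    ultimately obtain U where U: "U facet_of T" "x \<in> U"
      using rel_boundary_of_polyhedron[of T] T by blast
    then have "U = T"
      using T face_of_imp_subset[of U T] face_of_trans[of U T S] by (intro min) (auto simp: facet_of_def)
    then show False
      using U by (simp add: facet_of_def)
  qed
  with T that show ?thesis by auto
qed

lemma borel_rel_interior:
  fixes T :: "'a::euclidean_space set"
  shows "rel_interior T \<in> sets borel"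
proof -
  obtain U where "open U" "rel_interior T = affine hull T \<inter> U"
    using openin_rel_interior[of T] by (auto simp: openin_open)
  then show ?thesis
    by (auto intro: borel_closed closed_affine_hull)
qed

text \<open>The entries are affine in \<open>s\<close>, so the determinant is a polynomial. It does not vanish on
  \<open>(0, 1]\<close>, as positivity of \<open>f\<close> makes the map injective there, and it equals
  1 at \<open>s = 1\<close>; so the absolute value can be dropped.\<close>

lemma det_segment_poly:
  fixes f :: "real^'n \<Rightarrow> real^'n"
  assumes f: "linear f" and pos: "\<And>x. 0 \<le> f x \<bullet> x"
  obtains D :: "real poly" where "degree D \<le> CARD('n)"
    and "\<And>s. 0 < s \<Longrightarrow> s \<le> 1 \<Longrightarrow> \<bar>det (matrix (\<lambda>x. s *\<^sub>R x + (1 - s) *\<^sub>R f x))\<bar> = poly D s"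
proof -
  define L where "L s x = s *\<^sub>R x + (1 - s) *\<^sub>R f x" for s x
  have L: "linear (L s)" for s
    unfolding L_def using f
    by (intro linearI) (simp_all add: linear_add linear_scale algebra_simps)
  define q :: "'n \<Rightarrow> 'n \<Rightarrow> real poly" where
    "q i j = [:matrix f $ i $ j, (if i = j then 1 else 0) - matrix f $ i $ j:]" for i j
  have entry: "matrix (L s) $ i $ j = poly (q i j) s" for s i j
    by (simp add: matrix_def L_def q_def axis_def algebra_simps)
  define D where "D = (\<Sum>p | p permutes (UNIV :: 'n set). smult (of_int (sign p)) (\<Prod>i\<in>UNIV. q i (p i)))"
  have D: "det (matrix (L s)) = poly D s" for s
    unfolding det_def D_def by (simp add: poly_sum poly_prod entry)
  have "degree D \<le> CARD('n)"
    unfolding D_def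
  proof (rule degree_sum_le)
    show "finite {p. p permutes (UNIV :: 'n set)}" by (simp add: finite_permutations)
    fix p :: "'n \<Rightarrow> 'n"
    have "degree (smult (of_int (sign p)) (\<Prod>i\<in>UNIV. q i (p i))) \<le> degree (\<Prod>i\<in>UNIV. q i (p i))"
      by (rule degree_smult_le)
    also have "\<dots> \<le> (\<Sum>i\<in>UNIV. degree (q i (p i)))"
      using degree_prod_sum_le[of UNIV "\<lambda>i. q i (p i)"] by (simp add: o_def)
    also have "\<dots> \<le> (\<Sum>i\<in>(UNIV::'n set). 1)"
      by (intro sum_mono) (simp add: q_def)
    finally show "degree (smult (of_int (sign p)) (\<Prod>i\<in>UNIV. q i (p i))) \<le> CARD('n)"
      by simp
  qed
  moreover have "\<bar>det (matrix (L s))\<bar> = poly D s" if s: "0 < s" "s \<le> 1" for s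
  proof -
    have nz: "poly D u \<noteq> 0" if u: "0 < u" "u \<le> 1" for u
    proof -
      have "x = 0" if "L u x = 0" for x
      proof -
        have "0 = L u x \<bullet> x" using that by simp
        also have "\<dots> = u * (norm x)\<^sup>2 + (1 - u) * (f x \<bullet> x)"
          by (simp add: L_def inner_add_left power2_norm_eq_inner)
        finally have "u * (norm x)\<^sup>2 \<le> 0"
          using u pos[of x] mult_nonneg_nonneg[of "1 - u" "f x \<bullet> x"] by linarith
        then show "x = 0"
          using u by (simp add: mult_le_0_iff)
      qed
      then have "inj (L u)"
        using linear_injective_0[OF L] by auto
      then show ?thesis
        using det_nz_iff_inj[OF L, of u] D[of u] by auto
    qed
    have 1: "poly D 1 = 1"
    proof -
      have "L 1 = (\<lambda>x. x)" by (auto simp: L_def)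
      then have "matrix (L 1) = mat 1"
        using matrix_id_mat_1 by (simp add: id_def)
      then show ?thesis using D[of 1] by simp
    qed
    have "poly D s > 0"
    proof (rule ccontr)
      assume "\<not> poly D s > 0"
      then have "\<exists>u\<ge>s. u \<le> 1 \<and> poly D u = 0"
        using 1 s by (intro IVT') (auto intro: continuous_on_poly)
      then show False using nz s by force
    qed
    then show ?thesis by (simp add: D)
  qed
  ultimately show ?thesis
    using that[of D] unfolding L_def[abs_def] by blast
qed

lemma compact_parallel_body:
  fixes A :: "'a::euclidean_space set"
  assumes "compact A" "A \<noteq> {}"
  shows "compact {x. infdist x A \<le> r}"
proof -
  have "closed {x. infdist x A \<le> r}"
    by (intro closed_Collect_le continuous_intros)
  moreover have "bounded {x. infdist x A \<le> r}"
  proof -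
    obtain B where B: "\<And>x. x \<in> A \<Longrightarrow> norm x \<le> B"
      using assms compact_imp_bounded bounded_iff by metis
    have "norm x \<le> B + r" if "infdist x A \<le> r" for x
    proof -
      obtain a where "a \<in> A" "infdist x A = dist x a"
        using infdist_attains_inf[OF compact_imp_closed[OF assms(1)] assms(2)] by blast
      then show ?thesis
        using that B[of a] norm_triangle_sub[of x a] by (simp add: dist_norm)
    qed
    then show ?thesis by (auto simp: bounded_iff)
  qed
  ultimately show ?thesis by (simp add: compact_eq_bounded_closed)
qed

text \<open>Contraction by the factor \<open>s\<close> towards the nearest point maps the parallel body of radius
  \<open>e\<close> bijectively onto that of radius \<open>s * e\<close>. Split space according to the
  face whose relative interior contains the nearest point: on each of the finitely many pieces the
  contraction is affine and preserves the piece, so it multiplies its volume by a determinant that is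
  polynomial in \<open>s\<close>.\<close>

lemma polytope_parallel_volume_local:
  fixes P :: "(real^'n::{finite,wellorder}) set"
  assumes P: "polytope P" "P \<noteq> {}" and e: "e > 0"
  obtains q :: "real poly" where "degree q \<le> CARD('n)"
    and "\<And>s. 0 < s \<Longrightarrow> s \<le> 1 \<Longrightarrow> measure lebesgue {x. infdist x P \<le> s * e} = poly q s"
proof -
  have cl: "closed P" and cv: "convex P" and cp: "compact P"
    using P polytope_imp_closed polytope_imp_convex polytope_imp_compact by auto
  define p where "p = closest_point P"
  define \<F> where "\<F> = {T. T face_of P \<and> T \<noteq> {}}"
  have finF: "finite \<F>"
    unfolding \<F>_def using finite_polytope_faces[OF P(1)] by (rule finite_subset[rotated]) auto
  \<comment> \<open>\<open>R T r\<close> collects the points within distance \<open>r\<close> whose nearest point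
    is relatively interior to \<open>T\<close>; \<open>F s\<close> is the contraction towards the nearest
    point.\<close>
  define R where "R T r = {x. p x \<in> rel_interior T \<and> dist x (p x) \<le> r}" for T r
  define F where "F s x = p x + s *\<^sub>R (x - p x)" for s x
  have cont_p: "continuous_on UNIV p"
    unfolding p_def using continuous_on_closest_point[OF cv cl P(2)] .
  have p_meas [measurable]: "p \<in> borel_measurable borel"
    using cont_p by (rule borel_measurable_continuous_onI)
  have par: "{x. infdist x P \<le> r} = (\<Union>T\<in>\<F>. R T r)" for r
  proof -
    have "\<exists>T\<in>\<F>. p x \<in> rel_interior T" for x
    proof -
      have "p x \<in> P" unfolding p_def using cl P by (simp add: closest_point_in_set)
      then obtain T where T: "T face_of P" "p x \<in> rel_interior T"
        using polytope_point_in_face P(1) by blast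
      then show ?thesis
        using T unfolding \<F>_def by (intro bexI[of _ T]) auto
    qed
    then show ?thesis
      by (auto simp: R_def infdist_closest_point[OF cl P(2)] p_def)
  qed
  have disj: "disjoint_family_on (\<lambda>T. R T r) \<F>" for r
  proof (unfold disjoint_family_on_def, intro ballI impI)
    fix T U assume TU: "T \<in> \<F>" "U \<in> \<F>" "T \<noteq> U"
    then have "rel_interior T \<inter> rel_interior U = {}"
      using face_of_eq[of T P U] by (auto simp: \<F>_def)
    then show "R T r \<inter> R U r = {}"
      by (auto simp: R_def)
  qed
  have bdd: "bounded {x. infdist x P \<le> r}" for r
    by (rule compact_imp_bounded[OF compact_parallel_body[OF cp P(2)]])
  have Rborel: "R T r \<in> sets borel" for T r
  proof -
    have "p -` rel_interior T \<inter> space borel \<in> sets borel"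
      using borel_rel_interior by (rule measurable_sets[OF p_meas])
    moreover have "{x \<in> space borel. dist x (p x) \<le> r} \<in> sets borel"
      by measurable
    moreover have "R T r = (p -` rel_interior T \<inter> space borel) \<inter> {x \<in> space borel. dist x (p x) \<le> r}"
      by (auto simp: R_def)
    ultimately show ?thesis by simp
  qed
  have Rm: "R T r \<in> lmeasurable" if "T \<in> \<F>" for T r
  proof -
    have "bounded (R T r)"
      by (rule bounded_subset[OF bdd[of r]]) (use that in \<open>auto simp: par\<close>)
    then show ?thesis
      using Rborel by (metis bounded_set_imp_lmeasurable sets_completionI_sets sets_lborel)
  qed
  have vol: "measure lebesgue {x. infdist x P \<le> r} = (\<Sum>T\<in>\<F>. measure lebesgue (R T r))" for r
    unfolding par using finF Rm disj[of r]
    by (intro measure_UNION') (auto simp: disjoint_family_on_def pairwise_def disjnt_def)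
  have pF: "p (F s x) = p x" if "0 \<le> s" for s x
    unfolding p_def F_def using closest_point_ray[OF cv cl P(2) that] .
  have RF: "R T (s * e) = F s ` R T e" if s: "0 < s" for T s
  proof (intro equalityI subsetI)
    fix y assume y: "y \<in> R T (s * e)"
    define x where "x = F (1 / s) y"
    have px: "p x = p y" using s by (simp add: x_def pF)
    have xy: "x - p y = (1 / s) *\<^sub>R (y - p y)"
      by (simp add: x_def F_def)
    have "dist x (p x) = (1 / s) * dist y (p y)"
      using s unfolding px dist_norm xy by simp
    also have "\<dots> \<le> e"
      using y s by (simp add: R_def field_simps)
    finally have "x \<in> R T e"
      using y by (simp add: R_def px)
    moreover have "F s x = y"
      unfolding F_def px xy using s by simp
    ultimately show "y \<in> F s ` R T e" by force
  next
    fix y assume "y \<in> F s ` R T e"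
    then obtain x where x: "y = F s x" "x \<in> R T e" by auto
    have "dist y (p y) = s * dist x (p x)"
      using s unfolding x(1) pF[OF less_imp_le[OF s]] by (simp add: F_def dist_norm)
    then show "y \<in> R T (s * e)"
      using x s pF[of s x] by (simp add: R_def)
  qed
  have "\<exists>D. degree D \<le> CARD('n) \<and>
      (\<forall>s. 0 < s \<longrightarrow> s \<le> 1 \<longrightarrow> measure lebesgue (R T (s * e)) = poly D s * measure lebesgue (R T e))"
    if T: "T \<in> \<F>" for T
  proof -
    have TP: "T \<subseteq> P" "T \<noteq> {}"
      using T by (auto simp: \<F>_def dest: face_of_imp_subset)
    then obtain a where a: "a \<in> T" by auto
    \<comment> \<open>With the base point \<open>a\<close> as origin the nearest-point map becomes the linear
      projection \<open>\<pi>\<close> onto the direction space of \<open>T\<close>.\<close>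
    define V where "V = (\<lambda>y. y - a) ` (affine hull T)"
    have aff: "a \<in> affine hull T" using a by (simp add: hull_inc)
    have "V = (+) (- a) ` (affine hull T)"
      by (auto simp: V_def)
    then have V: "subspace V"
      using affine_diffs_subspace[OF affine_affine_hull aff] by simp
    obtain B where B: "B \<subseteq> V" "pairwise orthogonal B" "\<And>b. b \<in> B \<Longrightarrow> norm b = 1"
      "independent B" "span B = V"
      by (rule orthonormal_basis_subspace[OF V]) (rule that)
    have finB: "finite B" using B(4) by (rule independent_imp_finite)
    define \<pi> where "\<pi> x = (\<Sum>b\<in>B. (x \<bullet> b) *\<^sub>R b)" for x
    have lin: "linear \<pi>"
      unfolding \<pi>_def by (rule linear_orthonormal_projection)
    have pos: "0 \<le> \<pi> x \<bullet> x" for x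
      unfolding \<pi>_def inner_sum_left by (intro sum_nonneg) (simp add: inner_commute)
    obtain D :: "real poly" where D: "degree D \<le> CARD('n)"
      "\<And>s. 0 < s \<Longrightarrow> s \<le> 1 \<Longrightarrow> \<bar>det (matrix (\<lambda>x. s *\<^sub>R x + (1 - s) *\<^sub>R \<pi> x))\<bar> = poly D s"
      by (rule det_segment_poly[OF lin pos]) (rule that)
    have proj: "\<pi> (x - a) = p x - a" if x: "x \<in> R T e" for x
      unfolding \<pi>_def
    proof (rule orthonormal_projection_eq[OF finB B(2,3)])
      have "p x \<in> affine hull T"
        using x rel_interior_subset[of T] hull_subset[of T affine] by (auto simp: R_def)
      then show "p x - a \<in> span B"
        unfolding B(5) V_def by auto
      fix b assume "b \<in> B"
      then obtain y where y: "y \<in> affine hull T" "b = y - a"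
        using B(1) by (auto simp: V_def)
      have "(x - p x) \<bullet> (y - p x) = 0" "(x - p x) \<bullet> (a - p x) = 0"
        using closest_point_relative_interior_orthogonal[OF cv cl TP(1), of x] x aff y(1)
        by (simp_all add: R_def p_def)
      then show "orthogonal (x - a - (p x - a)) b"
        by (simp add: orthogonal_def y(2) inner_diff_right)
    qed
    have "measure lebesgue (R T (s * e)) = poly D s * measure lebesgue (R T e)"
      if s: "0 < s" "s \<le> 1" for s
    proof -
      define L where "L x = s *\<^sub>R x + (1 - s) *\<^sub>R \<pi> x" for x
      have L: "linear L"
        unfolding L_def using lin by (intro linearI) (simp_all add: linear_add linear_scale algebra_simps)
      have "F s x = a + L (x - a)" if "x \<in> R T e" for x
        by (simp add: L_def proj[OF that] F_def algebra_simps)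
      then have "F s ` R T e = (+) a ` L ` (+) (- a) ` R T e"
        by (auto simp: image_iff)
      then have "measure lebesgue (F s ` R T e) = measure lebesgue (L ` (+) (- a) ` R T e)"
        by (simp only: measure_translation)
      also have "\<dots> = \<bar>det (matrix L)\<bar> * measure lebesgue ((+) (- a) ` R T e)"
        using L Rm[OF T] by (intro measure_linear_image measurable_translation)
      also have "\<dots> = poly D s * measure lebesgue (R T e)"
        using D(2)[OF s] by (simp only: measure_translation) (simp add: L_def[abs_def])
      finally show ?thesis by (simp add: RF s)
    qed
    with D(1) show ?thesis by blast
  qed
  then obtain D where D: "\<And>T. T \<in> \<F> \<Longrightarrow> degree (D T) \<le> CARD('n)"
    "\<And>T s. T \<in> \<F> \<Longrightarrow> 0 < s \<Longrightarrow> s \<le> 1 \<Longrightarrow>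
       measure lebesgue (R T (s * e)) = poly (D T) s * measure lebesgue (R T e)"
    by metis
  show ?thesis
  proof (rule that)
    show "degree (\<Sum>T\<in>\<F>. smult (measure lebesgue (R T e)) (D T)) \<le> CARD('n)"
      using finF D(1) by (intro degree_sum_le) (auto intro: order_trans[OF degree_smult_le])
    show "measure lebesgue {x. infdist x P \<le> s * e} = poly (\<Sum>T\<in>\<F>. smult (measure lebesgue (R T e)) (D T)) s"
      if "0 < s" "s \<le> 1" for s
      using that by (simp add: vol poly_sum D(2) mult.commute[of _ "poly _ _"] cong: sum.cong)
  qed
qed

lemma poly_eq_if_infinitely_many:
  fixes p q :: "real poly"
  assumes "infinite {x. poly p x = poly q x}"
  shows "p = q"
proof (rule ccontr)
  assume "p \<noteq> q"
  then have "finite {x. poly (p - q) x = 0}"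
    by (intro poly_roots_finite) auto
  with assms show False by simp
qed

text \<open>The polynomials obtained on the intervals \<open>(0, e]\<close> agree on \<open>(0, 1]\<close>, hence
  are all the same.\<close>

lemma polytope_parallel_volume:
  fixes P :: "(real^'n::{finite,wellorder}) set"
  assumes P: "polytope P" "P \<noteq> {}"
  obtains q :: "real poly" where "degree q \<le> CARD('n)"
    and "\<And>r. r > 0 \<Longrightarrow> measure lebesgue {x. infdist x P \<le> r} = poly q r"
proof -
  let ?f = "\<lambda>r. measure lebesgue {x. infdist x P \<le> r}"
  have "\<exists>q. degree q \<le> CARD('n) \<and> (\<forall>r. 0 < r \<longrightarrow> r \<le> e \<longrightarrow> ?f r = poly q r)" if e: "e > 0" for e :: real
  proof -
    obtain q :: "real poly" where q: "degree q \<le> CARD('n)"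
      "\<And>s. 0 < s \<Longrightarrow> s \<le> 1 \<Longrightarrow> ?f (s * e) = poly q s"
      by (rule polytope_parallel_volume_local[OF P e]) (rule that)
    have "degree (q \<circ>\<^sub>p [:0, 1 / e:]) \<le> CARD('n)"
      using q(1) e by (simp add: degree_pcompose)
    moreover have "?f r = poly (q \<circ>\<^sub>p [:0, 1 / e:]) r" if "0 < r" "r \<le> e" for r
      using q(2)[of "r / e"] that e by (simp add: poly_pcompose)
    ultimately show ?thesis by blast
  qed
  then obtain q where q: "\<And>e. e > 0 \<Longrightarrow> degree (q e) \<le> CARD('n)"
    "\<And>e r. 0 < r \<Longrightarrow> r \<le> e \<Longrightarrow> ?f r = poly (q e) r"
    by (metis order.strict_trans2)
  have same: "q e = q 1" if "e \<ge> 1" for e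
  proof (rule poly_eq_if_infinitely_many)
    have "{0<..1::real} \<subseteq> {x. poly (q e) x = poly (q 1) x}"
      using q(2)[of _ e] q(2)[of _ 1] that by force
    then show "infinite {x. poly (q e) x = poly (q 1) x}"
      by (rule infinite_super) (simp add: infinite_Ioc)
  qed
  have "?f r = poly (q 1) r" if "r > 0" for r
    using q(2)[of r "max 1 r"] same[of "max 1 r"] that by simp
  then show ?thesis
    by (rule that[OF q(1)[OF zero_less_one]])
qed

section \<open>The parallel volume of a compact convex set\<close>

text \<open>Used to see that a pointwise limit of polynomials of bounded degree is again such a polynomial: the
  formula expresses every value through the values at \<open>1, \<dots>, n + 1\<close>.\<close>

lemma lagrange_interpolation:
  obtains L :: "nat \<Rightarrow> real poly" where "\<And>k. k \<le> n \<Longrightarrow> degree (L k) \<le> n"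
    and "\<And>(p::real poly) x. degree p \<le> n \<Longrightarrow> poly p x = (\<Sum>k\<le>n. poly p (real (Suc k)) * poly (L k) x)"
proof -
  define L :: "nat \<Rightarrow> real poly" where
    "L k = (\<Prod>j\<in>{..n} - {k}. smult (1 / (real k - real j)) [:- real (Suc j), 1:])" for k
  have deg: "degree (L k) \<le> n" if "k \<le> n" for k
  proof -
    have "degree (L k) \<le> (\<Sum>j\<in>{..n} - {k}. degree (smult (1 / (real k - real j)) [:- real (Suc j), 1:]))"
      unfolding L_def using degree_prod_sum_le[of "{..n} - {k}"
          "\<lambda>j. smult (1 / (real k - real j)) [:- real (Suc j), 1:]"] by (simp add: o_def)
    also have "\<dots> \<le> (\<Sum>j\<in>{..n} - {k}. 1)"
      by (intro sum_mono order_trans[OF degree_smult_le]) simp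
    also have "\<dots> = n"
      using that by (simp add: card_Diff_singleton)
    finally show ?thesis .
  qed
  have val: "poly (L k) (real (Suc i)) = (if i = k then 1 else 0)" if "i \<le> n" for i k
  proof (cases "i = k")
    case True
    have "poly (smult (1 / (real k - real j)) [:- real (Suc j), 1:]) (real (Suc k)) = 1" if "j \<noteq> k" for j
    proof -
      have "real k - real j \<noteq> 0" using that by simp
      then show ?thesis by (simp add: divide_simps)
    qed
    then show ?thesis
      unfolding L_def poly_prod using True by (auto intro!: prod.neutral)
  next
    case False
    then have "\<exists>j\<in>{..n} - {k}. poly (smult (1 / (real k - real j)) [:- real (Suc j), 1:]) (real (Suc i)) = 0"
      using that by (intro bexI[of _ i]) (auto simp: field_simps)
    then show ?thesis
      unfolding L_def poly_prod using False by (auto intro: prod_zero)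
  qed
  have "poly p x = (\<Sum>k\<le>n. poly p (real (Suc k)) * poly (L k) x)" if p: "degree p \<le> n"
    for p :: "real poly" and x
  proof -
    define d where "d = p - (\<Sum>k\<le>n. smult (poly p (real (Suc k))) (L k))"
    have "degree (\<Sum>k\<le>n. smult (poly p (real (Suc k))) (L k)) \<le> n"
      by (intro degree_sum_le) (auto intro!: order_trans[OF degree_smult_le] deg)
    then have dn: "degree d \<le> n"
      unfolding d_def using p by (intro degree_diff_le)
    have "d = 0"
    proof (rule ccontr)
      assume nz: "d \<noteq> 0"
      have "poly d (real (Suc i)) = 0" if "i \<le> n" for i
      proof -
        have "(\<Sum>k\<le>n. poly p (real (Suc k)) * poly (L k) (real (Suc i)))
            = (\<Sum>k\<le>n. if k = i then poly p (real (Suc i)) else 0)"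
          using val[OF that] by (intro sum.cong) (auto simp del: of_nat_Suc)
        then show ?thesis
          using that by (simp add: d_def poly_sum del: of_nat_Suc)
      qed
      then have "(\<lambda>i. real (Suc i)) ` {..n} \<subseteq> {x. poly d x = 0}" by auto
      then have "card ((\<lambda>i. real (Suc i)) ` {..n}) \<le> degree d"
        using card_poly_roots_bound[OF nz] card_mono[OF poly_roots_finite[OF nz]] by (meson order_trans)
      moreover have "card ((\<lambda>i. real (Suc i)) ` {..n}) = Suc n"
        by (subst card_image) (auto simp: inj_on_def)
      ultimately show False using dn by simp
    qed
    then have "poly p x = poly (\<Sum>k\<le>n. smult (poly p (real (Suc k))) (L k)) x"
      by (simp add: d_def)
    then show ?thesis by (simp add: poly_sum)
  qed
  with deg that show ?thesis by blast
qed

lemma parallel_body_eq_Union_cball: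
  fixes A :: "'a::euclidean_space set"
  assumes "compact A" "A \<noteq> {}"
  shows "(\<Union>x\<in>A. cball x r) = {x. infdist x A \<le> r}"
proof (intro equalityI subsetI)
  fix x assume "x \<in> {x. infdist x A \<le> r}"
  moreover obtain a where "a \<in> A" "infdist x A = dist x a"
    using infdist_attains_inf[OF compact_imp_closed[OF assms(1)] assms(2)] by blast
  ultimately show "x \<in> (\<Union>x\<in>A. cball x r)"
    by (auto simp: dist_commute)
next
  fix x assume "x \<in> (\<Union>x\<in>A. cball x r)"
  then show "x \<in> {x. infdist x A \<le> r}"
    by (auto simp: dist_commute intro: infdist_le2)
qed

lemma infdist_le_infdist_add:
  fixes A B :: "'a::euclidean_space set"
  assumes "compact B" "B \<noteq> {}" "A \<noteq> {}" "\<And>b. b \<in> B \<Longrightarrow> infdist b A \<le> d"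
  shows "infdist x A \<le> infdist x B + d"
proof -
  obtain b where b: "b \<in> B" "infdist x B = dist x b"
    using infdist_attains_inf[OF compact_imp_closed[OF assms(1)] assms(2)] by blast
  have "infdist x A \<le> infdist b A + dist x b"
    using infdist_triangle[of x A b] .
  then show ?thesis using b assms(4)[of b] by simp
qed

text \<open>Moving outwards along the ray from the nearest point increases the distance, so the level set lies in
  the frontier of a convex set.\<close>

lemma negligible_parallel_surface:
  fixes A :: "'a::euclidean_space set"
  assumes "compact A" "convex A" "A \<noteq> {}" "r > 0"
  shows "negligible {x. infdist x A = r}"
proof -
  have cl: "closed A" using assms compact_imp_closed by auto
  let ?D = "{x. infdist x A \<le> r}"
  have "convex ?D"
  proof -
    have "?D = (\<Union>x\<in>A. \<Union>y\<in>cball 0 r. {x + y})"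
      unfolding parallel_body_eq_Union_cball[OF assms(1,3), symmetric]
    proof (intro equalityI subsetI)
      fix z assume "z \<in> (\<Union>x\<in>A. cball x r)"
      then obtain x where "x \<in> A" "z \<in> cball x r" by auto
      then show "z \<in> (\<Union>x\<in>A. \<Union>y\<in>cball 0 r. {x + y})"
        by (intro UN_I[of x] UN_I[of "z - x"]) (auto simp: dist_norm norm_minus_commute)
    next
      fix z assume "z \<in> (\<Union>x\<in>A. \<Union>y\<in>cball 0 r. {x + y})"
      then obtain x y where "x \<in> A" "y \<in> cball 0 r" "z = x + y" by auto
      then show "z \<in> (\<Union>x\<in>A. cball x r)"
        by (intro UN_I[of x]) (auto simp: dist_norm)
    qed
    also have "convex \<dots>"
      using assms(2) by (intro convex_sums convex_cball)
    finally show ?thesis .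
  qed
  then have "negligible (frontier ?D)" by (rule negligible_convex_frontier)
  moreover have "{x. infdist x A = r} \<subseteq> frontier ?D"
  proof
    fix x assume x: "x \<in> {x. infdist x A = r}"
    have "x \<notin> interior ?D"
    proof
      assume "x \<in> interior ?D"
      then obtain e where e: "e > 0" "ball x e \<subseteq> ?D"
        by (auto simp: mem_interior)
      define p where "p = closest_point A x"
      have d: "dist x p = r"
        using x infdist_closest_point[OF cl assms(3), of x] by (simp add: p_def)
      define t where "t = e / (2 * r)"
      have t: "t > 0" using e assms by (simp add: t_def)
      define y where "y = p + (1 + t) *\<^sub>R (x - p)"
      have "y - x = t *\<^sub>R (x - p)"
        by (simp add: y_def algebra_simps)
      then have "dist x y = t * r"
        using d t by (simp add: dist_norm norm_minus_commute[of x y])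
      also have "\<dots> < e" using e assms by (simp add: t_def)
      finally have "y \<in> ?D" using e by auto
      moreover have "closest_point A y = p"
        unfolding y_def p_def using t assms cl by (intro closest_point_ray) auto
      then have "infdist y A = dist y p"
        using infdist_closest_point[OF cl assms(3), of y] by simp
      moreover have "dist y p = (1 + t) * r"
        using d t by (simp add: y_def dist_norm)
      ultimately show False using t assms by simp
    qed
    moreover have "closed ?D"
      by (intro closed_Collect_le continuous_intros)
    ultimately show "x \<in> frontier ?D"
      using x by (simp add: frontier_def)
  qed
  ultimately show ?thesis by (rule negligible_subset)
qed

lemma lmeasurable_parallel_body:
  fixes A :: "'a::euclidean_space set"
  assumes "compact A" "A \<noteq> {}"
  shows "{x. infdist x A \<le> r} \<in> lmeasurable"
  using compact_parallel_body[OF assms] by (rule lmeasurable_compact)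

lemma polytope_inner_approximation:
  fixes A :: "'a::euclidean_space set"
  assumes "compact A" "convex A" "A \<noteq> {}" "e > 0"
  obtains P where "polytope P" "P \<noteq> {}" "P \<subseteq> A" "\<And>a. a \<in> A \<Longrightarrow> infdist a P \<le> e"
proof -
  obtain F where F: "finite F" "F \<subseteq> A" "A \<subseteq> (\<Union>x\<in>F. ball x e)"
  proof (rule compactE_image[OF assms(1), of A "\<lambda>x. ball x e"])
    show "A \<subseteq> (\<Union>x\<in>A. ball x e)" using assms(4) by auto
  qed auto
  have "convex hull F \<subseteq> A" using F assms(2) by (simp add: hull_minimal)
  moreover have "infdist a (convex hull F) \<le> e" if a: "a \<in> A" for a
  proof -
    obtain x where "x \<in> F" "dist x a < e" using F a by auto
    then show ?thesis
      by (intro infdist_le2[of x]) (auto simp: hull_inc dist_commute)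
  qed
  moreover have "convex hull F \<noteq> {}" using F assms by auto
  ultimately show ?thesis
    using F that[of "convex hull F"] by (auto simp: polytope_def)
qed

text \<open>Inscribed polytopes \<open>P\<close> with \<open>A\<close> inside their
  \<open>1 / i\<close>-neighbourhood satisfy
  \<open>f\<^sub>A (r - 1 / i) \<le> f\<^sub>P r \<le> f\<^sub>A r\<close> for the parallel
  volumes, and \<open>f\<^sub>A\<close> is left continuous; so the parallel volume of \<open>A\<close> is
  a limit of polynomials of bounded degree.\<close>

lemma parallel_volume_poly_wellorder:
  fixes A :: "(real^'n::{finite,wellorder}) set"
  assumes A: "compact A" "convex A" "A \<noteq> {}"
  obtains q :: "real poly" where "degree q \<le> CARD('n)"
    and "\<And>r. r \<ge> 0 \<Longrightarrow> measure lebesgue {x. infdist x A \<le> r} = poly q r"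
proof -
  let ?f = "\<lambda>A r. measure lebesgue {x::real^'n::{finite,wellorder}. infdist x A \<le> r}"
  have "\<exists>P. polytope P \<and> P \<noteq> {} \<and> P \<subseteq> A \<and> (\<forall>a\<in>A. infdist a P \<le> 1 / real (Suc i))" for i
    by (rule polytope_inner_approximation[OF A, of "1 / real (Suc i)"]) auto
  then obtain P where P: "\<And>i. polytope (P i)" "\<And>i. P i \<noteq> {}" "\<And>i. P i \<subseteq> A"
    "\<And>i a. a \<in> A \<Longrightarrow> infdist a (P i) \<le> 1 / real (Suc i)"
    by metis
  have lim: "(\<lambda>i. ?f (P i) r) \<longlonglongrightarrow> ?f A r" if r: "r > 0" for r
  proof (rule tendsto_sandwich)
    show "\<forall>\<^sub>F i in sequentially. ?f A (r - 1 / real (Suc i)) \<le> ?f (P i) r"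
    proof (intro always_eventually allI measure_mono_fmeasurable)
      fix i
      show "{x. infdist x A \<le> r - 1 / real (Suc i)} \<subseteq> {x. infdist x (P i) \<le> r}"
      proof
        fix x assume "x \<in> {x. infdist x A \<le> r - 1 / real (Suc i)}"
        moreover have "infdist x (P i) \<le> infdist x A + 1 / real (Suc i)"
          by (rule infdist_le_infdist_add[OF A(1,3) P(2) P(4)])
        ultimately show "x \<in> {x. infdist x (P i) \<le> r}" by simp
      qed
      show "{x. infdist x A \<le> r - 1 / real (Suc i)} \<in> sets lebesgue"
        using lmeasurable_parallel_body[OF A(1,3)] by (rule fmeasurableD)
      show "{x. infdist x (P i) \<le> r} \<in> lmeasurable"
        by (intro lmeasurable_parallel_body polytope_imp_compact P)
    qed
    show "\<forall>\<^sub>F i in sequentially. ?f (P i) r \<le> ?f A r"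
    proof (intro always_eventually allI measure_mono_fmeasurable)
      fix i
      show "{x. infdist x (P i) \<le> r} \<subseteq> {x. infdist x A \<le> r}"
      proof
        fix x assume "x \<in> {x. infdist x (P i) \<le> r}"
        then show "x \<in> {x. infdist x A \<le> r}"
          using infdist_mono[OF P(3)[of i] P(2)[of i], of x] by simp
      qed
      show "{x. infdist x (P i) \<le> r} \<in> sets lebesgue"
        by (intro fmeasurableD lmeasurable_parallel_body polytope_imp_compact P)
      show "{x. infdist x A \<le> r} \<in> lmeasurable"
        by (intro lmeasurable_parallel_body A)
    qed
    have "(\<lambda>i. ?f A (r - 1 / real (Suc i))) \<longlonglongrightarrow> measure lebesgue (\<Union>i. {x. infdist x A \<le> r - 1 / real (Suc i)})"
    proof (rule Lim_measure_incseq)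
      show "range (\<lambda>i. {x. infdist x A \<le> r - 1 / real (Suc i)}) \<subseteq> sets lebesgue"
        using fmeasurableD[OF lmeasurable_parallel_body[OF A(1,3)]] by auto
      show "incseq (\<lambda>i. {x. infdist x A \<le> r - 1 / real (Suc i)})"
      proof (rule incseq_SucI, safe)
        fix i x assume "infdist x A \<le> r - 1 / real (Suc i)"
        moreover have "1 / real (Suc (Suc i)) \<le> 1 / real (Suc i)"
          by (intro divide_left_mono) auto
        ultimately show "infdist x A \<le> r - 1 / real (Suc (Suc i))" by linarith
      qed
      have "(\<Union>i. {x. infdist x A \<le> r - 1 / real (Suc i)}) \<subseteq> {x. infdist x A \<le> r}"
      proof safe
        fix x i assume "infdist x A \<le> r - 1 / real (Suc i)"
        moreover have "0 \<le> 1 / real (Suc i)" by simp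
        ultimately show "infdist x A \<le> r" by linarith
      qed
      then have "emeasure lebesgue (\<Union>i. {x. infdist x A \<le> r - 1 / real (Suc i)})
          \<le> emeasure lebesgue {x. infdist x A \<le> r}"
        by (intro emeasure_mono fmeasurableD lmeasurable_parallel_body A)
      also have "\<dots> < \<infinity>"
        using lmeasurable_parallel_body[OF A(1,3)] by (simp add: fmeasurable_def del: emeasure_completion)
      finally show "emeasure lebesgue (\<Union>i. {x. infdist x A \<le> r - 1 / real (Suc i)}) \<noteq> \<infinity>" by simp
    qed
    also have "(\<Union>i. {x. infdist x A \<le> r - 1 / real (Suc i)}) = {x. infdist x A < r}"
    proof safe
      fix x i assume "infdist x A \<le> r - 1 / real (Suc i)"
      moreover have "0 < 1 / real (Suc i)" by simp
      ultimately show "infdist x A < r" by linarith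
    next
      fix x assume "infdist x A < r"
      then have "0 < r - infdist x A" by simp
      then obtain i where "1 / real (Suc i) < r - infdist x A"
        by (rule nat_approx_posE)
      then have "infdist x A \<le> r - 1 / real (Suc i)" by linarith
      then show "x \<in> (\<Union>i. {x. infdist x A \<le> r - 1 / real (Suc i)})" by blast
    qed
    also have "measure lebesgue {x. infdist x A < r} = ?f A r"
    proof (rule measure_negligible_symdiff[symmetric])
      have "open {x. infdist x A < r}"
        by (intro open_Collect_less continuous_intros)
      moreover have "bounded {x. infdist x A < r}"
        by (rule bounded_subset[OF compact_imp_bounded[OF compact_parallel_body[OF A(1,3), of r]]]) auto
      ultimately show "{x. infdist x A < r} \<in> lmeasurable"
        by (rule lmeasurable_open[rotated])
      have "({x. infdist x A < r} - {x. infdist x A \<le> r}) \<union> ({x. infdist x A \<le> r} - {x. infdist x A < r})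
          \<subseteq> {x. infdist x A = r}" by auto
      then show "negligible (({x. infdist x A < r} - {x. infdist x A \<le> r}) \<union> ({x. infdist x A \<le> r} - {x. infdist x A < r}))"
        by (rule negligible_subset[OF negligible_parallel_surface[OF A r]])
    qed
    finally show "(\<lambda>i. ?f A (r - 1 / real (Suc i))) \<longlonglongrightarrow> ?f A r" .
  qed simp
  let ?n = "CARD('n)"
  obtain L :: "nat \<Rightarrow> real poly" where L: "\<And>k. k \<le> ?n \<Longrightarrow> degree (L k) \<le> ?n"
    and Leq: "\<And>(p::real poly) x. degree p \<le> ?n \<Longrightarrow> poly p x = (\<Sum>k\<le>?n. poly p (real (Suc k)) * poly (L k) x)"
    by (rule lagrange_interpolation[of ?n]) (rule that)
  define q where "q = (\<Sum>k\<le>?n. smult (?f A (real (Suc k))) (L k))"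
  have deg: "degree q \<le> ?n"
    unfolding q_def by (intro degree_sum_le) (auto intro!: order_trans[OF degree_smult_le] L)
  have pos: "?f A r = poly q r" if r: "r > 0" for r
  proof -
    have eq: "?f (P i) r = (\<Sum>k\<le>?n. ?f (P i) (real (Suc k)) * poly (L k) r)" for i
    proof -
      obtain p :: "real poly" where p: "degree p \<le> ?n" "\<And>r. r > 0 \<Longrightarrow> ?f (P i) r = poly p r"
        by (rule polytope_parallel_volume[OF P(1,2)[of i]]) (rule that)
      show ?thesis
        using Leq[OF p(1), of r] r by (simp add: p(2))
    qed
    have "(\<lambda>i. \<Sum>k\<le>?n. ?f (P i) (real (Suc k)) * poly (L k) r)
        \<longlonglongrightarrow> (\<Sum>k\<le>?n. ?f A (real (Suc k)) * poly (L k) r)"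
      by (intro tendsto_intros lim) auto
    then have "(\<lambda>i. ?f (P i) r) \<longlonglongrightarrow> poly q r"
      by (simp add: eq[symmetric] q_def poly_sum del: of_nat_Suc)
    then show ?thesis
      by (rule LIMSEQ_unique[OF lim[OF r]])
  qed
  have zero: "?f A 0 = poly q 0"
  proof -
    have "(\<lambda>i. ?f A (1 / real (Suc i))) \<longlonglongrightarrow> measure lebesgue (\<Inter>i. {x. infdist x A \<le> 1 / real (Suc i)})"
    proof (rule Lim_measure_decseq)
      show "range (\<lambda>i. {x. infdist x A \<le> 1 / real (Suc i)}) \<subseteq> sets lebesgue"
        using fmeasurableD[OF lmeasurable_parallel_body[OF A(1,3)]] by auto
      show "decseq (\<lambda>i. {x. infdist x A \<le> 1 / real (Suc i)})"
      proof (rule decseq_SucI, safe)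
        fix i x assume "infdist x A \<le> 1 / real (Suc (Suc i))"
        moreover have "1 / real (Suc (Suc i)) \<le> 1 / real (Suc i)"
          by (intro divide_left_mono) auto
        ultimately show "infdist x A \<le> 1 / real (Suc i)" by linarith
      qed
      show "emeasure lebesgue {x. infdist x A \<le> 1 / real (Suc i)} \<noteq> \<infinity>" for i
        using lmeasurable_parallel_body[OF A(1,3)] by (simp add: fmeasurableD2 del: emeasure_completion)
    qed
    also have "(\<Inter>i. {x. infdist x A \<le> 1 / real (Suc i)}) = {x. infdist x A \<le> 0}"
    proof (intro equalityI subsetI)
      fix x assume x: "x \<in> (\<Inter>i. {x. infdist x A \<le> 1 / real (Suc i)})"
      have "infdist x A \<le> 0"
      proof (rule ccontr)
        assume "\<not> infdist x A \<le> 0"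
        then have "0 < infdist x A" by simp
        then obtain i where "1 / real (Suc i) < infdist x A"
          by (rule nat_approx_posE)
        moreover have "infdist x A \<le> 1 / real (Suc i)" using x by blast
        ultimately show False by linarith
      qed
      then show "x \<in> {x. infdist x A \<le> 0}" by simp
    next
      fix x assume "x \<in> {x. infdist x A \<le> 0}"
      then have "infdist x A \<le> 1 / real (Suc i)" for i
        using order_trans[of "infdist x A" 0 "1 / real (Suc i)"] by simp
      then show "x \<in> (\<Inter>i. {x. infdist x A \<le> 1 / real (Suc i)})" by blast
    qed
    finally have "(\<lambda>i. poly q (1 / real (Suc i))) \<longlonglongrightarrow> ?f A 0"
      by (simp add: pos del: of_nat_Suc)
    moreover have "(\<lambda>i. poly q (1 / real (Suc i))) \<longlonglongrightarrow> poly q 0"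
      by (intro tendsto_poly LIMSEQ_Suc[OF lim_1_over_n])
    ultimately show ?thesis by (rule LIMSEQ_unique)
  qed
  show ?thesis
  proof (rule that[OF deg])
    fix r :: real assume "r \<ge> 0"
    then show "?f A r = poly q r"
      using pos[of r] zero by (cases "r = 0") auto
  qed
qed

section \<open>Passing to a well-ordered index type\<close>

text \<open>A copy of the index type that is well-ordered by rank. Relabelling the coordinates by it is an isometry
  that preserves Lebesgue measure, so results proved for well-ordered index types carry over to all
  finite ones.\<close>

typedef ('n::finite) ranked = "{..<CARD('n)}"
  by (rule exI[of _ 0]) simp

instance ranked :: (finite) finite
proof
  have "finite (Rep_ranked ` (UNIV :: 'a ranked set))"
    by (rule finite_subset[of _ "{..<CARD('a)}"]) (use Rep_ranked in auto)
  then show "finite (UNIV :: 'a ranked set)"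
    by (rule finite_imageD) (simp add: inj_on_def Rep_ranked_inject)
qed

instantiation ranked :: (finite) wellorder
begin

definition "x \<le> y \<longleftrightarrow> Rep_ranked x \<le> Rep_ranked y"
definition "x < y \<longleftrightarrow> Rep_ranked x < Rep_ranked y"

instance
proof
  fix P :: "'a ranked \<Rightarrow> bool" and a :: "'a ranked"
  assume *: "\<And>x. (\<And>y. y < x \<Longrightarrow> P y) \<Longrightarrow> P x"
  show "P a"
  proof (induction "Rep_ranked a" arbitrary: a rule: less_induct)
    case less
    show ?case
      by (rule *, rule less) (simp add: less_ranked_def)
  qed
qed (auto simp: less_eq_ranked_def less_ranked_def Rep_ranked_inject)

end

lemma card_ranked: "CARD(('n::finite) ranked) = CARD('n)"
  using type_definition.card[OF type_definition_ranked] by simp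

definition unrank :: "'n::finite ranked \<Rightarrow> 'n" where
  "unrank = (SOME g. bij g)"

lemma bij_unrank: "bij (unrank :: 'n::finite ranked \<Rightarrow> 'n)"
proof -
  have "\<exists>g :: 'n ranked \<Rightarrow> 'n. bij g"
    using finite_same_card_bij[of "UNIV :: 'n ranked set" "UNIV :: 'n set"] by (simp add: card_ranked)
  then show ?thesis
    unfolding unrank_def by (rule someI_ex)
qed

definition relabel :: "real^'n \<Rightarrow> real^('n::finite ranked)" where
  "relabel x = (\<chi> i. x $ unrank i)"

lemma inner_relabel: "relabel x \<bullet> relabel y = x \<bullet> y"
proof -
  have "relabel x \<bullet> relabel y = (\<Sum>i\<in>UNIV. x $ unrank i * y $ unrank i)"
    by (simp add: inner_vec_def relabel_def)
  also have "\<dots> = (\<Sum>j\<in>UNIV. x $ j * y $ j)"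
    using sum.reindex_bij_betw[OF bij_unrank, of "\<lambda>j. x $ j * y $ j"] .
  finally show ?thesis by (simp add: inner_vec_def)
qed

lemma linear_relabel: "linear relabel"
  by (intro linearI) (simp_all add: relabel_def vec_eq_iff)

lemma dist_relabel: "dist (relabel x) (relabel y) = dist x y"
  by (simp add: dist_norm linear_diff[OF linear_relabel, symmetric] norm_eq_sqrt_inner inner_relabel)

lemma surj_relabel: "surj relabel"
proof (rule surjI)
  fix y :: "real^('n::finite ranked)"
  show "relabel (\<chi> j. y $ inv unrank j) = y"
    by (simp add: relabel_def vec_eq_iff inv_f_f[OF bij_is_inj[OF bij_unrank]])
qed

lemma prod_Basis_vec: "(\<Prod>b\<in>Basis. (z::real^'n) \<bullet> b) = (\<Prod>i\<in>UNIV. z $ i)"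
proof -
  have "(Basis :: (real^'n) set) = range (\<lambda>i. axis i 1)"
    by (auto simp: Basis_vec_def)
  moreover have "inj (\<lambda>i::'n. axis i (1::real))"
    by (auto simp: inj_def axis_eq_axis)
  ultimately have "prod ((\<bullet>) z) Basis = prod ((\<bullet>) z \<circ> (\<lambda>i. axis i 1)) UNIV"
    by (metis prod.reindex)
  then show ?thesis
    by (simp add: inner_axis)
qed

lemma continuous_relabel: "continuous_on UNIV relabel"
  by (rule linear_continuous_on) (simp add: linear_conv_bounded_linear[symmetric] linear_relabel)

lemma measurable_relabel [measurable]: "relabel \<in> borel_measurable borel"
  by (rule borel_measurable_continuous_onI[OF continuous_relabel])

lemma distr_relabel: "distr lborel borel (relabel :: real^'n \<Rightarrow> _) = lborel"
proof (rule lborel_eqI[symmetric])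
  fix l u :: "real^('n ranked)"
  assume le: "\<And>b. b \<in> Basis \<Longrightarrow> l \<bullet> b \<le> u \<bullet> b"
  have le': "l $ i \<le> u $ i" for i
    using le[of "axis i 1"] by (auto simp: Basis_vec_def inner_axis)
  define l' u' :: "real^'n" where "l' = (\<chi> j. l $ inv unrank j)" and "u' = (\<chi> j. u $ inv unrank j)"
  have ii: "inv unrank (unrank i) = i" for i :: "'n ranked"
    by (rule inv_f_f[OF bij_is_inj[OF bij_unrank]])
  have uu: "unrank (inv unrank j) = j" for j :: 'n
    by (rule surj_f_inv_f[OF bij_is_surj[OF bij_unrank]])
  have vim: "relabel -` box l u = box l' u'"
  proof (intro equalityI subsetI)
    fix x :: "real^'n" assume x: "x \<in> relabel -` box l u"
    have "l' $ j < x $ j \<and> x $ j < u' $ j" for j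
      using x by (auto simp: mem_box_cart relabel_def l'_def u'_def uu dest: spec[of _ "inv unrank j"])
    then show "x \<in> box l' u'" by (simp add: mem_box_cart)
  next
    fix x :: "real^'n" assume x: "x \<in> box l' u'"
    have "l $ i < x $ unrank i \<and> x $ unrank i < u $ i" for i
      using x by (auto simp: mem_box_cart l'_def u'_def ii dest: spec[of _ "unrank i"])
    then show "x \<in> relabel -` box l u" by (simp add: mem_box_cart relabel_def)
  qed
  have "emeasure (distr lborel borel relabel) (box l u) = emeasure lborel (box l' u')"
    by (subst emeasure_distr) (auto simp: vim)
  also have "\<dots> = (\<Prod>b\<in>Basis. (u' - l') \<bullet> b)"
    by (rule emeasure_lborel_box) (auto simp: Basis_vec_def inner_axis l'_def u'_def le')
  also have "(\<Prod>b\<in>Basis. (u' - l') \<bullet> b) = (\<Prod>i\<in>UNIV. (u - l) $ (inv unrank i))"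
    unfolding prod_Basis_vec by (simp add: l'_def u'_def)
  also have "\<dots> = (\<Prod>i\<in>UNIV. (u - l) $ i)"
    using prod.reindex_bij_betw[OF bij_imp_bij_inv[OF bij_unrank], of "\<lambda>i. (u - l) $ i"] .
  also have "\<dots> = (\<Prod>b\<in>Basis. (u - l) \<bullet> b)"
    by (rule prod_Basis_vec[symmetric])
  finally show "emeasure (distr lborel borel (relabel :: real^'n \<Rightarrow> _)) (box l u) = (\<Prod>b\<in>Basis. (u - l) \<bullet> b)" .
qed simp

lemma parallel_volume_poly:
  fixes A :: "(real^'n) set"
  assumes A: "compact A" "convex A" "A \<noteq> {}"
  obtains q :: "real poly" where "degree q \<le> CARD('n)"
    and "\<And>r. r \<ge> 0 \<Longrightarrow> measure lebesgue {x. infdist x A \<le> r} = poly q r"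
proof -
  have A': "compact (relabel ` A)" "convex (relabel ` A)" "relabel ` A \<noteq> {}"
    using A continuous_on_subset[OF continuous_relabel, of A]
    by (auto intro!: compact_continuous_image convex_linear_image linear_relabel)
  obtain q :: "real poly" where q: "degree q \<le> CARD('n ranked)"
    "\<And>r. r \<ge> 0 \<Longrightarrow> measure lebesgue {x. infdist x (relabel ` A) \<le> r} = poly q r"
    by (rule parallel_volume_poly_wellorder[OF A']) (rule that)
  have "measure lebesgue {x. infdist x A \<le> r} = measure lebesgue {x. infdist x (relabel ` A) \<le> r}" for r
  proof -
    have inf: "infdist (relabel x) (relabel ` A) = infdist x A" for x
      using A by (simp add: infdist_def dist_relabel image_image)
    have cl: "closed {x. infdist x (relabel ` A) \<le> r}" "closed {x. infdist x A \<le> r}"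
      by (intro closed_Collect_le continuous_intros)+
    have "measure lebesgue {x. infdist x (relabel ` A) \<le> r} = measure (distr lborel borel (relabel :: real^'n \<Rightarrow> _)) {x. infdist x (relabel ` A) \<le> r}"
      using cl by (simp add: distr_relabel)
    also have "\<dots> = measure lborel (relabel -` {x. infdist x (relabel ` A) \<le> r} \<inter> space lborel)"
      using cl by (intro measure_distr) auto
    also have "\<dots> = measure lebesgue {x. infdist x A \<le> r}"
      using cl by (simp add: inf vimage_def)
    finally show ?thesis by simp
  qed
  with q show ?thesis
    using that[of q] by (simp add: card_ranked)
qed

section \<open>The Wills functional as a Gaussian integral of the distance\<close>

lemma nn_integral_exp_tail:
  "(\<integral>\<^sup>+t. indicator {c..} t * ennreal (exp (- t)) \<partial>lborel) = ennreal (exp (- c))"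
proof -
  have "(\<integral>\<^sup>+t. ennreal (exp (- t)) * indicator {c..} t \<partial>lborel) = ennreal (0 - (- exp (- c)))"
  proof (rule nn_integral_FTC_atLeast)
    show "((\<lambda>x::real. - exp (- x)) \<longlongrightarrow> 0) at_top"
      using tendsto_minus[OF filterlim_compose[OF exp_at_bot filterlim_uminus_at_bot_at_top]] by simp
  qed (auto intro!: derivative_eq_intros)
  then show ?thesis by (simp add: mult.commute)
qed

text \<open>This moment is what makes the volumes of unit balls in Steiner's formula cancel.\<close>

lemma has_integral_exp_half_power:
  "((\<lambda>t. exp (- t) * sqrt (t / pi) ^ d) has_integral (1 / unit_ball_vol (real d))) {0..}"
proof -
  have "((\<lambda>t. t powr (real d / 2 + 1 - 1) / exp t) has_integral Gamma (real d / 2 + 1)) {0..}"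
    by (rule Gamma_integral_real) simp
  then have "((\<lambda>t. (1 / pi powr (real d / 2)) * (t powr (real d / 2 + 1 - 1) / exp t))
      has_integral (1 / pi powr (real d / 2) * Gamma (real d / 2 + 1))) {0..}"
    by (rule has_integral_mult_right)
  also have "1 / pi powr (real d / 2) * Gamma (real d / 2 + 1) = 1 / unit_ball_vol (real d)"
    by (simp add: unit_ball_vol_def)
  finally show ?thesis
  proof (rule has_integral_spike[OF negligible_sing[of 0], rotated])
    fix t :: real assume "t \<in> {0..} - {0}"
    then have t: "t > 0" by simp
    then have "sqrt (t / pi) ^ d = t powr (real d / 2) / pi powr (real d / 2)"
      by (simp add: powr_half_sqrt[symmetric] powr_realpow[symmetric] powr_powr powr_divide)
    then show "exp (- t) * sqrt (t / pi) ^ d = 1 / pi powr (real d / 2) * (t powr (real d / 2 + 1 - 1) / exp t)"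
      by (simp add: exp_minus field_simps)
  qed
qed

text \<open>By the layer cake formula the integral is that of \<open>exp (- t)\<close> against the parallel
  volume at radius \<open>sqrt (t / pi)\<close>. Since the latter is a polynomial, Steiner's formula
  defines the intrinsic volumes, and each of its terms contributes exactly one intrinsic volume.\<close>

theorem wills_eq_integral:
  fixes A :: "(real^'n) set"
  assumes A: "compact A" "convex A" "A \<noteq> {}"
  shows "(\<integral>\<^sup>+x. ennreal (exp (- (pi * (infdist x A)\<^sup>2))) \<partial>lborel) = ennreal (wills A)"
proof -
  let ?n = "CARD('n)"
  obtain q :: "real poly" where q: "degree q \<le> ?n"
    "\<And>r. r \<ge> 0 \<Longrightarrow> measure lebesgue {x. infdist x A \<le> r} = poly q r"
    by (rule parallel_volume_poly[OF A]) (rule that)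
  define V where "V i = coeff q (?n - i) / unit_ball_vol (real (?n - i))" for i
  have ubv: "unit_ball_vol (real i) \<noteq> 0" for i
    by (rule less_imp_neq[OF unit_ball_vol_pos, symmetric]) simp
  have poly_q: "poly q r = (\<Sum>d\<le>?n. coeff q d * r ^ d)" for r
    unfolding poly_altdef using q(1)
    by (intro sum.mono_neutral_left) (auto simp: coeff_eq_0)
  have flip: "(\<Sum>i\<le>?n. g (?n - i)) = (\<Sum>d\<le>?n. g d)" for g :: "nat \<Rightarrow> real"
    using sum.nat_diff_reindex[of g "Suc ?n"] by (simp add: lessThan_Suc_atMost)
  have "steiner_formula A V"
    unfolding steiner_formula_def
  proof (intro allI impI)
    fix r :: real assume r: "r \<ge> 0"
    have "measure lebesgue (\<Union>x\<in>A. cball x r) = (\<Sum>d\<le>?n. coeff q d * r ^ d)"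
      using A r by (simp add: parallel_body_eq_Union_cball q(2) poly_q)
    also have "\<dots> = (\<Sum>i\<le>DIM(real^'n). unit_ball_vol (real (DIM(real^'n) - i)) * V i * r ^ (DIM(real^'n) - i))"
      unfolding flip[of "\<lambda>d. coeff q d * r ^ d", symmetric] by (simp add: V_def ubv del: of_nat_diff)
    finally show "measure lebesgue (\<Union>x\<in>A. cball x r) = \<dots>" .
  qed
  then have "wills A = (\<Sum>i\<le>?n. V i)"
    by (simp add: wills_def intrinsic_volume_eq)
  also have "\<dots> = (\<Sum>d\<le>?n. coeff q d / unit_ball_vol (real d))"
    unfolding V_def using flip[of "\<lambda>d. coeff q d / unit_ball_vol (real d)"] .
  finally have W: "wills A = (\<Sum>d\<le>?n. coeff q d * (1 / unit_ball_vol (real d)))" by simp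
  have "((\<lambda>t. \<Sum>d\<le>?n. coeff q d * (exp (- t) * sqrt (t / pi) ^ d)) has_integral wills A) {0..}"
    unfolding W by (intro has_integral_sum has_integral_mult_right has_integral_exp_half_power) auto
  then have int: "((\<lambda>t. exp (- t) * poly q (sqrt (t / pi))) has_integral wills A) {0..}"
    by (simp add: poly_q sum_distrib_left mult_ac)
  have le_iff: "pi * (infdist x A)\<^sup>2 \<le> t \<longleftrightarrow> infdist x A \<le> sqrt (t / pi)" if "t \<ge> 0" for x t
  proof -
    have "pi * (infdist x A)\<^sup>2 \<le> t \<longleftrightarrow> (infdist x A)\<^sup>2 \<le> (sqrt (t / pi))\<^sup>2"
      using that by (simp add: pos_le_divide_eq mult.commute)
    also have "\<dots> \<longleftrightarrow> infdist x A \<le> sqrt (t / pi)"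
      using that by (intro power2_le_iff_abs_le[THEN trans]) (auto simp: infdist_nonneg)
    finally show ?thesis .
  qed
  have "(\<integral>\<^sup>+x. ennreal (exp (- (pi * (infdist x A)\<^sup>2))) \<partial>lborel)
      = (\<integral>\<^sup>+x. (\<integral>\<^sup>+t. indicator {pi * (infdist x A)\<^sup>2..} t * ennreal (exp (- t)) \<partial>lborel) \<partial>lborel)"
    by (simp only: nn_integral_exp_tail)
  also have "\<dots> = (\<integral>\<^sup>+t. (\<integral>\<^sup>+x. indicator {pi * (infdist x A)\<^sup>2..} t * ennreal (exp (- t)) \<partial>lborel) \<partial>lborel)"
  proof (rule lborel_pair.Fubini')
    have [measurable]: "(\<lambda>x. infdist x A) \<in> borel_measurable borel"
      by (intro borel_measurable_continuous_onI continuous_intros)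
    have "(\<lambda>(t, x). indicator {(t, x). pi * (infdist x A)\<^sup>2 \<le> t} (t, x) * ennreal (exp (- t)))
        \<in> borel_measurable (lborel \<Otimes>\<^sub>M lborel)"
      by measurable
    then show "(\<lambda>(t, x). indicator {pi * (infdist x A)\<^sup>2..} t * ennreal (exp (- t)))
        \<in> borel_measurable (lborel \<Otimes>\<^sub>M lborel)"
      by (simp add: indicator_def)
  qed
  also have "\<dots> = (\<integral>\<^sup>+t. ennreal (indicator {0..} t * (exp (- t) * poly q (sqrt (t / pi)))) \<partial>lborel)"
  proof (rule nn_integral_cong)
    fix t :: real
    show "(\<integral>\<^sup>+x. indicator {pi * (infdist x A)\<^sup>2..} t * ennreal (exp (- t)) \<partial>lborel)
        = ennreal (indicator {0..} t * (exp (- t) * poly q (sqrt (t / pi))))"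
    proof (cases "t \<ge> 0")
      case True
      let ?D = "{x. infdist x A \<le> sqrt (t / pi)}"
      have D: "?D \<in> sets borel"
        using compact_parallel_body[OF A(1,3)] by (intro borel_compact)
      have "(\<integral>\<^sup>+x. indicator {pi * (infdist x A)\<^sup>2..} t * ennreal (exp (- t)) \<partial>lborel)
          = (\<integral>\<^sup>+x. ennreal (exp (- t)) * indicator ?D x \<partial>lborel)"
        using True by (intro nn_integral_cong) (auto simp: indicator_def le_iff)
      also have "\<dots> = ennreal (exp (- t)) * emeasure lborel ?D"
        using D by (simp add: nn_integral_cmult_indicator)
      also have "emeasure lborel ?D = ennreal (measure lebesgue ?D)"
        using emeasure_bounded_finite[OF compact_imp_bounded[OF compact_parallel_body[OF A(1,3)]], of "sqrt (t / pi)"] D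
        by (subst emeasure_eq_ennreal_measure) auto
      also have "measure lebesgue ?D = poly q (sqrt (t / pi))"
        using True by (simp add: q(2))
      finally show ?thesis
        using True by (simp add: ennreal_mult')
    next
      case False
      have "0 \<le> pi * (infdist x A)\<^sup>2" for x by simp
      then have "\<not> pi * (infdist x A)\<^sup>2 \<le> t" for x
        using False by (meson order_trans)
      then show ?thesis using False by (simp add: indicator_def)
    qed
  qed
  also have "\<dots> = ennreal (wills A)"
  proof (rule nn_integral_has_integral_lebesgue[OF _ int])
    fix t :: real assume "t \<in> {0..}"
    then have "poly q (sqrt (t / pi)) \<ge> 0"
      by (subst q(2)[symmetric]) auto
    then show "0 \<le> exp (- t) * poly q (sqrt (t / pi))" by simp
  qed
  finally show ?thesis .
qed

section \<open>Determinants of weighted Parseval frames\<close>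

lemma orthonormal_Parseval:
  fixes B :: "'a::euclidean_space set"
  assumes "finite B" "pairwise orthogonal B" "\<And>b. b \<in> B \<Longrightarrow> norm b = 1" "span B = UNIV"
  shows "(\<Sum>b\<in>B. (x \<bullet> b)\<^sup>2) = (norm x)\<^sup>2"
proof -
  have "(\<Sum>b\<in>B. (x \<bullet> b) *\<^sub>R b) = x"
    using assms by (intro orthonormal_projection_eq) (auto simp: orthogonal_def)
  then have "(norm x)\<^sup>2 = (\<Sum>b\<in>B. (x \<bullet> b) *\<^sub>R b) \<bullet> x"
    by (simp add: power2_norm_eq_inner)
  also have "\<dots> = (\<Sum>b\<in>B. (x \<bullet> b)\<^sup>2)"
    unfolding inner_sum_left inner_scaleR_left power2_eq_square by (simp add: inner_commute)
  finally show ?thesis by simp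
qed

text \<open>A maximiser \<open>e\<close> of the quadratic form on the unit sphere of \<open>V\<close> is an
  eigenvector: otherwise the form would increase to first order from \<open>e\<close> in the direction
  \<open>f e - (f e \<bullet> e) e\<close>.\<close>

lemma self_adjoint_eigenvector:
  fixes f :: "'a::euclidean_space \<Rightarrow> 'a"
  assumes f: "linear f" and sym: "\<And>x y. f x \<bullet> y = x \<bullet> f y"
    and V: "subspace V" "\<And>x. x \<in> V \<Longrightarrow> f x \<in> V" and ne: "\<exists>x\<in>V. x \<noteq> 0"
  obtains e where "e \<in> V" "norm e = 1" "f e = (f e \<bullet> e) *\<^sub>R e"
proof -
  let ?S = "V \<inter> sphere 0 1"
  obtain x0 where x0: "x0 \<in> V" "x0 \<noteq> 0" using ne by blast
  have "(1 / norm x0) *\<^sub>R x0 \<in> ?S"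
    using x0 subspace_scale[OF V(1)] by auto
  then have "?S \<noteq> {}" by blast
  moreover have "compact ?S"
    using closed_subspace[OF V(1)] by (simp add: closed_Int_compact)
  moreover have "continuous_on ?S (\<lambda>x. f x \<bullet> x)"
    using f by (intro continuous_intros linear_continuous_on) (simp add: linear_conv_bounded_linear)
  ultimately obtain e where e: "e \<in> ?S" and max: "\<And>x. x \<in> ?S \<Longrightarrow> f x \<bullet> x \<le> f e \<bullet> e"
    using continuous_attains_sup[of ?S "\<lambda>x. f x \<bullet> x"] by blast
  have eV: "e \<in> V" and e1: "norm e = 1" using e by auto
  \<comment> \<open>Compare the value at \<open>e + t y\<close> with the maximum: the linear term in
    \<open>t\<close> is \<open>2 t |y|\<^sup>2\<close>.\<close>
  define \<mu> where "\<mu> = f e \<bullet> e"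
  have bound: "f z \<bullet> z \<le> \<mu> * (norm z)\<^sup>2" if z: "z \<in> V" for z
  proof (cases "z = 0")
    case True
    then show ?thesis by simp
  next
    case False
    have "(1 / norm z) *\<^sub>R z \<in> ?S"
      using z False subspace_scale[OF V(1)] by auto
    from max[OF this] have "f z \<bullet> z / (norm z)\<^sup>2 \<le> \<mu>"
      by (simp add: \<mu>_def linear_scale[OF f] power2_eq_square)
    then show ?thesis
      using False by (simp add: pos_divide_le_eq)
  qed
  define y where "y = f e - \<mu> *\<^sub>R e"
  have yV: "y \<in> V"
    unfolding y_def using V eV by (intro subspace_diff subspace_scale) auto
  define C where "C = \<mu> * (norm y)\<^sup>2 - f y \<bullet> y"
  have C: "C \<ge> 0" unfolding C_def using bound[OF yV] by simp
  have key: "2 * t * (norm y)\<^sup>2 \<le> t\<^sup>2 * C" for t :: real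
  proof -
    have z: "e + t *\<^sub>R y \<in> V"
      using V(1) eV yV by (intro subspace_add subspace_scale)
    have "f (e + t *\<^sub>R y) \<bullet> (e + t *\<^sub>R y) = \<mu> + 2 * t * (f e \<bullet> y) + t\<^sup>2 * (f y \<bullet> y)"
      using sym[of y e]
      by (simp add: linear_add[OF f] linear_scale[OF f] inner_add_left inner_add_right \<mu>_def
          power2_eq_square algebra_simps inner_commute)
    moreover have "(norm (e + t *\<^sub>R y))\<^sup>2 = 1 + 2 * t * (e \<bullet> y) + t\<^sup>2 * (norm y)\<^sup>2"
    proof -
      have "e \<bullet> e = 1" using e1 by (simp add: norm_eq_1)
      then show ?thesis
        unfolding power2_norm_eq_inner
        by (simp add: inner_add_left inner_add_right power2_eq_square algebra_simps inner_commute)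
    qed
    moreover have "f e \<bullet> y = \<mu> * (e \<bullet> y) + (norm y)\<^sup>2"
      by (simp add: y_def power2_norm_eq_inner algebra_simps inner_diff_left inner_commute)
    ultimately show ?thesis
      using bound[OF z] by (simp add: C_def algebra_simps)
  qed
  have "(norm y)\<^sup>2 = 0"
  proof (rule ccontr)
    assume "(norm y)\<^sup>2 \<noteq> 0"
    then have p: "(norm y)\<^sup>2 > 0" by simp
    define t where "t = (norm y)\<^sup>2 / (C + 1)"
    have t: "t > 0" using p C by (simp add: t_def)
    have "2 * (norm y)\<^sup>2 \<le> t * C"
      using key[of t] t by (simp add: power2_eq_square)
    also have "\<dots> \<le> (norm y)\<^sup>2"
      using p C by (simp add: t_def field_simps)
    finally show False using p by simp
  qed
  then have "f e = (f e \<bullet> e) *\<^sub>R e"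
    by (simp add: y_def \<mu>_def)
  with that eV e1 show ?thesis by blast
qed

text \<open>The spectral theorem, by adding eigenvectors in the orthogonal complement of those already found.\<close>

lemma self_adjoint_eigenbasis:
  fixes f :: "'a::euclidean_space \<Rightarrow> 'a"
  assumes f: "linear f" and sym: "\<And>x y. f x \<bullet> y = x \<bullet> f y"
  obtains B where "finite B" "pairwise orthogonal B" "\<And>b. b \<in> B \<Longrightarrow> norm b = 1"
    "card B = DIM('a)" "span B = UNIV" "\<And>b. b \<in> B \<Longrightarrow> f b = (f b \<bullet> b) *\<^sub>R b"
proof -
  have "\<exists>B. finite B \<and> pairwise orthogonal B \<and> (\<forall>b\<in>B. norm b = 1) \<and> card B = k \<and>
      (\<forall>b\<in>B. f b = (f b \<bullet> b) *\<^sub>R b)" if "k \<le> DIM('a)" for k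
    using that
  proof (induction k)
    case 0
    show ?case by (rule exI[of _ "{}"]) simp
  next
    case (Suc k)
    then obtain B where B: "finite B" "pairwise orthogonal B" "\<forall>b\<in>B. norm b = 1" "card B = k"
      "\<forall>b\<in>B. f b = (f b \<bullet> b) *\<^sub>R b" by auto
    let ?V = "{x. \<forall>b\<in>B. x \<bullet> b = 0}"
    have "dim (span B) < DIM('a)"
      using dim_le_card[of B B] B Suc.prems by (simp add: span_superset)
    then obtain x where x: "x \<noteq> 0" "\<And>y. y \<in> span B \<Longrightarrow> orthogonal x y"
      using orthogonal_to_subspace_exists[of B] by (auto simp: span_base)
    have sub: "subspace ?V"
      by (auto simp: subspace_def inner_add_left)
    have inv: "f x \<in> ?V" if x: "x \<in> ?V" for x
    proof safe
      fix b assume b: "b \<in> B"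
      have "f x \<bullet> b = x \<bullet> ((f b \<bullet> b) *\<^sub>R b)"
        using B(5) b sym[of x b] by simp
      then show "f x \<bullet> b = 0" using x b by simp
    qed
    have "\<exists>x\<in>?V. x \<noteq> 0"
      using x by (intro bexI[of _ x]) (auto simp: orthogonal_def span_base)
    then obtain e where e: "e \<in> ?V" "norm e = 1" "f e = (f e \<bullet> e) *\<^sub>R e"
      using self_adjoint_eigenvector[OF f sym sub inv] by blast
    have "e \<notin> B"
    proof
      assume "e \<in> B"
      then have "e \<bullet> e = 0" using e(1) by blast
      then show False using e(2) by simp
    qed
    moreover have "pairwise orthogonal (insert e B)"
      using B(2) e(1) by (auto simp: pairwise_insert orthogonal_def inner_commute)
    ultimately show ?case
      using B e by (intro exI[of _ "insert e B"]) auto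
  qed
  from this[of "DIM('a)"] obtain B where B: "finite B" "pairwise orthogonal B" "\<forall>b\<in>B. norm b = 1"
    "card B = DIM('a)" "\<forall>b\<in>B. f b = (f b \<bullet> b) *\<^sub>R b" by auto
  have "0 \<notin> B" using B(3) by force
  then have "independent B"
    using B(2) by (intro pairwise_orthogonal_independent)
  then have "span B = UNIV"
    using B(4) card_eq_dim[of B UNIV] by (auto simp: dim_UNIV B(1))
  with B that show ?thesis by blast
qed

lemma det_self_adjoint:
  fixes f :: "real^'n \<Rightarrow> real^'n"
  assumes f: "linear f" and B: "finite B" "pairwise orthogonal B" "\<And>b. b \<in> B \<Longrightarrow> norm b = 1"
    "card B = CARD('n)" "\<And>b. b \<in> B \<Longrightarrow> f b = (f b \<bullet> b) *\<^sub>R b"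
  shows "det (matrix f) = (\<Prod>b\<in>B. f b \<bullet> b)"
proof -
  obtain e :: "'n \<Rightarrow> real^'n" where e: "bij_betw e UNIV B"
    using finite_same_card_bij[of "UNIV :: 'n set" B] B by auto
  have eB: "e i \<in> B" for i using e by (auto simp: bij_betw_def)
  have orth: "e i \<bullet> e j = (if i = j then 1 else 0)" for i j
    using B(2,3) eB[of i] eB[of j] bij_betw_imp_inj_on[OF e]
    by (auto simp: pairwise_def orthogonal_def inj_eq norm_eq_1)
  define Q :: "real^'n^'n" where "Q = (\<chi> i. e i)"
  have QQ: "Q ** transpose Q = mat 1"
    by (simp add: Q_def matrix_matrix_mult_def transpose_def mat_def vec_eq_iff orth[unfolded inner_vec_def, simplified])
  have "det Q * det Q = det (Q ** transpose Q)"
    by (simp add: det_mul)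
  then have detQ: "det Q * det Q = 1" by (simp add: QQ)
  let ?D = "Q ** matrix f ** transpose Q"
  have entry: "?D $ i $ j = e i \<bullet> f (e j)" for i j
  proof -
    have "f (e j) = matrix f *v e j"
      using f by (simp add: matrix_works)
    then show ?thesis
      by (simp add: Q_def matrix_matrix_mult_def matrix_vector_mult_def transpose_def inner_vec_def
          sum_distrib_left sum_distrib_right mult_ac) (rule sum.swap)
  qed
  have entry': "?D $ i $ j = (if i = j then f (e i) \<bullet> e i else 0)" for i j
  proof -
    have "e i \<bullet> f (e j) = e i \<bullet> ((f (e j) \<bullet> e j) *\<^sub>R e j)"
      using B(5)[OF eB[of j]] by simp
    then show ?thesis unfolding entry by (simp add: orth)
  qed
  have "det ?D = (\<Prod>i\<in>UNIV. ?D $ i $ i)"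
    by (rule det_diagonal) (simp add: entry')
  also have "\<dots> = (\<Prod>i\<in>UNIV. f (e i) \<bullet> e i)"
    by (simp add: entry')
  also have "\<dots> = (\<Prod>b\<in>B. f b \<bullet> b)"
    using prod.reindex_bij_betw[OF e, of "\<lambda>b. f b \<bullet> b"] .
  also have "det ?D = det (matrix f) * (det Q * det Q)"
    by (simp add: det_mul)
  finally show ?thesis by (simp add: detQ)
qed

text \<open>In an orthonormal eigenbasis each eigenvalue is an average of the weights \<open>\<theta> j\<close>
  with coefficients \<open>(w j \<bullet> b)\<^sup>2\<close>; convexity of \<open>exp\<close> bounds
  it below by the corresponding geometric mean, and in the product over the basis the exponents add up to
  \<open>(norm (w j))\<^sup>2\<close>.\<close>

lemma det_weighted_frame_ge:
  fixes w :: "'i \<Rightarrow> real^'n"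
  assumes J: "finite J" and id: "\<And>x. (\<Sum>j\<in>J. (w j \<bullet> x) *\<^sub>R w j) = x"
    and \<theta>: "\<And>j. j \<in> J \<Longrightarrow> \<theta> j > 0"
  shows "(\<Prod>j\<in>J. \<theta> j powr (norm (w j))\<^sup>2) \<le> det (matrix (\<lambda>x. \<Sum>j\<in>J. (\<theta> j * (w j \<bullet> x)) *\<^sub>R w j))"
proof -
  define f where "f x = (\<Sum>j\<in>J. (\<theta> j * (w j \<bullet> x)) *\<^sub>R w j)" for x
  have f: "linear f"
    unfolding f_def by (intro linearI)
      (simp_all add: inner_add_right scaleR_add_left algebra_simps sum.distrib scaleR_sum_right)
  have sym: "f x \<bullet> y = x \<bullet> f y" for x y
    by (simp add: f_def inner_sum_left inner_sum_right inner_commute mult_ac)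
  obtain B where B: "finite B" "pairwise orthogonal B" "\<And>b. b \<in> B \<Longrightarrow> norm b = 1"
    "card B = DIM(real^'n)" "span B = UNIV" "\<And>b. b \<in> B \<Longrightarrow> f b = (f b \<bullet> b) *\<^sub>R b"
    by (rule self_adjoint_eigenbasis[OF f sym]) (rule that)
  have ne: "J \<noteq> {}"
  proof
    assume "J = {}"
    then have "axis undefined 1 = (0::real^'n)" using id[of "axis undefined 1"] by simp
    then show False by (simp add: axis_eq_0_iff)
  qed
  have jensen: "exp (\<Sum>j\<in>J. (w j \<bullet> b)\<^sup>2 * ln (\<theta> j)) \<le> f b \<bullet> b" if b: "b \<in> B" for b
  proof -
    have "(\<Sum>j\<in>J. (w j \<bullet> b)\<^sup>2) = (\<Sum>j\<in>J. (w j \<bullet> b) *\<^sub>R w j) \<bullet> b"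
      by (simp add: inner_sum_left power2_eq_square)
    also have "\<dots> = 1"
      unfolding id using B(3)[OF b] by (simp add: norm_eq_1)
    finally have "exp (\<Sum>j\<in>J. (w j \<bullet> b)\<^sup>2 *\<^sub>R ln (\<theta> j)) \<le> (\<Sum>j\<in>J. (w j \<bullet> b)\<^sup>2 * exp (ln (\<theta> j)))"
      by (intro convex_on_sum[OF J ne exp_convex]) auto
    also have "\<dots> = f b \<bullet> b"
      using \<theta> by (auto simp: f_def inner_sum_left power2_eq_square mult_ac intro!: sum.cong)
    finally show ?thesis by simp
  qed
  have "(\<Prod>j\<in>J. \<theta> j powr (norm (w j))\<^sup>2) = exp (\<Sum>j\<in>J. (norm (w j))\<^sup>2 * ln (\<theta> j))"
    unfolding exp_sum[OF J] by (intro prod.cong) (auto simp: powr_def less_imp_neq[OF \<theta>, symmetric])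
  also have "(\<Sum>j\<in>J. (norm (w j))\<^sup>2 * ln (\<theta> j)) = (\<Sum>j\<in>J. \<Sum>b\<in>B. (w j \<bullet> b)\<^sup>2 * ln (\<theta> j))"
    by (simp add: orthonormal_Parseval[OF B(1-3,5), symmetric] sum_distrib_right)
  also have "\<dots> = (\<Sum>b\<in>B. \<Sum>j\<in>J. (w j \<bullet> b)\<^sup>2 * ln (\<theta> j))"
    by (rule sum.swap)
  also have "exp \<dots> = (\<Prod>b\<in>B. exp (\<Sum>j\<in>J. (w j \<bullet> b)\<^sup>2 * ln (\<theta> j)))"
    by (rule exp_sum[OF B(1)])
  also have "\<dots> \<le> (\<Prod>b\<in>B. f b \<bullet> b)"
    by (intro prod_mono) (simp add: jensen)
  also have "\<dots> = det (matrix f)"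
    using B by (intro det_self_adjoint[OF f, symmetric]) auto
  finally show ?thesis by (simp add: f_def[abs_def])
qed

section \<open>Change of variables along a monotone frame map\<close>

lemma nn_integral_lborel_eq_integral:
  fixes f :: "'a::euclidean_space \<Rightarrow> real"
  assumes "f absolutely_integrable_on UNIV" "\<And>x. f x \<ge> 0"
  shows "(\<integral>\<^sup>+x. ennreal (f x) \<partial>lborel) = ennreal (integral UNIV f)"
proof -
  have "(f has_integral integral UNIV f) UNIV"
    using assms(1) by (intro integrable_integral set_lebesgue_integral_eq_integral(1))
  from nn_integral_has_integral_lebesgue[OF _ this] assms(2)
  show ?thesis by simp
qed

lemma nn_integral_injective_change_le:
  fixes g :: "real^'n::{finite,wellorder} \<Rightarrow> real^'n::_" and \<psi> :: "real^'n::_ \<Rightarrow> real"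
  assumes der: "\<And>x. (g has_derivative g' x) (at x)" and inj: "inj g"
    and \<psi>: "integrable lborel \<psi>" "\<And>x. \<psi> x \<ge> 0"
  shows "(\<integral>\<^sup>+x. ennreal (\<bar>det (matrix (g' x))\<bar> * \<psi> (g x)) \<partial>lborel) \<le> (\<integral>\<^sup>+x. ennreal (\<psi> x) \<partial>lborel)"
proof -
  have U: "\<psi> absolutely_integrable_on UNIV"
    using \<psi>(1) by (simp add: set_integrable_def integrable_completion)
  have "continuous_on UNIV g"
    by (intro continuous_at_imp_continuous_on ballI has_derivative_continuous[OF der])
  then have "open (range g)"
    using inj by (intro invariance_of_domain) auto
  then have R: "\<psi> absolutely_integrable_on range g"
    by (intro set_integrable_subset[OF U]) auto
  let ?D = "\<lambda>x. \<bar>det (matrix (g' x))\<bar> * \<psi> (g x)"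
  have "(\<lambda>x. \<bar>det (matrix (g' x))\<bar> *\<^sub>R (vec (\<psi> (g x)) :: real^1)) absolutely_integrable_on UNIV \<and>
     integral UNIV (\<lambda>x. \<bar>det (matrix (g' x))\<bar> *\<^sub>R (vec (\<psi> (g x)) :: real^1)) = vec (integral (range g) \<psi>)"
    using R inj
    by (intro has_absolute_integral_change_of_variables[where f = "\<lambda>x. vec (\<psi> x) :: real^1", THEN iffD2])
      (auto simp: absolutely_integrable_on_1_iff integral_on_1_eq intro: has_derivative_at_withinI der)
  then have D: "?D absolutely_integrable_on UNIV" "integral UNIV ?D = integral (range g) \<psi>"
    by (auto simp: absolutely_integrable_on_1_iff integral_on_1_eq)
  have "(\<integral>\<^sup>+x. ennreal (?D x) \<partial>lborel) = ennreal (integral (range g) \<psi>)"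
    using nn_integral_lborel_eq_integral[OF D(1)] \<psi>(2) D(2) by simp
  also have "integral (range g) \<psi> \<le> integral UNIV \<psi>"
    using R U \<psi>(2) by (intro integral_subset_le) (auto simp: set_lebesgue_integral_eq_integral(1))
  then have "ennreal (integral (range g) \<psi>) \<le> ennreal (integral UNIV \<psi>)"
    by (rule ennreal_leI)
  also have "ennreal (integral UNIV \<psi>) = (\<integral>\<^sup>+x. ennreal (\<psi> x) \<partial>lborel)"
    using nn_integral_lborel_eq_integral[OF U] \<psi>(2) by simp
  finally show ?thesis .
qed

text \<open>The map \<open>z \<mapsto> \<Sum>j. S j (\<tau> j + w j \<bullet> z) w j\<close> is
  strictly monotone, hence injective, and its Jacobian determinant dominates the product of powers by
  \<open>det_weighted_frame_ge\<close>. So the left-hand side is at most the integral of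
  \<open>\<psi>\<close> over the image.\<close>

lemma frame_transport_inequality_wellorder:
  fixes w :: "'i \<Rightarrow> real^'n::{finite,wellorder}" and \<psi> :: "real^'n::_ \<Rightarrow> real"
  assumes J: "finite J" and id: "\<And>x. (\<Sum>j\<in>J. (w j \<bullet> x) *\<^sub>R w j) = x"
    and S: "\<And>j x. j \<in> J \<Longrightarrow> (S j has_real_derivative S' j x) (at x)" "\<And>j x. j \<in> J \<Longrightarrow> S' j x > 0"
    and \<psi>: "integrable lborel \<psi>" "\<And>x. \<psi> x \<ge> 0"
  shows "(\<integral>\<^sup>+z. ennreal ((\<Prod>j\<in>J. S' j (\<tau> j + w j \<bullet> z) powr (norm (w j))\<^sup>2)
      * \<psi> (\<Sum>j\<in>J. S j (\<tau> j + w j \<bullet> z) *\<^sub>R w j)) \<partial>lborel) \<le> (\<integral>\<^sup>+x. ennreal (\<psi> x) \<partial>lborel)"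
proof -
  define g where "g z = (\<Sum>j\<in>J. S j (\<tau> j + w j \<bullet> z) *\<^sub>R w j)" for z
  define g' where "g' z = (\<lambda>x. \<Sum>j\<in>J. (S' j (\<tau> j + w j \<bullet> z) * (w j \<bullet> x)) *\<^sub>R w j)" for z
  have der: "(g has_derivative g' z) (at z)" for z
    unfolding g_def g'_def
  proof (rule has_derivative_sum)
    fix j assume j: "j \<in> J"
    have "((\<lambda>z. \<tau> j + w j \<bullet> z) has_derivative (\<lambda>x. w j \<bullet> x)) (at z)"
      by (auto intro!: derivative_eq_intros)
    moreover have "(S j has_derivative (*) (S' j (\<tau> j + w j \<bullet> z))) (at (\<tau> j + w j \<bullet> z))"
      using S(1)[OF j] by (simp add: has_field_derivative_def)
    ultimately have "((\<lambda>z. S j (\<tau> j + w j \<bullet> z)) has_derivative (\<lambda>x. S' j (\<tau> j + w j \<bullet> z) * (w j \<bullet> x))) (at z)"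
      by (rule has_derivative_compose)
    then show "((\<lambda>z. S j (\<tau> j + w j \<bullet> z) *\<^sub>R w j) has_derivative
        (\<lambda>x. (S' j (\<tau> j + w j \<bullet> z) * (w j \<bullet> x)) *\<^sub>R w j)) (at z)"
      by (rule has_derivative_scaleR_left)
  qed
  have mono: "S j a < S j b" if "j \<in> J" "a < b" for j a b
    using DERIV_pos_imp_increasing[of a b "S j"] that S by blast
  have "inj g"
  proof (rule injI)
    fix y z assume "g y = g z"
    then have "0 = (g y - g z) \<bullet> (y - z)" by simp
    also have "\<dots> = (\<Sum>j\<in>J. (S j (\<tau> j + w j \<bullet> y) - S j (\<tau> j + w j \<bullet> z)) * (w j \<bullet> y - w j \<bullet> z))"
      by (simp add: g_def sum_subtractf[symmetric] scaleR_left_diff_distrib[symmetric] inner_sum_left inner_diff_right right_diff_distrib)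
    finally have sum0: "(\<Sum>j\<in>J. (S j (\<tau> j + w j \<bullet> y) - S j (\<tau> j + w j \<bullet> z)) * (w j \<bullet> y - w j \<bullet> z)) = 0"
      by simp
    have nn: "0 \<le> (S j (\<tau> j + w j \<bullet> y) - S j (\<tau> j + w j \<bullet> z)) * (w j \<bullet> y - w j \<bullet> z)" if j: "j \<in> J" for j
      using mono[OF j, of "\<tau> j + w j \<bullet> y" "\<tau> j + w j \<bullet> z"] mono[OF j, of "\<tau> j + w j \<bullet> z" "\<tau> j + w j \<bullet> y"]
      by (cases "w j \<bullet> y" "w j \<bullet> z" rule: linorder_cases) (auto simp: mult_nonpos_nonpos)
    have "w j \<bullet> (y - z) = 0" if j: "j \<in> J" for j
    proof -
      have "(S j (\<tau> j + w j \<bullet> y) - S j (\<tau> j + w j \<bullet> z)) * (w j \<bullet> y - w j \<bullet> z) = 0"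
        by (rule sum_nonneg_0[OF J nn sum0 j])
      then show ?thesis
        using mono[OF j, of "\<tau> j + w j \<bullet> y" "\<tau> j + w j \<bullet> z"] mono[OF j, of "\<tau> j + w j \<bullet> z" "\<tau> j + w j \<bullet> y"]
        by (cases "w j \<bullet> y" "w j \<bullet> z" rule: linorder_cases) (auto simp: inner_diff_right)
    qed
    then have "(\<Sum>j\<in>J. (w j \<bullet> (y - z)) *\<^sub>R w j) = 0" by simp
    then show "y = z" unfolding id by simp
  qed
  have "(\<Prod>j\<in>J. S' j (\<tau> j + w j \<bullet> z) powr (norm (w j))\<^sup>2) * \<psi> (g z) \<le> \<bar>det (matrix (g' z))\<bar> * \<psi> (g z)" for z
  proof (rule mult_right_mono[OF _ \<psi>(2)])
    have "(\<Prod>j\<in>J. S' j (\<tau> j + w j \<bullet> z) powr (norm (w j))\<^sup>2) \<le> det (matrix (g' z))"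
      unfolding g'_def by (intro det_weighted_frame_ge J id S)
    then show "(\<Prod>j\<in>J. S' j (\<tau> j + w j \<bullet> z) powr (norm (w j))\<^sup>2) \<le> \<bar>det (matrix (g' z))\<bar>"
      by linarith
  qed
  then have "(\<integral>\<^sup>+z. ennreal ((\<Prod>j\<in>J. S' j (\<tau> j + w j \<bullet> z) powr (norm (w j))\<^sup>2) * \<psi> (g z)) \<partial>lborel)
      \<le> (\<integral>\<^sup>+z. ennreal (\<bar>det (matrix (g' z))\<bar> * \<psi> (g z)) \<partial>lborel)"
    by (intro nn_integral_mono ennreal_leI) 
  also have "\<dots> \<le> (\<integral>\<^sup>+x. ennreal (\<psi> x) \<partial>lborel)"
    by (rule nn_integral_injective_change_le[OF der \<open>inj g\<close> \<psi>])
  finally show ?thesis by (simp add: g_def)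
qed

lemma frame_transport_inequality:
  fixes w :: "'i \<Rightarrow> real^'n" and \<psi> :: "real^'n \<Rightarrow> real"
  assumes J: "finite J" and id: "\<And>x. (\<Sum>j\<in>J. (w j \<bullet> x) *\<^sub>R w j) = x"
    and S: "\<And>j x. j \<in> J \<Longrightarrow> (S j has_real_derivative S' j x) (at x)" "\<And>j x. j \<in> J \<Longrightarrow> S' j x > 0"
    and S'_meas [measurable]: "\<And>j. j \<in> J \<Longrightarrow> S' j \<in> borel_measurable borel"
    and \<psi>: "integrable lborel \<psi>" "\<And>x. \<psi> x \<ge> 0"
  shows "(\<integral>\<^sup>+z. ennreal ((\<Prod>j\<in>J. S' j (\<tau> j + w j \<bullet> z) powr (norm (w j))\<^sup>2)
      * \<psi> (\<Sum>j\<in>J. S j (\<tau> j + w j \<bullet> z) *\<^sub>R w j)) \<partial>lborel) \<le> (\<integral>\<^sup>+x. ennreal (\<psi> x) \<partial>lborel)"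
proof -
  define R where "R = inv (relabel :: real^'n \<Rightarrow> _)"
  have inj: "inj (relabel :: real^'n \<Rightarrow> _)"
    by (rule injI) (metis dist_relabel dist_eq_0_iff)
  have R: "R (relabel x) = x" for x :: "real^'n"
    unfolding R_def by (rule inv_f_f[OF inj])
  have R': "relabel (R y) = y" for y
    unfolding R_def by (rule surj_f_inv_f[OF surj_relabel])
  have S_meas [measurable]: "S j \<in> borel_measurable borel" if "j \<in> J" for j
    using S(1)[OF that] by (intro borel_measurable_continuous_onI continuous_at_imp_continuous_on)
      (auto intro: DERIV_isCont)
  have [measurable]: "\<psi> \<in> borel_measurable borel"
    using borel_measurable_integrable[OF \<psi>(1)] by simp
  have inner_R: "x \<bullet> R y = relabel x \<bullet> y" for x y
    by (metis R' inner_relabel)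
  have nrm: "norm (R y) = norm y" for y
    by (metis R' inner_relabel norm_eq)
  have R_lin: "linear R"
  proof (rule linearI)
    show "R (x + y) = R x + R y" for x y
      by (metis R R' linear_add[OF linear_relabel])
    show "R (c *\<^sub>R x) = c *\<^sub>R R x" for c x
      by (metis R R' linear_scale[OF linear_relabel])
  qed
  have [measurable]: "R \<in> borel_measurable borel"
    using R_lin by (intro borel_measurable_continuous_onI linear_continuous_on)
      (simp add: linear_conv_bounded_linear)
  have transfer: "(\<integral>\<^sup>+x. F x \<partial>lborel) = (\<integral>\<^sup>+y. F (R y) \<partial>lborel)"
    if [measurable]: "F \<in> borel_measurable borel" for F :: "real^'n \<Rightarrow> ennreal"
  proof -
    have "(\<integral>\<^sup>+y. F (R y) \<partial>lborel) = (\<integral>\<^sup>+y. F (R y) \<partial>(distr lborel borel (relabel :: real^'n \<Rightarrow> _)))"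
      by (simp add: distr_relabel)
    also have "\<dots> = (\<integral>\<^sup>+x. F (R (relabel x)) \<partial>lborel)"
      by (subst nn_integral_distr) auto
    finally show ?thesis by (simp add: R)
  qed
  have sumR: "(\<Sum>j\<in>J. c j *\<^sub>R w j) = R (\<Sum>j\<in>J. c j *\<^sub>R relabel (w j))" for c
    by (simp add: linear_sum[OF R_lin] linear_scale[OF R_lin] R)
  have \<psi>R: "integrable lborel (\<lambda>y. \<psi> (R y))"
  proof (rule integrableI_nonneg)
    have "(\<integral>\<^sup>+y. ennreal (\<psi> (R y)) \<partial>lborel) = (\<integral>\<^sup>+x. ennreal (\<psi> x) \<partial>lborel)"
      by (rule transfer[symmetric]) simp
    also have "\<dots> < \<infinity>"
      using \<psi> by (simp add: nn_integral_eq_integral)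
    finally show "(\<integral>\<^sup>+y. ennreal (\<psi> (R y)) \<partial>lborel) < \<infinity>" .
  qed (use \<psi>(2) in auto)
  have id': "(\<Sum>j\<in>J. (relabel (w j) \<bullet> y) *\<^sub>R relabel (w j)) = y" for y
  proof -
    have "(\<Sum>j\<in>J. (relabel (w j) \<bullet> y) *\<^sub>R relabel (w j)) = relabel (\<Sum>j\<in>J. (w j \<bullet> R y) *\<^sub>R w j)"
      by (simp add: linear_sum[OF linear_relabel] linear_scale[OF linear_relabel] inner_R)
    then show ?thesis by (simp add: id R')
  qed
  have nw: "norm (relabel x) = norm x" for x :: "real^'n"
    by (metis R nrm)
  have "(\<integral>\<^sup>+z. ennreal ((\<Prod>j\<in>J. S' j (\<tau> j + w j \<bullet> z) powr (norm (w j))\<^sup>2)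
      * \<psi> (\<Sum>j\<in>J. S j (\<tau> j + w j \<bullet> z) *\<^sub>R w j)) \<partial>lborel)
    = (\<integral>\<^sup>+y. ennreal ((\<Prod>j\<in>J. S' j (\<tau> j + w j \<bullet> R y) powr (norm (w j))\<^sup>2)
      * \<psi> (\<Sum>j\<in>J. S j (\<tau> j + w j \<bullet> R y) *\<^sub>R w j)) \<partial>lborel)"
    by (rule transfer) measurable
  also have "\<dots> = (\<integral>\<^sup>+y. ennreal ((\<Prod>j\<in>J. S' j (\<tau> j + relabel (w j) \<bullet> y) powr (norm (relabel (w j)))\<^sup>2)
      * \<psi> (R (\<Sum>j\<in>J. S j (\<tau> j + relabel (w j) \<bullet> y) *\<^sub>R relabel (w j)))) \<partial>lborel)"
    by (simp add: sumR inner_R nw)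
  also have "\<dots> \<le> (\<integral>\<^sup>+y. ennreal (\<psi> (R y)) \<partial>lborel)"
    by (rule frame_transport_inequality_wellorder[OF J id' S \<psi>R]) (use \<psi>(2) in auto)
  also have "\<dots> = (\<integral>\<^sup>+x. ennreal (\<psi> x) \<partial>lborel)"
    by (rule transfer[symmetric]) simp
  finally show ?thesis .
qed

section \<open>Monotone transport on the line\<close>

lemma finite_borel_measure_density:
  fixes f :: "real \<Rightarrow> real"
  assumes "integrable lborel f" "\<And>x. f x \<ge> 0"
  shows "finite_borel_measure (density lborel f)"
proof -
  have [measurable]: "f \<in> borel_measurable borel"
    using assms(1) borel_measurable_integrable by fastforce
  have "emeasure (density lborel f) (space (density lborel f)) = ennreal (LINT x|lborel. f x)"
    using assms by (simp add: emeasure_density nn_integral_eq_integral)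
  then have "finite_measure (density lborel f)"
    by (intro finite_measureI) simp
  then show ?thesis
    by (simp add: finite_borel_measure_def finite_borel_measure_axioms_def)
qed

lemma measure_density_UNIV:
  fixes f :: "real \<Rightarrow> real"
  assumes "integrable lborel f" "\<And>x. f x \<ge> 0"
  shows "measure (density lborel f) UNIV = (LINT x|lborel. f x)"
proof -
  have [measurable]: "f \<in> borel_measurable borel"
    using assms(1) borel_measurable_integrable by fastforce
  have "emeasure (density lborel f) UNIV = ennreal (LINT x|lborel. f x)"
    using assms by (simp add: emeasure_density nn_integral_eq_integral)
  then show ?thesis
    using assms by (simp add: measure_def integral_nonneg)
qed

text \<open>The distribution function differs from an indefinite integral of \<open>f\<close> by a constant near
  \<open>x\<close>.\<close>

lemma cdf_density_deriv:
  fixes f :: "real \<Rightarrow> real"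
  assumes f: "integrable lborel f" "\<And>x. f x \<ge> 0" "continuous_on UNIV f"
  shows "(cdf (density lborel f) has_real_derivative f x) (at x)"
proof -
  interpret finite_borel_measure "density lborel f"
    using f(1,2) by (rule finite_borel_measure_density)
  let ?F = "cdf (density lborel f)"
  have [measurable]: "f \<in> borel_measurable borel"
    using f(3) by (rule borel_measurable_continuous_onI)
  have diff: "?F y = ?F (x - 1) + integral {x - 1..y} f" if y: "x - 1 < y" for y
  proof -
    have c: "continuous_on {x - 1..y} f"
      by (rule continuous_on_subset[OF f(3)]) simp
    have Fd: "?F y - ?F (x - 1) = measure (density lborel f) {x - 1<..y}"
      using y by (rule cdf_diff_eq)
    have "emeasure (density lborel f) {x - 1<..y} = (\<integral>\<^sup>+t. ennreal (f t) * indicator {x - 1<..y} t \<partial>lborel)"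
      by (rule emeasure_density) auto
    also have "\<dots> = (\<integral>\<^sup>+t. indicator {x - 1..y} t * ennreal (f t) \<partial>lborel)"
      by (rule nn_integral_cong_AE)
        (rule AE_mp[OF AE_lborel_singleton[of "x - 1"]], rule AE_I2, auto simp: indicator_def)
    also have "\<dots> = (\<integral>\<^sup>+t. ennreal (indicator {x - 1..y} t * f t) \<partial>lborel)"
      by (intro nn_integral_cong) (auto simp: indicator_def)
    also have "\<dots> = ennreal (integral {x - 1..y} f)"
      by (rule nn_integral_has_integral_lebesgue)
        (auto intro!: f(2) integrable_integral integrable_continuous_real c)
    finally have "measure (density lborel f) {x - 1<..y} = integral {x - 1..y} f"
      by (simp add: measure_def integral_nonneg f(2) integrable_continuous_real c)
    then show ?thesis
      using Fd by simp
  qed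
  have "((\<lambda>y. integral {x - 1..y} f) has_real_derivative f x) (at x within {x - 1..x + 1})"
    by (intro integral_has_real_derivative continuous_on_subset[OF f(3)]) auto
  then have "((\<lambda>y. integral {x - 1..y} f) has_real_derivative f x) (at x)"
    by (subst (asm) at_within_interior) auto
  then have "((\<lambda>y. ?F (x - 1) + integral {x - 1..y} f) has_real_derivative f x) (at x)"
    by (auto intro!: derivative_eq_intros)
  then show ?thesis
  proof (rule has_field_derivative_transform_within_open[of _ _ _ "{x - 1<..}"])
    fix y assume "y \<in> {x - 1<..}"
    then show "?F (x - 1) + integral {x - 1..y} f = ?F y"
      using diff[of y] by simp
  qed auto
qed

lemma cdf_density_strict_mono:
  fixes f :: "real \<Rightarrow> real"
  assumes f: "integrable lborel f" "\<And>x. f x > 0" "continuous_on UNIV f" and "x < y"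
  shows "cdf (density lborel f) x < cdf (density lborel f) y"
  using \<open>x < y\<close>
proof (rule DERIV_pos_imp_increasing)
  fix z
  show "\<exists>d. (cdf (density lborel f) has_real_derivative d) (at z) \<and> 0 < d"
    using cdf_density_deriv[OF f(1) less_imp_le[OF f(2)] f(3), of z] f(2) by blast
qed

lemma cdf_density_strict_bounds:
  fixes f :: "real \<Rightarrow> real"
  assumes f: "integrable lborel f" "\<And>x. f x > 0" "continuous_on UNIV f"
  shows "0 < cdf (density lborel f) x" "cdf (density lborel f) x < (LINT x|lborel. f x)"
proof -
  interpret finite_borel_measure "density lborel f"
    using f(1) less_imp_le[OF f(2)] by (rule finite_borel_measure_density)
  show "0 < cdf (density lborel f) x"
    using cdf_density_strict_mono[OF f, of "x - 1" x] cdf_nonneg[of "x - 1"] by simp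
  have "cdf (density lborel f) (x + 1) \<le> measure (density lborel f) UNIV"
    using cdf_bounded[of "x + 1"] by simp
  then show "cdf (density lborel f) x < (LINT x|lborel. f x)"
    using cdf_density_strict_mono[OF f, of x "x + 1"] measure_density_UNIV[OF f(1) less_imp_le[OF f(2)]]
    by simp
qed

lemma cdf_density_surj:
  fixes f :: "real \<Rightarrow> real"
  assumes f: "integrable lborel f" "\<And>x. f x > 0" "continuous_on UNIV f"
    and c: "0 < c" "c < (LINT x|lborel. f x)"
  obtains x where "cdf (density lborel f) x = c"
proof -
  interpret finite_borel_measure "density lborel f"
    using f(1) less_imp_le[OF f(2)] by (rule finite_borel_measure_density)
  let ?F = "cdf (density lborel f)"
  have "\<forall>\<^sub>F x in at_bot. ?F x < c"
    using order_tendstoD(2)[OF cdf_lim_at_bot c(1)] .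
  then obtain a where a: "?F a < c"
    by (auto simp: eventually_at_bot_linorder)
  have "(?F \<longlongrightarrow> (LINT x|lborel. f x)) at_top"
    using cdf_lim_at_top measure_density_UNIV[OF f(1) less_imp_le[OF f(2)]] by simp
  then have "\<forall>\<^sub>F x in at_top. c < ?F x"
    using c(2) by (rule order_tendstoD(1))
  then obtain b where b: "c < ?F b"
    by (auto simp: eventually_at_top_linorder)
  have "a \<le> b"
    using cdf_nondecreasing[of b a] a b by linarith
  have "continuous_on {a..b} ?F"
    using DERIV_isCont[OF cdf_density_deriv[OF f(1) less_imp_le[OF f(2)] f(3)]]
    by (auto intro: continuous_at_imp_continuous_on)
  then obtain x where "?F x = c"
    using IVT'[of ?F a c b] a b \<open>a \<le> b\<close> by auto
  with that show ?thesis .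
qed

text \<open>The map \<open>S = F\<inverse> \<circ> G\<close>, where \<open>F\<close> and \<open>G\<close> are
  the distribution functions of the two densities.\<close>

lemma monotone_transport_exists:
  fixes f g :: "real \<Rightarrow> real"
  assumes f: "integrable lborel f" "\<And>x. f x > 0" "continuous_on UNIV f"
    and g: "integrable lborel g" "\<And>x. g x > 0" "continuous_on UNIV g"
    and eq: "(LINT x|lborel. f x) = (LINT x|lborel. g x)"
  obtains S where "\<And>x. (S has_real_derivative g x / f (S x)) (at x)"
    and "distr (density lborel g) borel S = density lborel f"
proof -
  let ?F = "cdf (density lborel f)" and ?G = "cdf (density lborel g)"
  have [measurable]: "f \<in> borel_measurable borel" "g \<in> borel_measurable borel"
    using f(3) g(3) by (auto intro: borel_measurable_continuous_onI)
  have "\<exists>x. ?F x = ?G y" for y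
    by (rule cdf_density_surj[OF f]) (use cdf_density_strict_bounds[OF g, of y] eq in auto)
  then obtain S where S: "\<And>y. ?F (S y) = ?G y" by metis
  define R where "R = inv ?F"
  have inj: "inj ?F"
  proof (rule injI)
    fix x y assume "?F x = ?F y"
    then show "x = y"
      using cdf_density_strict_mono[OF f, of x y] cdf_density_strict_mono[OF f, of y x]
      by (cases x y rule: linorder_cases) auto
  qed
  have R: "R (?F x) = x" for x
    unfolding R_def by (rule inv_f_f[OF inj])
  have SR: "S y = R (?G y)" for y
    by (metis R S)
  have derF: "(?F has_real_derivative f x) (at x)" for x
    using cdf_density_deriv[OF f(1) less_imp_le[OF f(2)] f(3)] .
  have derG: "(?G has_real_derivative g x) (at x)" for x
    using cdf_density_deriv[OF g(1) less_imp_le[OF g(2)] g(3)] .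
  have FR: "?F (R c) = c" if "0 < c" "c < (LINT x|lborel. f x)" for c
    using cdf_density_surj[OF f that] R by metis
  have derR: "(R has_real_derivative inverse (f x)) (at (?F x))" for x
  proof (rule DERIV_inverse_function[of ?F])
    show "(?F has_real_derivative f x) (at (R (?F x)))"
      unfolding R by (rule derF)
    show "f x \<noteq> 0" using f(2)[of x] by simp
    show "0 < ?F x" "?F x < (LINT x|lborel. f x)"
      using cdf_density_strict_bounds[OF f] by auto
    show "?F (R y) = y" if "0 < y" "y < (LINT x|lborel. f x)" for y
      using FR that by blast
    show "isCont R (?F x)"
      by (rule isCont_inverse_function[of 1]) (auto simp: R intro: DERIV_isCont[OF derF])
  qed
  have derS: "(S has_real_derivative g y / f (S y)) (at y)" for y
  proof -
    have "(R has_real_derivative inverse (f (S y))) (at (?G y))"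
      using derR[of "S y"] by (simp add: S)
    then have "((\<lambda>y. R (?G y)) has_real_derivative inverse (f (S y)) * g y) (at y)"
      by (rule DERIV_chain2[OF _ derG])
    then show ?thesis
      by (simp add: SR[abs_def] divide_inverse mult.commute)
  qed
  have [measurable]: "S \<in> borel_measurable borel"
    by (intro borel_measurable_continuous_onI continuous_at_imp_continuous_on ballI DERIV_isCont[OF derS])
  have "distr (density lborel g) borel S = density lborel f"
  proof (rule cdf_unique')
    interpret G: finite_borel_measure "density lborel g"
      using g(1) less_imp_le[OF g(2)] by (rule finite_borel_measure_density)
    show "finite_borel_measure (distr (density lborel g) borel S)"
      using G.finite_measure_distr[of S borel]
      by (simp add: finite_borel_measure_def finite_borel_measure_axioms_def)
    show "finite_borel_measure (density lborel f)"
      using f(1) less_imp_le[OF f(2)] by (rule finite_borel_measure_density)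
    show "cdf (distr (density lborel g) borel S) = ?F"
    proof
      fix x
      obtain y0 where y0: "?G y0 = ?F x"
        by (rule cdf_density_surj[OF g]) (use cdf_density_strict_bounds[OF f, of x] eq in auto)
      have mono: "(?F a \<le> ?F b) = (a \<le> b)" for a b
        using cdf_density_strict_mono[OF f, of a b] cdf_density_strict_mono[OF f, of b a]
        by (cases a b rule: linorder_cases) auto
      have mono': "(?G a \<le> ?G b) = (a \<le> b)" for a b
        using cdf_density_strict_mono[OF g, of a b] cdf_density_strict_mono[OF g, of b a]
        by (cases a b rule: linorder_cases) auto
      have "S z \<le> x \<longleftrightarrow> z \<le> y0" for z
        using mono[of "S z" x] mono'[of z y0] by (simp add: S y0)
      then have "S -` {..x} = {..y0}" by auto
      then have "cdf (distr (density lborel g) borel S) x = ?G y0"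
        unfolding cdf_def by (subst measure_distr) auto
      then show "cdf (distr (density lborel g) borel S) x = ?F x"
        by (simp add: y0)
    qed
  qed
  with derS that show ?thesis by blast
qed

section \<open>Gaussian integrals\<close>

lemma gaussian_integral:
  assumes "a > 0"
  shows "integrable lborel (\<lambda>x::real. exp (- (a * x\<^sup>2)))"
    and "(LINT x|lborel. exp (- (a * x\<^sup>2))) = sqrt (pi / a)"
proof -
  define \<sigma> where "\<sigma> = 1 / sqrt (2 * a)"
  have \<sigma>: "\<sigma> > 0" and \<sigma>2: "\<sigma>\<^sup>2 = 1 / (2 * a)"
    using assms by (auto simp: \<sigma>_def power_divide)
  have eq: "exp (- (a * x\<^sup>2)) = sqrt (pi / a) * normal_density 0 \<sigma> x" for x
    using assms by (simp add: normal_density_def \<sigma>2 real_sqrt_divide)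
  show "integrable lborel (\<lambda>x::real. exp (- (a * x\<^sup>2)))"
    unfolding eq using \<sigma> by simp
  show "(LINT x|lborel. exp (- (a * x\<^sup>2))) = sqrt (pi / a)"
    unfolding eq using \<sigma> by simp
qed

lemma nn_integral_gaussian:
  assumes "a > 0"
  shows "(\<integral>\<^sup>+x. ennreal (exp (- (a * x\<^sup>2))) \<partial>lborel) = ennreal (sqrt (pi / a))"
  using gaussian_integral[OF assms] by (subst nn_integral_eq_integral) auto

lemma exp_norm_square_prod_Basis:
  fixes x :: "'a::euclidean_space"
  shows "exp (- (a * (norm x)\<^sup>2)) = (\<Prod>b\<in>Basis. exp (- (a * (x \<bullet> b)\<^sup>2)))"
proof -
  have "(norm x)\<^sup>2 = (\<Sum>b\<in>Basis. (x \<bullet> b)\<^sup>2)"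
    by (simp add: norm_eq_sqrt_inner euclidean_inner[of x x] power2_eq_square sum_nonneg)
  then have "- (a * (norm x)\<^sup>2) = (\<Sum>b\<in>Basis. - (a * (x \<bullet> b)\<^sup>2))"
    by (simp add: sum_distrib_left sum_negf)
  then show ?thesis by (simp add: exp_sum)
qed

lemma nn_integral_gaussian_euclidean:
  fixes y :: "'a::euclidean_space"
  shows "(\<integral>\<^sup>+z. ennreal (exp (- (pi * (norm (y - z))\<^sup>2))) \<partial>lborel) = 1"
proof -
  have "(\<integral>\<^sup>+z. ennreal (exp (- (pi * (norm (y - z))\<^sup>2))) \<partial>lborel)
      = (\<integral>\<^sup>+z. ennreal (exp (- (pi * (norm (y - z))\<^sup>2))) \<partial>(distr lborel borel ((+) y)))"
    by (simp add: lborel_distr_plus)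
  also have "\<dots> = (\<integral>\<^sup>+z. ennreal (exp (- (pi * (norm (z::'a))\<^sup>2))) \<partial>lborel)"
    by (subst nn_integral_distr) auto
  also have "\<dots> = (\<integral>\<^sup>+z. (\<Prod>b\<in>Basis. ennreal (exp (- (pi * ((z::'a) \<bullet> b)\<^sup>2)))) \<partial>lborel)"
    by (simp add: exp_norm_square_prod_Basis prod_ennreal)
  also have "\<dots> = (\<Prod>b\<in>(Basis::'a set). (\<integral>\<^sup>+x. ennreal (exp (- (pi * x\<^sup>2))) \<partial>lborel))"
    by (rule nn_integral_lborel_prod) auto
  also have "\<dots> = 1"
    using nn_integral_gaussian[of pi] by simp
  finally show ?thesis .
qed

section \<open>Finite products of measures on the line\<close>

lemma distr_PiM_components:
  fixes M N :: "'i \<Rightarrow> 'a measure"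
  assumes J: "finite J" and M: "product_sigma_finite M" and N: "product_sigma_finite N"
    and T [measurable]: "\<And>j. j \<in> J \<Longrightarrow> T j \<in> measurable (N j) (M j)"
    and eq: "\<And>j. j \<in> J \<Longrightarrow> distr (N j) (M j) (T j) = M j"
  shows "distr (PiM J N) (PiM J M) (\<lambda>\<tau>. \<lambda>j\<in>J. T j (\<tau> j)) = PiM J M"
proof -
  interpret M: product_sigma_finite M by fact
  interpret N: product_sigma_finite N by fact
  show ?thesis
  proof (rule M.PiM_eqI[OF J])
    fix A assume A: "\<And>i. i \<in> J \<Longrightarrow> A i \<in> sets (M i)"
    have "(\<lambda>\<tau>. \<lambda>j\<in>J. T j (\<tau> j)) -` Pi\<^sub>E J A \<inter> space (PiM J N) = Pi\<^sub>E J (\<lambda>j. T j -` A j \<inter> space (N j))"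
      by (auto simp: space_PiM PiE_iff extensional_def)
    then have "emeasure (distr (PiM J N) (PiM J M) (\<lambda>\<tau>. \<lambda>j\<in>J. T j (\<tau> j))) (Pi\<^sub>E J A)
        = emeasure (PiM J N) (Pi\<^sub>E J (\<lambda>j. T j -` A j \<inter> space (N j)))"
      using A J by (subst emeasure_distr) (auto intro!: sets_PiM_I_finite)
    also have "\<dots> = (\<Prod>j\<in>J. emeasure (N j) (T j -` A j \<inter> space (N j)))"
      using A by (intro N.emeasure_PiM J) (auto intro: measurable_sets[OF T])
    also have "\<dots> = (\<Prod>j\<in>J. emeasure (M j) (A j))"
    proof (rule prod.cong)
      fix j assume j: "j \<in> J"
      show "emeasure (N j) (T j -` A j \<inter> space (N j)) = emeasure (M j) (A j)"
        using emeasure_distr[OF T[OF j] A[OF j]] eq[OF j] by simp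
    qed simp
    finally show "emeasure (distr (PiM J N) (PiM J M) (\<lambda>\<tau>. \<lambda>j\<in>J. T j (\<tau> j))) (Pi\<^sub>E J A)
        = (\<Prod>i\<in>J. emeasure (M i) (A i))" .
  qed simp
qed

lemma PiM_density_lborel:
  fixes f :: "'i \<Rightarrow> real \<Rightarrow> real"
  assumes J: "finite J" and f [measurable]: "\<And>j. f j \<in> borel_measurable borel"
    and sf: "product_sigma_finite (\<lambda>j. density lborel (f j))"
  shows "PiM J (\<lambda>j. density lborel (f j)) = density (PiM J (\<lambda>_. lborel)) (\<lambda>x. \<Prod>j\<in>J. ennreal (f j (x j)))"
proof -
  interpret D: product_sigma_finite "\<lambda>j. density lborel (f j)" by fact
  interpret L: product_sigma_finite "\<lambda>_::'i. lborel :: real measure" by standard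
  show ?thesis
  proof (rule D.PiM_eqI[OF J, symmetric])
    show "sets (density (PiM J (\<lambda>_. lborel)) (\<lambda>x. \<Prod>j\<in>J. ennreal (f j (x j)))) = sets (PiM J (\<lambda>j. density lborel (f j)))"
      unfolding sets_density by (rule sets_PiM_cong) auto
    fix A assume "\<And>i. i \<in> J \<Longrightarrow> A i \<in> sets (density lborel (\<lambda>x. ennreal (f i x)))"
    then have A [measurable]: "\<And>i. i \<in> J \<Longrightarrow> A i \<in> sets borel" by simp
    have "emeasure (density (PiM J (\<lambda>_. lborel)) (\<lambda>x. \<Prod>j\<in>J. ennreal (f j (x j)))) (Pi\<^sub>E J A)
        = (\<integral>\<^sup>+x. (\<Prod>j\<in>J. ennreal (f j (x j))) * indicator (Pi\<^sub>E J A) x \<partial>PiM J (\<lambda>_. lborel))"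
      using A J by (intro emeasure_density) (auto intro!: sets_PiM_I_finite)
    also have "\<dots> = (\<integral>\<^sup>+x. (\<Prod>j\<in>J. ennreal (f j (x j)) * indicator (A j) (x j)) \<partial>PiM J (\<lambda>_. lborel))"
    proof (rule nn_integral_cong)
      fix x assume "x \<in> space (PiM J (\<lambda>_. lborel :: real measure))"
      then have x: "x \<in> extensional J" by (simp add: space_PiM PiE_def)
      have "(\<Prod>j\<in>J. indicator (A j) (x j)) = (indicator (Pi\<^sub>E J A) x :: ennreal)"
        using x J by (auto simp: indicator_def PiE_iff prod_zero_iff split: if_splits)
      then show "(\<Prod>j\<in>J. ennreal (f j (x j))) * indicator (Pi\<^sub>E J A) x
          = (\<Prod>j\<in>J. ennreal (f j (x j)) * indicator (A j) (x j))"
        by (simp add: prod.distrib)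
    qed
    also have "\<dots> = (\<Prod>j\<in>J. \<integral>\<^sup>+x. ennreal (f j x) * indicator (A j) x \<partial>lborel)"
      by (rule L.product_nn_integral_prod[OF J]) simp
    also have "\<dots> = (\<Prod>j\<in>J. emeasure (density lborel (f j)) (A j))"
      by (intro prod.cong refl emeasure_density[symmetric]) auto
    finally show "emeasure (density (PiM J (\<lambda>_. lborel)) (\<lambda>x. \<Prod>j\<in>J. ennreal (f j (x j)))) (Pi\<^sub>E J A)
        = (\<Prod>i\<in>J. emeasure (density lborel (f i)) (A i))" .
  qed
qed

lemma nn_integral_PiM_shift:
  fixes G :: "('i \<Rightarrow> real) \<Rightarrow> ennreal"
  assumes J: "finite J" and G [measurable]: "G \<in> borel_measurable (PiM J (\<lambda>_. lborel))"
  shows "(\<integral>\<^sup>+\<tau>. G \<tau> \<partial>PiM J (\<lambda>_. lborel)) = (\<integral>\<^sup>+\<tau>. G (\<lambda>j\<in>J. v j + \<tau> j) \<partial>PiM J (\<lambda>_. lborel))"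
proof -
  have sf: "product_sigma_finite (\<lambda>_::'i. lborel :: real measure)" by standard
  have "distr (PiM J (\<lambda>_. lborel)) (PiM J (\<lambda>_. lborel)) (\<lambda>\<tau>. \<lambda>j\<in>J. v j + \<tau> j) = PiM J (\<lambda>_. lborel :: real measure)"
  proof (rule distr_PiM_components[OF J sf sf])
    fix j
    have "distr lborel lborel ((+) (v j)) = distr lborel borel ((+) (v j))"
      by (rule distr_cong) auto
    then show "distr lborel lborel ((+) (v j)) = lborel"
      by (simp add: lborel_distr_plus)
  qed auto
  then have "(\<integral>\<^sup>+\<tau>. G \<tau> \<partial>PiM J (\<lambda>_. lborel))
      = (\<integral>\<^sup>+\<tau>. G \<tau> \<partial>distr (PiM J (\<lambda>_. lborel)) (PiM J (\<lambda>_. lborel)) (\<lambda>\<tau>. \<lambda>j\<in>J. v j + \<tau> j))"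
    by simp
  also have "\<dots> = (\<integral>\<^sup>+\<tau>. G (\<lambda>j\<in>J. v j + \<tau> j) \<partial>PiM J (\<lambda>_. lborel))"
    by (rule nn_integral_distr) measurable
  finally show ?thesis .
qed

section \<open>A Brascamp-Lieb inequality with a kernel\<close>

lemma frame_Parseval:
  fixes w :: "'i \<Rightarrow> 'a::euclidean_space"
  assumes "\<And>x. (\<Sum>j\<in>J. (w j \<bullet> x) *\<^sub>R w j) = x"
  shows "(\<Sum>j\<in>J. (w j \<bullet> x)\<^sup>2) = (norm x)\<^sup>2"
proof -
  have "(\<Sum>j\<in>J. (w j \<bullet> x)\<^sup>2) = (\<Sum>j\<in>J. (w j \<bullet> x) *\<^sub>R w j) \<bullet> x"
    unfolding inner_sum_left inner_scaleR_left power2_eq_square ..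
  then show ?thesis
    using assms[of x] by (simp add: power2_norm_eq_inner)
qed

lemma frame_norm_le_1:
  fixes w :: "'i \<Rightarrow> 'a::euclidean_space"
  assumes J: "finite J" and id: "\<And>x. (\<Sum>j\<in>J. (w j \<bullet> x) *\<^sub>R w j) = x" and i: "i \<in> J"
  shows "norm (w i) \<le> 1"
proof -
  have "(w i \<bullet> w i)\<^sup>2 \<le> (\<Sum>j\<in>J. (w j \<bullet> w i)\<^sup>2)"
    using i J by (intro member_le_sum) auto
  also have "\<dots> = w i \<bullet> w i"
    by (simp add: frame_Parseval[OF id] power2_norm_eq_inner)
  finally have "(norm (w i))\<^sup>2 * (norm (w i))\<^sup>2 \<le> (norm (w i))\<^sup>2 * 1"
    by (simp add: power2_eq_square power2_norm_eq_inner[symmetric])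
  then have le: "(norm (w i))\<^sup>2 * (norm (w i))\<^sup>2 \<le> (norm (w i))\<^sup>2 * 1" .
  show ?thesis
  proof (rule ccontr)
    assume "\<not> norm (w i) \<le> 1"
    then have "1 < (norm (w i))\<^sup>2" by (simp add: one_less_power)
    then have "(norm (w i))\<^sup>2 * 1 < (norm (w i))\<^sup>2 * (norm (w i))\<^sup>2"
      by (intro mult_strict_left_mono) auto
    with le show False by simp
  qed
qed

text \<open>Parseval's identity at a unit frame vector leaves no room for the other ones.\<close>

lemma frame_unit_orthogonal:
  fixes w :: "'i \<Rightarrow> 'a::euclidean_space"
  assumes J: "finite J" and id: "\<And>x. (\<Sum>j\<in>J. (w j \<bullet> x) *\<^sub>R w j) = x"
    and i: "i \<in> J" "norm (w i) = 1" and j: "j \<in> J" "j \<noteq> i"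
  shows "w j \<bullet> w i = 0"
proof -
  have ii: "w i \<bullet> w i = 1" using i(2) by (simp add: norm_eq_1)
  have "(\<Sum>j\<in>J. (w j \<bullet> w i)\<^sup>2) = (w i \<bullet> w i)\<^sup>2 + (\<Sum>j\<in>J - {i}. (w j \<bullet> w i)\<^sup>2)"
    using J i by (simp add: sum.remove)
  then have 0: "(\<Sum>j\<in>J - {i}. (w j \<bullet> w i)\<^sup>2) = 0"
    using i(2) by (simp add: frame_Parseval[OF id] ii)
  have "(w j \<bullet> w i)\<^sup>2 = 0"
    by (rule sum_nonneg_0[OF _ _ 0]) (use J j in auto)
  then show ?thesis by simp
qed

lemma frame_unit_part_le:
  fixes w :: "'i \<Rightarrow> 'a::euclidean_space"
  assumes J: "finite J" and id: "\<And>x. (\<Sum>j\<in>J. (w j \<bullet> x) *\<^sub>R w j) = x"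
  shows "(\<Sum>j\<in>{j\<in>J. norm (w j) = 1}. (\<sigma> j)\<^sup>2) \<le> (norm (\<Sum>j\<in>J. \<sigma> j *\<^sub>R w j))\<^sup>2"
proof -
  let ?W = "\<Sum>j\<in>J. \<sigma> j *\<^sub>R w j"
  have "w i \<bullet> ?W = \<sigma> i" if i: "i \<in> J" "norm (w i) = 1" for i
  proof -
    have "w i \<bullet> ?W = (\<Sum>j\<in>J. \<sigma> j * (w j \<bullet> w i))"
      by (simp add: inner_sum_right inner_commute)
    also have "\<dots> = (\<Sum>j\<in>J. if j = i then \<sigma> i else 0)"
      using i(2) frame_unit_orthogonal[OF J id i] by (intro sum.cong) (auto simp: norm_eq_1)
    finally show ?thesis using J i by simp
  qed
  then have "(\<Sum>j\<in>{j\<in>J. norm (w j) = 1}. (\<sigma> j)\<^sup>2) = (\<Sum>j\<in>{j\<in>J. norm (w j) = 1}. (w j \<bullet> ?W)\<^sup>2)"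
    by (intro sum.cong) auto
  also have "\<dots> \<le> (\<Sum>j\<in>J. (w j \<bullet> ?W)\<^sup>2)"
    using J by (intro sum_mono2) auto
  finally show ?thesis by (simp add: frame_Parseval[OF id])
qed

lemma product_sigma_finite_lborel: "product_sigma_finite (\<lambda>_::'i. lborel :: real measure)"
  by standard

text \<open>The Gaussian \<open>exp (- pi |W \<tau> - z|\<^sup>2)\<close> integrates to 1 in
  \<open>z\<close>, where \<open>W \<tau> = \<Sum>j. \<tau> j w j\<close>; after Fubini, translate
  \<open>\<tau>\<close> by the vector with coordinates \<open>w j \<bullet> z\<close>, whose image
  under \<open>W\<close> is \<open>z\<close>. This replaces integration over the coefficient space by
  integration over translates of an \<open>n\<close>-dimensional subspace, so that determinants are only
  needed in dimension \<open>n\<close>.\<close>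

lemma frame_average:
  fixes w :: "'i \<Rightarrow> real^'n" and G :: "('i \<Rightarrow> real) \<Rightarrow> ennreal"
  assumes J: "finite J" and id: "\<And>x. (\<Sum>j\<in>J. (w j \<bullet> x) *\<^sub>R w j) = x"
    and G [measurable]: "G \<in> borel_measurable (PiM J (\<lambda>_. lborel))"
  shows "(\<integral>\<^sup>+\<tau>. G \<tau> \<partial>PiM J (\<lambda>_. lborel)) =
    (\<integral>\<^sup>+\<tau>. ennreal (exp (- (pi * (norm (\<Sum>j\<in>J. \<tau> j *\<^sub>R w j))\<^sup>2))) *
       (\<integral>\<^sup>+z. G (\<lambda>j\<in>J. w j \<bullet> z + \<tau> j) \<partial>lborel) \<partial>PiM J (\<lambda>_. lborel))"
proof -
  let ?P = "PiM J (\<lambda>_. lborel :: real measure)"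
  define W where "W \<tau> = (\<Sum>j\<in>J. \<tau> j *\<^sub>R w j)" for \<tau> :: "'i \<Rightarrow> real"
  interpret product_sigma_finite "\<lambda>_::'i. lborel :: real measure"
    by (rule product_sigma_finite_lborel)
  interpret P: sigma_finite_measure ?P
    using J by (rule sigma_finite)
  interpret pair_sigma_finite ?P "lborel :: (real^'n) measure" ..
  have [measurable]: "W \<in> borel_measurable ?P"
    unfolding W_def by measurable
  have W_shift: "W (\<lambda>j\<in>J. w j \<bullet> z + \<tau> j) = z + W \<tau>" for z \<tau>
  proof -
    have "W (\<lambda>j\<in>J. w j \<bullet> z + \<tau> j) = (\<Sum>j\<in>J. (w j \<bullet> z + \<tau> j) *\<^sub>R w j)"
      unfolding W_def by (intro sum.cong) auto
    then show ?thesis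
      by (simp add: W_def scaleR_add_left sum.distrib id)
  qed
  have [measurable]: "(\<lambda>(\<tau>, z). \<lambda>j\<in>J. w j \<bullet> z + \<tau> j) \<in> measurable (?P \<Otimes>\<^sub>M lborel) ?P"
    by measurable
  have "(\<integral>\<^sup>+\<tau>. G \<tau> \<partial>?P) = (\<integral>\<^sup>+\<tau>. G \<tau> * (\<integral>\<^sup>+z. ennreal (exp (- (pi * (norm (W \<tau> - z))\<^sup>2))) \<partial>lborel) \<partial>?P)"
    by (simp add: nn_integral_gaussian_euclidean)
  also have "\<dots> = (\<integral>\<^sup>+\<tau>. (\<integral>\<^sup>+z. ennreal (exp (- (pi * (norm (W \<tau> - z))\<^sup>2))) * G \<tau> \<partial>lborel) \<partial>?P)"
    by (simp add: nn_integral_multc mult.commute[of "G _"])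
  also have "\<dots> = (\<integral>\<^sup>+z. (\<integral>\<^sup>+\<tau>. ennreal (exp (- (pi * (norm (W \<tau> - z))\<^sup>2))) * G \<tau> \<partial>?P) \<partial>lborel)"
    by (rule Fubini'[symmetric]) measurable
  also have "\<dots> = (\<integral>\<^sup>+z. (\<integral>\<^sup>+\<tau>. ennreal (exp (- (pi * (norm (W \<tau>))\<^sup>2))) * G (\<lambda>j\<in>J. w j \<bullet> z + \<tau> j) \<partial>?P) \<partial>lborel)"
  proof (rule nn_integral_cong)
    fix z :: "real^'n"
    show "(\<integral>\<^sup>+\<tau>. ennreal (exp (- (pi * (norm (W \<tau> - z))\<^sup>2))) * G \<tau> \<partial>?P)
      = (\<integral>\<^sup>+\<tau>. ennreal (exp (- (pi * (norm (W \<tau>))\<^sup>2))) * G (\<lambda>j\<in>J. w j \<bullet> z + \<tau> j) \<partial>?P)"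
      by (subst nn_integral_PiM_shift[OF J, where v = "\<lambda>j. w j \<bullet> z"]) (measurable, simp add: W_shift)
  qed
  also have "\<dots> = (\<integral>\<^sup>+\<tau>. (\<integral>\<^sup>+z. ennreal (exp (- (pi * (norm (W \<tau>))\<^sup>2))) * G (\<lambda>j\<in>J. w j \<bullet> z + \<tau> j) \<partial>lborel) \<partial>?P)"
    by (rule Fubini') measurable
  also have "\<dots> = (\<integral>\<^sup>+\<tau>. ennreal (exp (- (pi * (norm (W \<tau>))\<^sup>2))) * (\<integral>\<^sup>+z. G (\<lambda>j\<in>J. w j \<bullet> z + \<tau> j) \<partial>lborel) \<partial>?P)"
  proof (rule nn_integral_cong)
    fix \<tau> assume \<tau> [measurable]: "\<tau> \<in> space ?P"
    have [measurable]: "(\<lambda>z. \<lambda>j\<in>J. w j \<bullet> z + \<tau> j) \<in> measurable lborel ?P"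
      by (intro measurable_restrict) measurable
    show "(\<integral>\<^sup>+z. ennreal (exp (- (pi * (norm (W \<tau>))\<^sup>2))) * G (\<lambda>j\<in>J. w j \<bullet> z + \<tau> j) \<partial>lborel)
      = ennreal (exp (- (pi * (norm (W \<tau>))\<^sup>2))) * (\<integral>\<^sup>+z. G (\<lambda>j\<in>J. w j \<bullet> z + \<tau> j) \<partial>lborel)"
      by (rule nn_integral_cmult) measurable
  qed
  finally show ?thesis by (simp add: W_def)
qed

text \<open>For a kernel concentrated at 0 this is the Brascamp-Lieb inequality on the orthogonal complement of the
  coefficient vectors \<open>(w j \<bullet> z)\<^sub>j\<close>, on which the coordinate functionals
  have squared norms \<open>1 - (norm (w j))\<^sup>2\<close>.

  The proof is by transport. Let \<open>S j\<close> push a centred Gaussian of variance proportional to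
  \<open>1 - (norm (w j))\<^sup>2\<close> and of the same mass forward to \<open>f j\<close>. The
  variance is chosen such that the substitution \<open>\<xi> j = S j (\<tau> j)\<close> turns the
  measure \<open>(\<Prod>j. f j (\<xi> j) powr (1 - (norm (w j))\<^sup>2)) d\<xi>\<close> into
  a constant times
  \<open>exp (- pi |\<tau>|\<^sup>2) (\<Prod>j. S' j (\<tau> j) powr (norm (w j))\<^sup>2) d\<tau>\<close>,
  where \<open>S' j\<close> is the derivative of \<open>S j\<close>. Averaging over the translates from
  \<open>frame_average\<close> leaves inner integrals that \<open>frame_transport_inequality\<close>
  bounds by the integral of the kernel, and the outer Gaussian integral is 1.

  A unit vector \<open>w j\<close> has exponent 0; its coordinate is not transported, and its missing
  Gaussian factor is compensated by orthogonality to the other vectors.\<close>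

theorem brascamp_lieb_kernel:
  fixes w :: "'i \<Rightarrow> real^'n" and F f :: "'i \<Rightarrow> real \<Rightarrow> real" and M :: "'i \<Rightarrow> real"
    and \<psi> :: "real^'n \<Rightarrow> real"
  assumes J: "finite J" and id: "\<And>x. (\<Sum>j\<in>J. (w j \<bullet> x) *\<^sub>R w j) = x"
    and F0: "\<And>j s. j \<in> J \<Longrightarrow> F j s \<ge> 0" 
    and f: "\<And>j. j \<in> J \<Longrightarrow> norm (w j) < 1 \<Longrightarrow> integrable lborel (f j)"
      "\<And>j s. j \<in> J \<Longrightarrow> norm (w j) < 1 \<Longrightarrow> f j s > 0"
      "\<And>j. j \<in> J \<Longrightarrow> norm (w j) < 1 \<Longrightarrow> continuous_on UNIV (f j)"
      "\<And>j s. j \<in> J \<Longrightarrow> norm (w j) < 1 \<Longrightarrow> F j s \<le> f j s powr (1 - (norm (w j))\<^sup>2)"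
    and M: "\<And>j s. j \<in> J \<Longrightarrow> norm (w j) = 1 \<Longrightarrow> F j s \<le> M j"
    and \<psi>: "integrable lborel \<psi>" "\<And>x. \<psi> x \<ge> 0"
  shows "(\<integral>\<^sup>+\<xi>. ennreal ((\<Prod>j\<in>J. F j (\<xi> j)) * \<psi> (\<Sum>j\<in>J. \<xi> j *\<^sub>R w j)) \<partial>PiM J (\<lambda>_. lborel))
    \<le> ennreal (\<Prod>j\<in>J. if norm (w j) = 1 then M j
          else ((LINT s|lborel. f j s) / sqrt (1 - (norm (w j))\<^sup>2)) powr (1 - (norm (w j))\<^sup>2)) *
      (\<integral>\<^sup>+x. ennreal (\<psi> x) \<partial>lborel)"
proof -
  let ?P = "PiM J (\<lambda>_. lborel :: real measure)"
  define c where "c j = (norm (w j))\<^sup>2" for j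
  \<comment> \<open>\<open>A\<close> marks the coordinates that are transported; all others keep Lebesgue measure
    and the identity map.\<close>
  define A where "A j \<longleftrightarrow> j \<in> J \<and> norm (w j) < 1" for j
  define I where "I j = (LINT s|lborel. f j s)" for j
  have notA: "norm (w j) = 1" "c j = 1" if "j \<in> J" "\<not> A j" for j
    using that frame_norm_le_1[OF J id that(1)] by (auto simp: A_def c_def)
  have q: "0 < 1 - c j" if "A j" for j
    using that by (simp add: A_def c_def abs_square_less_1)
  have I: "I j > 0" if "A j" for j
    using cdf_density_strict_bounds[of "f j" 0] that f[of j] by (simp add: I_def A_def)
  have [measurable]: "\<psi> \<in> borel_measurable borel"
    using borel_measurable_integrable[OF \<psi>(1)] by simp
  interpret L: product_sigma_finite "\<lambda>_::'i. lborel :: real measure"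
    by (rule product_sigma_finite_lborel)
  define g where "g j s = I j / sqrt (1 - c j) * exp (- (pi / (1 - c j) * s\<^sup>2))" for j s
  have g: "integrable lborel (g j)" "\<And>s. g j s > 0" "continuous_on UNIV (g j)"
    "(LINT s|lborel. f j s) = (LINT s|lborel. g j s)" if "A j" for j
  proof -
    have p: "pi / (1 - c j) > 0" using q[OF that] by simp
    show "integrable lborel (g j)"
      unfolding g_def using gaussian_integral(1)[OF p] by simp
    show "g j s > 0" for s
      unfolding g_def using q[OF that] I[OF that] by simp
    show "continuous_on UNIV (g j)"
      unfolding g_def by (intro continuous_intros)
    have "(LINT s|lborel. g j s) = I j / sqrt (1 - c j) * sqrt (pi / (pi / (1 - c j)))"
      unfolding g_def by (simp only: integral_mult_right_zero gaussian_integral(2)[OF p])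
    also have "\<dots> = I j" using q[OF that] by simp
    finally show "(LINT s|lborel. f j s) = (LINT s|lborel. g j s)" by (simp add: I_def)
  qed
  have "\<exists>S. (\<forall>x. (S has_real_derivative g j x / f j (S x)) (at x)) \<and>
      distr (density lborel (g j)) borel S = density lborel (f j)" if "A j" for j
    by (rule monotone_transport_exists[of "f j" "g j"]) (use that f[of j] g[OF that] in \<open>auto simp: A_def\<close>)
  then obtain S0 where S0: "\<And>j x. A j \<Longrightarrow> (S0 j has_real_derivative g j x / f j (S0 j x)) (at x)"
    "\<And>j. A j \<Longrightarrow> distr (density lborel (g j)) borel (S0 j) = density lborel (f j)"
    by metis
  define ff gg S where "ff j = (if A j then f j else (\<lambda>_. 1))"
    and "gg j = (if A j then g j else (\<lambda>_. 1))" and "S j = (if A j then S0 j else (\<lambda>x. x))" for j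
  define S' where "S' j x = gg j x / ff j (S j x)" for j x
  have ff0: "ff j s > 0" and gg0: "gg j s > 0" for j s
    using f(2)[of j s] g(2)[of j s] by (auto simp: ff_def gg_def A_def)
  have ff_meas [measurable]: "ff j \<in> borel_measurable borel" and gg_meas [measurable]: "gg j \<in> borel_measurable borel" for j
    using f(3)[of j] g(3)[of j] by (auto simp: ff_def gg_def A_def intro: borel_measurable_continuous_onI)
  have derS: "(S j has_real_derivative S' j x) (at x)" for j x
    using S0(1)[of j x] by (auto simp: S_def S'_def ff_def gg_def)
  have S'0: "S' j x > 0" for j x
    using ff0 gg0 by (simp add: S'_def)
  have S_meas [measurable]: "S j \<in> borel_measurable borel" for j
    by (intro borel_measurable_continuous_onI continuous_at_imp_continuous_on ballI DERIV_isCont[OF derS])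
  have S'_meas [measurable]: "S' j \<in> borel_measurable borel" for j
    unfolding S'_def by measurable
  have distrS: "distr (density lborel (gg j)) (density lborel (ff j)) (S j) = density lborel (ff j)" for j
  proof -
    have "distr (density lborel (gg j)) (density lborel (ff j)) (S j) = distr (density lborel (gg j)) borel (S j)"
      by (rule distr_cong) auto
    also have "\<dots> = density lborel (ff j)"
      using S0(2)[of j] by (auto simp: S_def ff_def gg_def density_1 distr_id2)
    finally show ?thesis .
  qed
  have sf: "product_sigma_finite (\<lambda>j. density lborel (ff j))" "product_sigma_finite (\<lambda>j. density lborel (gg j))"
    unfolding product_sigma_finite_def
    by (simp_all add: sigma_finite_measure.sigma_finite_iff_density_finite[OF sigma_finite_lborel])
  \<comment> \<open>Bookkeeping of the constants: \<open>K\<close> bounds the coordinates that are not transported,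
    \<open>C\<close> comes from the masses and variances, and \<open>\<theta>\<close> is the Gaussian factor that
    remains.\<close>
  define C where "C j = (if A j then (I j / sqrt (1 - c j)) powr (1 - c j) else 1)" for j
  define K where "K j = (if A j then 1 else M j)" for j
  define \<theta> where "\<theta> j s = (if A j then exp (- (pi * s\<^sup>2)) else 1)" for j and s :: real
  have \<theta>_meas [measurable]: "\<theta> j \<in> borel_measurable borel" for j
    unfolding \<theta>_def by (cases "A j") auto
  have \<theta>0: "\<theta> j s \<ge> 0" for j s by (simp add: \<theta>_def)
  have C0: "C j \<ge> 0" for j by (simp add: C_def)
  have K0: "K j \<ge> 0" if "j \<in> J" for j
    using F0[OF that, of 0] M[OF that, of 0] notA[OF that] by (auto simp: K_def)
  have Fle: "F j s \<le> K j * (ff j s * ff j s powr (- c j))" if j: "j \<in> J" for j s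
  proof (cases "A j")
    case True
    have "f j s powr (1 - c j) = f j s * f j s powr (- c j)"
      using f(2)[of j s] True by (simp add: A_def powr_add[of _ 1 "- c j", simplified])
    then show ?thesis
      using True f(4)[of j s] by (simp add: A_def K_def ff_def c_def)
  next
    case False
    then show ?thesis
      using M[OF j notA(1)[OF j False]] by (simp add: K_def ff_def)
  qed
  have weight: "gg j s * ff j (S j s) powr (- c j) = C j * \<theta> j s * S' j s powr c j" if j: "j \<in> J" for j s
  proof -
    have "gg j s powr (1 - c j) = C j * \<theta> j s"
    proof (cases "A j")
      case True
      have "gg j s powr (1 - c j) = (I j / sqrt (1 - c j)) powr (1 - c j) * exp (- (pi / (1 - c j) * s\<^sup>2)) powr (1 - c j)"
        unfolding gg_def g_def if_P[OF True] by (rule powr_mult)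
      also have "exp (- (pi / (1 - c j) * s\<^sup>2)) powr (1 - c j) = exp (- (pi * s\<^sup>2))"
        using q[OF True] by (simp add: powr_def)
      finally show ?thesis using True by (simp add: C_def \<theta>_def)
    next
      case False
      then show ?thesis by (simp add: gg_def C_def \<theta>_def)
    qed
    moreover have "S' j s powr c j = gg j s powr c j * ff j (S j s) powr (- c j)"
      using ff0[of j "S j s"] gg0[of j s] by (simp add: S'_def powr_divide powr_minus_divide)
    moreover have "gg j s = gg j s powr (1 - c j) * gg j s powr c j"
      using gg0[of j s] by (simp add: powr_add[symmetric])
    ultimately show ?thesis by (metis mult.assoc)
  qed
  define u where "u \<xi> = (\<Prod>j\<in>J. ff j (\<xi> j) powr (- c j)) * \<psi> (\<Sum>j\<in>J. \<xi> j *\<^sub>R w j)" for \<xi> :: "'i \<Rightarrow> real"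
  have u0: "u \<xi> \<ge> 0" for \<xi> unfolding u_def using \<psi>(2) by (intro mult_nonneg_nonneg prod_nonneg) auto
  have [measurable]: "u \<in> borel_measurable ?P"
    unfolding u_def by measurable
  define G where "G \<tau> = ennreal ((\<Prod>j\<in>J. \<theta> j (\<tau> j)) * ((\<Prod>j\<in>J. S' j (\<tau> j) powr c j) * \<psi> (\<Sum>j\<in>J. S j (\<tau> j) *\<^sub>R w j)))"
    for \<tau> :: "'i \<Rightarrow> real"
  have G_meas [measurable]: "G \<in> borel_measurable ?P"
    unfolding G_def by measurable
  have "(\<integral>\<^sup>+\<xi>. ennreal ((\<Prod>j\<in>J. F j (\<xi> j)) * \<psi> (\<Sum>j\<in>J. \<xi> j *\<^sub>R w j)) \<partial>?P)
      \<le> (\<integral>\<^sup>+\<xi>. ennreal (\<Prod>j\<in>J. K j) * ((\<Prod>j\<in>J. ennreal (ff j (\<xi> j))) * ennreal (u \<xi>)) \<partial>?P)"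
  proof (rule nn_integral_mono)
    fix \<xi> :: "'i \<Rightarrow> real"
    have "(\<Prod>j\<in>J. F j (\<xi> j)) \<le> (\<Prod>j\<in>J. K j * (ff j (\<xi> j) * ff j (\<xi> j) powr (- c j)))"
      using F0 Fle by (intro prod_mono) auto
    then have "(\<Prod>j\<in>J. F j (\<xi> j)) * \<psi> (\<Sum>j\<in>J. \<xi> j *\<^sub>R w j)
        \<le> (\<Prod>j\<in>J. K j * (ff j (\<xi> j) * ff j (\<xi> j) powr (- c j))) * \<psi> (\<Sum>j\<in>J. \<xi> j *\<^sub>R w j)"
      by (intro mult_right_mono \<psi>(2))
    also have "\<dots> = (\<Prod>j\<in>J. K j) * ((\<Prod>j\<in>J. ff j (\<xi> j)) * u \<xi>)"
      by (simp add: prod.distrib u_def mult_ac)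
    finally have "(\<Prod>j\<in>J. F j (\<xi> j)) * \<psi> (\<Sum>j\<in>J. \<xi> j *\<^sub>R w j)
        \<le> (\<Prod>j\<in>J. K j) * ((\<Prod>j\<in>J. ff j (\<xi> j)) * u \<xi>)" .
    then have "ennreal ((\<Prod>j\<in>J. F j (\<xi> j)) * \<psi> (\<Sum>j\<in>J. \<xi> j *\<^sub>R w j)) \<le> ennreal ((\<Prod>j\<in>J. K j) * ((\<Prod>j\<in>J. ff j (\<xi> j)) * u \<xi>))"
      by (rule ennreal_leI)
    also have "\<dots> = ennreal (\<Prod>j\<in>J. K j) * ((\<Prod>j\<in>J. ennreal (ff j (\<xi> j))) * ennreal (u \<xi>))"
      using K0 ff0 u0 by (simp add: ennreal_mult prod_nonneg prod_ennreal less_imp_le)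
    finally show "ennreal ((\<Prod>j\<in>J. F j (\<xi> j)) * \<psi> (\<Sum>j\<in>J. \<xi> j *\<^sub>R w j))
      \<le> ennreal (\<Prod>j\<in>J. K j) * ((\<Prod>j\<in>J. ennreal (ff j (\<xi> j))) * ennreal (u \<xi>))" .
  qed
  also have "\<dots> = ennreal (\<Prod>j\<in>J. K j) * (\<integral>\<^sup>+\<xi>. (\<Prod>j\<in>J. ennreal (ff j (\<xi> j))) * ennreal (u \<xi>) \<partial>?P)"
    by (rule nn_integral_cmult) measurable
  also have "(\<integral>\<^sup>+\<xi>. (\<Prod>j\<in>J. ennreal (ff j (\<xi> j))) * ennreal (u \<xi>) \<partial>?P)
      = (\<integral>\<^sup>+\<xi>. ennreal (u \<xi>) \<partial>density ?P (\<lambda>\<xi>. \<Prod>j\<in>J. ennreal (ff j (\<xi> j))))"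
    by (rule nn_integral_density[symmetric]) measurable
  also have "density ?P (\<lambda>\<xi>. \<Prod>j\<in>J. ennreal (ff j (\<xi> j))) = PiM J (\<lambda>j. density lborel (ff j))"
    by (rule PiM_density_lborel[OF J ff_meas sf(1), symmetric])
  also have "\<dots> = distr (PiM J (\<lambda>j. density lborel (gg j))) (PiM J (\<lambda>j. density lborel (ff j))) (\<lambda>\<tau>. \<lambda>j\<in>J. S j (\<tau> j))"
    by (rule distr_PiM_components[OF J sf _ distrS, symmetric]) simp
  also have "(\<integral>\<^sup>+\<xi>. ennreal (u \<xi>) \<partial>distr (PiM J (\<lambda>j. density lborel (gg j))) (PiM J (\<lambda>j. density lborel (ff j))) (\<lambda>\<tau>. \<lambda>j\<in>J. S j (\<tau> j)))
      = (\<integral>\<^sup>+\<tau>. ennreal (u (\<lambda>j\<in>J. S j (\<tau> j))) \<partial>PiM J (\<lambda>j. density lborel (gg j)))"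
  proof (rule nn_integral_distr)
    show "(\<lambda>\<tau>. \<lambda>j\<in>J. S j (\<tau> j)) \<in> PiM J (\<lambda>j. density lborel (gg j)) \<rightarrow>\<^sub>M PiM J (\<lambda>j. density lborel (ff j))"
      by (intro measurable_restrict) (simp add: measurable_component_singleton)
    have sets_eq: "sets (PiM J (\<lambda>j. density lborel (ff j))) = sets ?P"
      by (rule sets_PiM_cong) auto
    show "(\<lambda>\<xi>. ennreal (u \<xi>)) \<in> borel_measurable (distr (PiM J (\<lambda>j. density lborel (gg j)))
        (PiM J (\<lambda>j. density lborel (ff j))) (\<lambda>\<tau>. \<lambda>j\<in>J. S j (\<tau> j)))"
      unfolding measurable_distr_eq1 measurable_cong_sets[OF sets_eq refl] by measurable
  qed
  also have "PiM J (\<lambda>j. density lborel (gg j)) = density ?P (\<lambda>\<tau>. \<Prod>j\<in>J. ennreal (gg j (\<tau> j)))"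
    by (rule PiM_density_lborel[OF J gg_meas sf(2)])
  also have "(\<integral>\<^sup>+\<tau>. ennreal (u (\<lambda>j\<in>J. S j (\<tau> j))) \<partial>density ?P (\<lambda>\<tau>. \<Prod>j\<in>J. ennreal (gg j (\<tau> j))))
      = (\<integral>\<^sup>+\<tau>. (\<Prod>j\<in>J. ennreal (gg j (\<tau> j))) * ennreal (u (\<lambda>j\<in>J. S j (\<tau> j))) \<partial>?P)"
    by (rule nn_integral_density) measurable
  also have "\<dots> = (\<integral>\<^sup>+\<tau>. ennreal (\<Prod>j\<in>J. C j) * G \<tau> \<partial>?P)"
  proof (rule nn_integral_cong)
    fix \<tau> :: "'i \<Rightarrow> real"
    have "(\<Prod>j\<in>J. gg j (\<tau> j)) * u (\<lambda>j\<in>J. S j (\<tau> j))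
        = (\<Prod>j\<in>J. gg j (\<tau> j) * ff j (S j (\<tau> j)) powr (- c j)) * \<psi> (\<Sum>j\<in>J. S j (\<tau> j) *\<^sub>R w j)"
      by (simp add: u_def prod.distrib cong: prod.cong sum.cong)
    also have "\<dots> = (\<Prod>j\<in>J. C j * \<theta> j (\<tau> j) * S' j (\<tau> j) powr c j) * \<psi> (\<Sum>j\<in>J. S j (\<tau> j) *\<^sub>R w j)"
      by (simp add: weight cong: prod.cong)
    finally have "(\<Prod>j\<in>J. gg j (\<tau> j)) * u (\<lambda>j\<in>J. S j (\<tau> j)) = (\<Prod>j\<in>J. C j) *
        ((\<Prod>j\<in>J. \<theta> j (\<tau> j)) * ((\<Prod>j\<in>J. S' j (\<tau> j) powr c j) * \<psi> (\<Sum>j\<in>J. S j (\<tau> j) *\<^sub>R w j)))"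
      by (simp add: prod.distrib)
    then have "ennreal ((\<Prod>j\<in>J. gg j (\<tau> j)) * u (\<lambda>j\<in>J. S j (\<tau> j))) = ennreal (\<Prod>j\<in>J. C j) * G \<tau>"
      unfolding G_def using C0 by (simp add: ennreal_mult' prod_nonneg)
    then show "(\<Prod>j\<in>J. ennreal (gg j (\<tau> j))) * ennreal (u (\<lambda>j\<in>J. S j (\<tau> j))) = ennreal (\<Prod>j\<in>J. C j) * G \<tau>"
      using gg0 u0 by (simp add: ennreal_mult prod_nonneg prod_ennreal less_imp_le)
  qed
  also have "\<dots> = ennreal (\<Prod>j\<in>J. C j) * (\<integral>\<^sup>+\<tau>. G \<tau> \<partial>?P)"
    by (rule nn_integral_cmult) measurable
  also have "(\<integral>\<^sup>+\<tau>. G \<tau> \<partial>?P) \<le> (\<integral>\<^sup>+x. ennreal (\<psi> x) \<partial>lborel)"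
  proof -
    define Y where "Y \<tau> z = ennreal ((\<Prod>j\<in>J. S' j (\<tau> j + w j \<bullet> z) powr (norm (w j))\<^sup>2)
        * \<psi> (\<Sum>j\<in>J. S j (\<tau> j + w j \<bullet> z) *\<^sub>R w j))" for \<tau> z
    have Y_le: "(\<integral>\<^sup>+z. Y \<tau> z \<partial>lborel) \<le> (\<integral>\<^sup>+x. ennreal (\<psi> x) \<partial>lborel)" for \<tau>
      unfolding Y_def by (rule frame_transport_inequality[OF J id derS S'0 S'_meas \<psi>])
    have GY: "ennreal (exp (- (pi * (norm (\<Sum>j\<in>J. \<tau> j *\<^sub>R w j))\<^sup>2))) * G (\<lambda>j\<in>J. w j \<bullet> z + \<tau> j)
        \<le> (\<Prod>j\<in>J. ennreal (exp (- (pi * (\<tau> j)\<^sup>2)))) * Y \<tau> z" for \<tau> z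
    proof -
      let ?W = "\<Sum>j\<in>J. \<tau> j *\<^sub>R w j"
      \<comment> \<open>The translation changes \<open>|\<tau>|\<^sup>2\<close> by the same amount as
        \<open>|W \<tau>|\<^sup>2\<close>, and the unit vectors contribute at most
        \<open>|W \<sigma>|\<^sup>2\<close> to \<open>|\<sigma>|\<^sup>2\<close>.\<close>
      define \<sigma> where "\<sigma> j = w j \<bullet> z + \<tau> j" for j
      have Wz: "(\<Sum>j\<in>J. \<sigma> j *\<^sub>R w j) = z + ?W"
        by (simp add: \<sigma>_def scaleR_add_left sum.distrib id)
      have cross: "(\<Sum>j\<in>J. \<tau> j * (w j \<bullet> z)) = ?W \<bullet> z"
        by (simp add: inner_sum_left)
      have "(\<Sum>j\<in>J. (\<sigma> j)\<^sup>2) = (\<Sum>j\<in>J. (w j \<bullet> z)\<^sup>2) + 2 * (\<Sum>j\<in>J. \<tau> j * (w j \<bullet> z)) + (\<Sum>j\<in>J. (\<tau> j)\<^sup>2)"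
        by (simp add: \<sigma>_def power2_sum sum.distrib sum_distrib_left mult_ac)
      also have "\<dots> = (norm (z + ?W))\<^sup>2 - (norm ?W)\<^sup>2 + (\<Sum>j\<in>J. (\<tau> j)\<^sup>2)"
        unfolding cross frame_Parseval[OF id]
        by (simp add: power2_norm_eq_inner inner_add_left inner_add_right inner_commute)
      finally have s1: "(\<Sum>j\<in>J. (\<sigma> j)\<^sup>2) = (norm (z + ?W))\<^sup>2 - (norm ?W)\<^sup>2 + (\<Sum>j\<in>J. (\<tau> j)\<^sup>2)" .
      have "(\<Sum>j\<in>J. (\<sigma> j)\<^sup>2) = (\<Sum>j\<in>{j\<in>J. A j}. (\<sigma> j)\<^sup>2) + (\<Sum>j\<in>{j\<in>J. norm (w j) = 1}. (\<sigma> j)\<^sup>2)"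
        using J notA by (subst sum.union_disjoint[symmetric]) (auto simp: A_def intro!: sum.cong)
      moreover have "(\<Sum>j\<in>{j\<in>J. norm (w j) = 1}. (\<sigma> j)\<^sup>2) \<le> (norm (z + ?W))\<^sup>2"
        using frame_unit_part_le[OF J id, of \<sigma>] by (simp add: Wz)
      ultimately have s2: "(\<Sum>j\<in>J. (\<tau> j)\<^sup>2) \<le> (norm ?W)\<^sup>2 + (\<Sum>j\<in>{j\<in>J. A j}. (\<sigma> j)\<^sup>2)"
        using s1 by linarith
      have "(\<Prod>j\<in>J. \<theta> j (\<sigma> j)) = (\<Prod>j\<in>{j\<in>J. A j}. exp (- (pi * (\<sigma> j)\<^sup>2)))"
        unfolding \<theta>_def using J by (intro prod.mono_neutral_cong_right) auto
      also have "\<dots> = exp (- (pi * (\<Sum>j\<in>{j\<in>J. A j}. (\<sigma> j)\<^sup>2)))"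
        using J by (simp add: exp_sum[symmetric] sum_negf sum_distrib_left)
      finally have "exp (- (pi * (norm ?W)\<^sup>2)) * (\<Prod>j\<in>J. \<theta> j (\<sigma> j))
          = exp (- (pi * ((norm ?W)\<^sup>2 + (\<Sum>j\<in>{j\<in>J. A j}. (\<sigma> j)\<^sup>2))))"
        by (simp add: exp_add[symmetric] algebra_simps)
      also have "\<dots> \<le> exp (- (pi * (\<Sum>j\<in>J. (\<tau> j)\<^sup>2)))"
        using s2 by simp
      also have "\<dots> = (\<Prod>j\<in>J. exp (- (pi * (\<tau> j)\<^sup>2)))"
        using J by (simp add: exp_sum[symmetric] sum_negf sum_distrib_left)
      finally have le: "exp (- (pi * (norm ?W)\<^sup>2)) * (\<Prod>j\<in>J. \<theta> j (\<sigma> j)) \<le> (\<Prod>j\<in>J. exp (- (pi * (\<tau> j)\<^sup>2)))" .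
      define y where "y = (\<Prod>j\<in>J. S' j (\<sigma> j) powr c j) * \<psi> (\<Sum>j\<in>J. S j (\<sigma> j) *\<^sub>R w j)"
      have y0: "y \<ge> 0" unfolding y_def using \<psi>(2) by (intro mult_nonneg_nonneg prod_nonneg) auto
      have "G (\<lambda>j\<in>J. w j \<bullet> z + \<tau> j) = ennreal ((\<Prod>j\<in>J. \<theta> j (\<sigma> j)) * y)"
        unfolding G_def y_def \<sigma>_def by (simp cong: prod.cong sum.cong)
      then have "ennreal (exp (- (pi * (norm ?W)\<^sup>2))) * G (\<lambda>j\<in>J. w j \<bullet> z + \<tau> j)
          = ennreal (exp (- (pi * (norm ?W)\<^sup>2)) * (\<Prod>j\<in>J. \<theta> j (\<sigma> j)) * y)"
        by (simp add: ennreal_mult'[symmetric] mult.assoc)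
      also have "\<dots> \<le> ennreal ((\<Prod>j\<in>J. exp (- (pi * (\<tau> j)\<^sup>2))) * y)"
        using le y0 by (intro ennreal_leI mult_right_mono)
      also have "\<dots> = (\<Prod>j\<in>J. ennreal (exp (- (pi * (\<tau> j)\<^sup>2)))) * ennreal y"
        by (simp add: ennreal_mult' prod_nonneg prod_ennreal)
      also have "ennreal y = Y \<tau> z"
        by (simp add: y_def Y_def \<sigma>_def c_def add.commute)
      finally show ?thesis .
    qed
    have [measurable]: "(\<lambda>z. \<lambda>j\<in>J. w j \<bullet> z + \<tau> j) \<in> measurable lborel ?P" for \<tau> :: "'i \<Rightarrow> real"
      by (intro measurable_restrict) measurable
    have Y_meas [measurable]: "Y \<tau> \<in> borel_measurable lborel" for \<tau>
      unfolding Y_def by measurable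
    have "(\<integral>\<^sup>+\<tau>. G \<tau> \<partial>?P) = (\<integral>\<^sup>+\<tau>. ennreal (exp (- (pi * (norm (\<Sum>j\<in>J. \<tau> j *\<^sub>R w j))\<^sup>2))) *
       (\<integral>\<^sup>+z. G (\<lambda>j\<in>J. w j \<bullet> z + \<tau> j) \<partial>lborel) \<partial>?P)"
      by (rule frame_average[OF J id G_meas])
    also have "\<dots> \<le> (\<integral>\<^sup>+\<tau>. (\<Prod>j\<in>J. ennreal (exp (- (pi * (\<tau> j)\<^sup>2)))) * (\<integral>\<^sup>+x. ennreal (\<psi> x) \<partial>lborel) \<partial>?P)"
    proof (rule nn_integral_mono)
      fix \<tau> :: "'i \<Rightarrow> real"
      have "ennreal (exp (- (pi * (norm (\<Sum>j\<in>J. \<tau> j *\<^sub>R w j))\<^sup>2))) * (\<integral>\<^sup>+z. G (\<lambda>j\<in>J. w j \<bullet> z + \<tau> j) \<partial>lborel)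
          = (\<integral>\<^sup>+z. ennreal (exp (- (pi * (norm (\<Sum>j\<in>J. \<tau> j *\<^sub>R w j))\<^sup>2))) * G (\<lambda>j\<in>J. w j \<bullet> z + \<tau> j) \<partial>lborel)"
        by (rule nn_integral_cmult[symmetric]) measurable
      also have "\<dots> \<le> (\<integral>\<^sup>+z. (\<Prod>j\<in>J. ennreal (exp (- (pi * (\<tau> j)\<^sup>2)))) * Y \<tau> z \<partial>lborel)"
        by (intro nn_integral_mono GY)
      also have "\<dots> = (\<Prod>j\<in>J. ennreal (exp (- (pi * (\<tau> j)\<^sup>2)))) * (\<integral>\<^sup>+z. Y \<tau> z \<partial>lborel)"
        by (rule nn_integral_cmult) measurable
      also have "\<dots> \<le> (\<Prod>j\<in>J. ennreal (exp (- (pi * (\<tau> j)\<^sup>2)))) * (\<integral>\<^sup>+x. ennreal (\<psi> x) \<partial>lborel)"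
        by (intro mult_left_mono Y_le) simp
      finally show "ennreal (exp (- (pi * (norm (\<Sum>j\<in>J. \<tau> j *\<^sub>R w j))\<^sup>2))) *
          (\<integral>\<^sup>+z. G (\<lambda>j\<in>J. w j \<bullet> z + \<tau> j) \<partial>lborel)
        \<le> (\<Prod>j\<in>J. ennreal (exp (- (pi * (\<tau> j)\<^sup>2)))) * (\<integral>\<^sup>+x. ennreal (\<psi> x) \<partial>lborel)" .
    qed
    also have "\<dots> = (\<integral>\<^sup>+\<tau>. (\<Prod>j\<in>J. ennreal (exp (- (pi * (\<tau> j)\<^sup>2)))) \<partial>?P) * (\<integral>\<^sup>+x. ennreal (\<psi> x) \<partial>lborel)"
      by (rule nn_integral_multc) measurable
    also have "(\<integral>\<^sup>+\<tau>. (\<Prod>j\<in>J. ennreal (exp (- (pi * (\<tau> j)\<^sup>2)))) \<partial>?P) = (\<Prod>j\<in>J. \<integral>\<^sup>+s. ennreal (exp (- (pi * s\<^sup>2))) \<partial>lborel)"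
      by (rule L.product_nn_integral_prod[OF J]) measurable
    also have "\<dots> = 1"
      using nn_integral_gaussian[of pi] by simp
    finally show ?thesis by simp
  qed
  finally have "(\<integral>\<^sup>+\<xi>. ennreal ((\<Prod>j\<in>J. F j (\<xi> j)) * \<psi> (\<Sum>j\<in>J. \<xi> j *\<^sub>R w j)) \<partial>?P)
      \<le> ennreal (\<Prod>j\<in>J. K j) * (ennreal (\<Prod>j\<in>J. C j) * (\<integral>\<^sup>+x. ennreal (\<psi> x) \<partial>lborel))"
    by (simp add: mult_left_mono)
  also have "\<dots> = ennreal (\<Prod>j\<in>J. K j * C j) * (\<integral>\<^sup>+x. ennreal (\<psi> x) \<partial>lborel)"
    using K0 C0 by (simp add: prod.distrib ennreal_mult prod_nonneg mult.assoc)
  also have "(\<Prod>j\<in>J. K j * C j) = (\<Prod>j\<in>J. if norm (w j) = 1 then M j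
          else ((LINT s|lborel. f j s) / sqrt (1 - (norm (w j))\<^sup>2)) powr (1 - (norm (w j))\<^sup>2))"
    using notA by (intro prod.cong) (auto simp: K_def C_def I_def c_def A_def)
  finally show ?thesis .
qed

section \<open>The Gaussian plateau and its Fourier transform\<close>

lemma measurable_cis [measurable]: "cis \<in> borel_measurable borel"
  by (intro borel_measurable_continuous_onI continuous_intros)

lemma gaussian_fourier_std:
  "(LINT x|lborel. complex_of_real (std_normal_density x) * cis (t * x)) = complex_of_real (exp (- (t\<^sup>2) / 2))"
proof -
  have "char std_normal_distribution t = (CLINT x|density lborel std_normal_density. cis (t * x))"
    unfolding char_def by (simp add: cis_conv_exp)
  also have "\<dots> = (LINT x|lborel. std_normal_density x *\<^sub>R cis (t * x))"
    by (rule integral_density) auto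
  finally show ?thesis
    by (simp add: char_std_normal_distribution scaleR_conv_of_real)
qed

text \<open>Scaling of the characteristic function of the standard normal distribution.\<close>

lemma gaussian_fourier:
  assumes a: "a > 0"
  shows "integrable lborel (\<lambda>x. complex_of_real (exp (- (a * x\<^sup>2))) * cis (s * x))"
    and "(LINT x|lborel. complex_of_real (exp (- (a * x\<^sup>2))) * cis (s * x))
      = complex_of_real (sqrt (pi / a) * exp (- (s\<^sup>2 / (4 * a))))"
proof -
  show "integrable lborel (\<lambda>x. complex_of_real (exp (- (a * x\<^sup>2))) * cis (s * x))"
    by (rule Bochner_Integration.integrable_bound[OF gaussian_integral(1)[OF a]])
      (auto simp: norm_mult cis_conv_exp)
  define r where "r = sqrt (2 * a)"
  have r: "r > 0" "r\<^sup>2 = 2 * a" using a by (auto simp: r_def)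
  define t where "t = s / r"
  have "complex_of_real (exp (- (t\<^sup>2) / 2))
      = (LINT x|lborel. complex_of_real (std_normal_density x) * cis (t * x))"
    by (rule gaussian_fourier_std[symmetric])
  also have "\<dots> = \<bar>r\<bar> *\<^sub>R (LINT x|lborel. complex_of_real (std_normal_density (0 + r * x)) * cis (t * (0 + r * x)))"
    using r by (intro lborel_integral_real_affine) auto
  also have "(LINT x|lborel. complex_of_real (std_normal_density (0 + r * x)) * cis (t * (0 + r * x)))
      = (LINT x|lborel. complex_of_real (1 / sqrt (2 * pi)) * (complex_of_real (exp (- (a * x\<^sup>2))) * cis (s * x)))"
    using r by (intro Bochner_Integration.integral_cong) (auto simp: std_normal_density_def power_mult_distrib t_def)
  also have "\<dots> = complex_of_real (1 / sqrt (2 * pi)) * (LINT x|lborel. complex_of_real (exp (- (a * x\<^sup>2))) * cis (s * x))"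
    by (rule integral_mult_right_zero)
  finally have eq: "complex_of_real (exp (- (t\<^sup>2) / 2)) =
      complex_of_real (r / sqrt (2 * pi)) * (LINT x|lborel. complex_of_real (exp (- (a * x\<^sup>2))) * cis (s * x))"
    using r by (simp add: scaleR_conv_of_real)
  have "t\<^sup>2 / 2 = s\<^sup>2 / (4 * a)"
    using r by (simp add: t_def power_divide)
  then have t: "- (t\<^sup>2) / 2 = - (s\<^sup>2 / (4 * a))" by simp
  have q: "sqrt (pi / a) = sqrt (2 * pi) / r"
    using a by (simp add: r_def real_sqrt_divide real_sqrt_mult)
  have "complex_of_real (sqrt (2 * pi) / r) * complex_of_real (exp (- (t\<^sup>2) / 2))
     = complex_of_real (sqrt (2 * pi) / r * (r / sqrt (2 * pi))) * (LINT x|lborel. complex_of_real (exp (- (a * x\<^sup>2))) * cis (s * x))"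
    unfolding eq by simp
  then show "(LINT x|lborel. complex_of_real (exp (- (a * x\<^sup>2))) * cis (s * x))
      = complex_of_real (sqrt (pi / a) * exp (- (s\<^sup>2 / (4 * a))))"
    using r unfolding t q by simp
qed

lemma gaussian_cosine:
  assumes a: "a > 0"
  shows "(LINT x|lborel. exp (- (a * x\<^sup>2)) * cos (s * x)) = sqrt (pi / a) * exp (- (s\<^sup>2 / (4 * a)))"
proof -
  have "(LINT x|lborel. Re (complex_of_real (exp (- (a * x\<^sup>2))) * cis (s * x)))
      = Re (LINT x|lborel. complex_of_real (exp (- (a * x\<^sup>2))) * cis (s * x))"
    by (rule integral_Re[OF gaussian_fourier(1)[OF a]])
  then show ?thesis
    unfolding gaussian_fourier(2)[OF a] by simp
qed

text \<open>The function \<open>exp (- pi d\<^sup>2)\<close> of the distance \<open>d\<close> to the interval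
  \<open>[-a, a]\<close>.\<close>

definition gauss_plateau :: "real \<Rightarrow> real \<Rightarrow> real" where
  "gauss_plateau a y = exp (- (pi * (max 0 (\<bar>y\<bar> - a))\<^sup>2))"

text \<open>The Fourier transform of the plateau, written as a cosine integral because the plateau is even; it is
  the function whose powers occur in \<open>wills_h\<close>.\<close>

definition plateau_hat :: "real \<Rightarrow> real \<Rightarrow> real" where
  "plateau_hat a s = (LINT y|lborel. gauss_plateau a y * cos (s * y))"

lemma gauss_plateau_bounds: "0 < gauss_plateau a y" "gauss_plateau a y \<le> 1"
  by (simp_all add: gauss_plateau_def)

lemma gauss_plateau_even: "gauss_plateau a (- y) = gauss_plateau a y"
  by (simp add: gauss_plateau_def)

lemma continuous_gauss_plateau: "continuous_on UNIV (gauss_plateau a)"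
  unfolding gauss_plateau_def by (intro continuous_intros)

lemma measurable_gauss_plateau [measurable]: "gauss_plateau a \<in> borel_measurable borel"
  by (rule borel_measurable_continuous_onI[OF continuous_gauss_plateau])

definition half_gauss :: "real \<Rightarrow> real" where
  "half_gauss y = indicator {0<..} y * exp (- (pi * y\<^sup>2))"

lemma integrable_half_gauss: "integrable lborel half_gauss"
  unfolding half_gauss_def
  by (rule Bochner_Integration.integrable_bound[OF gaussian_integral(1)[of pi]]) (auto simp: indicator_def)

lemma measurable_half_gauss [measurable]: "half_gauss \<in> borel_measurable borel"
  unfolding half_gauss_def by measurable

lemma gauss_plateau_decompose:
  assumes "a \<ge> 0"
  shows "gauss_plateau a y = indicator {-a..a} y + half_gauss (y - a) + half_gauss (- y - a)"
proof -
  consider "\<bar>y\<bar> \<le> a" | "y > a" | "y < - a" by linarith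
  then show ?thesis
  proof cases
    case 1
    then show ?thesis by (auto simp: gauss_plateau_def half_gauss_def indicator_def max_def)
  next
    case 2
    then show ?thesis using assms by (auto simp: gauss_plateau_def half_gauss_def indicator_def max_def)
  next
    case 3
    then have "\<bar>y\<bar> - a = - y - a" using assms by simp
    then show ?thesis using 3 assms by (auto simp: gauss_plateau_def half_gauss_def indicator_def max_def)
  qed
qed

lemma integrable_half_gauss_shift:
  "integrable lborel (\<lambda>y. half_gauss (y - a))" "integrable lborel (\<lambda>y. half_gauss (- y - a))"
  using lborel_integrable_real_affine[OF integrable_half_gauss, of 1 "- a"]
    lborel_integrable_real_affine[OF integrable_half_gauss, of "-1" "- a"]
  by (simp_all add: algebra_simps)

lemma integrable_bounded_mult:
  fixes f g :: "'a \<Rightarrow> real"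
  assumes "integrable M f" "g \<in> borel_measurable M" "\<And>x. \<bar>g x\<bar> \<le> 1"
  shows "integrable M (\<lambda>x. f x * g x)"
proof (rule Bochner_Integration.integrable_bound[OF assms(1)])
  show "AE x in M. norm (f x * g x) \<le> norm (f x)"
    using assms(3) by (intro AE_I2) (simp add: abs_mult mult_left_le)
qed (use assms borel_measurable_integrable in auto)

lemma integrable_indicator_Icc: "integrable lborel (indicator {a..b::real} :: real \<Rightarrow> real)"
  by (rule integrable_real_indicator) (auto simp: emeasure_lborel_Icc_eq)

lemma integrable_gauss_plateau:
  assumes "a \<ge> 0"
  shows "integrable lborel (gauss_plateau a)"
proof -
  have "integrable lborel (indicator {-a..a} :: real \<Rightarrow> real)"
    by (rule integrable_indicator_Icc)
  then show ?thesis
    unfolding gauss_plateau_decompose[OF assms, abs_def]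
    using integrable_half_gauss_shift by (intro Bochner_Integration.integrable_add) auto
qed

lemma integral_cos_Icc:
  fixes r s :: real
  assumes "0 \<le> r" "s \<noteq> 0"
  shows "(LINT y|lborel. indicator {-r..r} y * cos (s * y)) = 2 * sin (r * s) / s"
proof -
  have "(LINT y|lborel. cos (s * y) * indicator {-r..r} y) = sin (s * r) / s - sin (s * (- r)) / s"
    using assms by (intro integral_FTC_Icc_real[where F = "\<lambda>y. sin (s * y) / s"]) (auto intro!: derivative_eq_intros)
  then show ?thesis
    by (simp add: mult.commute add_divide_distrib[symmetric])
qed

lemma integral_half_gauss_cos:
  "(LINT y|lborel. half_gauss y * cos (s * y)) = exp (- (s\<^sup>2 / (4 * pi))) / 2"
proof -
  have i: "integrable lborel (\<lambda>y. half_gauss y * cos (s * y))"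
    by (intro integrable_bounded_mult integrable_half_gauss) auto
  have flip: "(LINT y|lborel. half_gauss y * cos (s * y)) = (LINT y|lborel. half_gauss (- y) * cos (s * y))"
    by (subst lborel_integral_real_affine[of "-1" _ 0]) auto
  have i': "integrable lborel (\<lambda>y. half_gauss (- y) * cos (s * y))"
    using integrable_half_gauss_shift(2)[of 0] by (intro integrable_bounded_mult) auto
  have "2 * (LINT y|lborel. half_gauss y * cos (s * y))
      = (LINT y|lborel. half_gauss y * cos (s * y) + half_gauss (- y) * cos (s * y))"
    using i i' flip by simp
  also have "\<dots> = (LINT y|lborel. exp (- (pi * y\<^sup>2)) * cos (s * y))"
  proof (rule integral_cong_AE)
    show "AE y in lborel. half_gauss y * cos (s * y) + half_gauss (- y) * cos (s * y) = exp (- (pi * y\<^sup>2)) * cos (s * y)"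
      by (rule AE_mp[OF AE_lborel_singleton[of 0]], rule AE_I2) (auto simp: half_gauss_def indicator_def)
  qed auto
  also have "\<dots> = exp (- (s\<^sup>2 / (4 * pi)))"
    using gaussian_cosine[of pi s] by simp
  finally show ?thesis by simp
qed

lemma plateau_hat_expand:
  assumes a: "a \<ge> 0"
  shows "plateau_hat a s = (LINT y|lborel. indicator {-a..a} y * cos (s * y))
    + 2 * (LINT y|lborel. half_gauss y * cos (s * (y + a)))"
proof -
  have i1: "integrable lborel (\<lambda>y. indicator {-a..a} y * cos (s * y))"
    by (intro integrable_bounded_mult integrable_indicator_Icc) auto
  have i2: "integrable lborel (\<lambda>y. half_gauss (y - a) * cos (s * y))"
    and i3: "integrable lborel (\<lambda>y. half_gauss (- y - a) * cos (s * y))"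
    by (auto intro!: integrable_bounded_mult integrable_half_gauss_shift)
  have e2: "(LINT y|lborel. half_gauss (y - a) * cos (s * y)) = (LINT y|lborel. half_gauss y * cos (s * (y + a)))"
    by (subst lborel_integral_real_affine[of 1 _ a]) (auto simp: add.commute)
  have e3: "(LINT y|lborel. half_gauss (- y - a) * cos (s * y)) = (LINT y|lborel. half_gauss y * cos (s * (y + a)))"
  proof -
    have "cos (s * (- a - y)) = cos (s * (y + a))" for y
      using cos_minus[of "s * (y + a)"] by (simp add: algebra_simps)
    then show ?thesis
      by (subst lborel_integral_real_affine[of "-1" _ "- a"]) auto
  qed
  have "plateau_hat a s = (LINT y|lborel. indicator {-a..a} y * cos (s * y)
      + half_gauss (y - a) * cos (s * y) + half_gauss (- y - a) * cos (s * y))"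
    unfolding plateau_hat_def gauss_plateau_decompose[OF a] by (simp add: algebra_simps)
  then show ?thesis
    using i1 i2 i3 by (simp add: e2 e3)
qed

lemma plateau_hat_formula:
  assumes a: "a \<ge> 0" and s: "s \<noteq> 0"
  shows "plateau_hat a s = 2 * sin (a * s) / s + cos (a * s) * exp (- (s\<^sup>2 / (4 * pi)))
    - 2 * sin (a * s) * (LINT y:{0..}|lborel. exp (- pi * y\<^sup>2) * sin (y * s))"
proof -
  have ic: "integrable lborel (\<lambda>y. half_gauss y * cos (s * y))"
    and isn: "integrable lborel (\<lambda>y. half_gauss y * sin (s * y))"
    by (auto intro!: integrable_bounded_mult integrable_half_gauss)
  have "half_gauss y * cos (s * (y + a)) = cos (a * s) * (half_gauss y * cos (s * y)) - sin (a * s) * (half_gauss y * sin (s * y))" for y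
    by (simp add: distrib_left cos_add algebra_simps)
  then have "(LINT y|lborel. half_gauss y * cos (s * (y + a)))
      = cos (a * s) * (LINT y|lborel. half_gauss y * cos (s * y)) - sin (a * s) * (LINT y|lborel. half_gauss y * sin (s * y))"
    using ic isn by simp
  moreover have "(LINT y|lborel. half_gauss y * sin (s * y)) = (LINT y:{0..}|lborel. exp (- pi * y\<^sup>2) * sin (y * s))"
    unfolding set_lebesgue_integral_def
    by (intro Bochner_Integration.integral_cong) (auto simp: half_gauss_def indicator_def mult.commute)
  ultimately show ?thesis
    unfolding plateau_hat_expand[OF a] integral_cos_Icc[OF a s] integral_half_gauss_cos by simp
qed

lemma plateau_hat_0:
  assumes a: "a \<ge> 0"
  shows "plateau_hat a 0 = 2 * a + 1"
proof -
  have "(LINT y|lborel. half_gauss y) = 1 / 2"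
    using integral_half_gauss_cos[of 0] by simp
  then show ?thesis
    unfolding plateau_hat_expand[OF a] using a by simp
qed

lemma abs_plateau_hat_le:
  assumes a: "a \<ge> 0"
  shows "\<bar>plateau_hat a s\<bar> \<le> 2 * a + 1"
proof -
  have "\<bar>plateau_hat a s\<bar> \<le> (LINT y|lborel. \<bar>gauss_plateau a y * cos (s * y)\<bar>)"
    unfolding plateau_hat_def by (rule integral_abs_bound)
  also have "\<dots> \<le> (LINT y|lborel. gauss_plateau a y)"
  proof (rule integral_mono)
    show "integrable lborel (\<lambda>y. \<bar>gauss_plateau a y * cos (s * y)\<bar>)"
      by (intro integrable_abs integrable_bounded_mult integrable_gauss_plateau a) auto
    show "integrable lborel (gauss_plateau a)"
      by (rule integrable_gauss_plateau[OF a])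
    show "\<bar>gauss_plateau a y * cos (s * y)\<bar> \<le> gauss_plateau a y" for y
      using gauss_plateau_bounds[of a y] by (simp add: abs_mult mult_left_le)
  qed
  also have "\<dots> = 2 * a + 1"
    using plateau_hat_0[OF a] by (simp add: plateau_hat_def)
  finally show ?thesis .
qed

text \<open>Write the plateau as a superposition of indicators of its superlevel sets. These are symmetric
  intervals, and the cosine integral over a symmetric interval is at most
  \<open>2 / \<bar>s\<bar>\<close>.\<close>

lemma plateau_hat_decay:
  assumes a: "a \<ge> 0" and s: "s \<noteq> 0"
  shows "\<bar>plateau_hat a s\<bar> \<le> 2 / \<bar>s\<bar>"
proof -
  \<comment> \<open>The superlevel set of height \<open>u\<close> is \<open>[- r u, r u]\<close>.\<close>
  define r where "r u = a + sqrt (- ln u / pi)" for u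
  have level: "u \<le> gauss_plateau a y \<longleftrightarrow> y \<in> {- r u..r u}" if u: "0 < u" "u < 1" for u y
  proof -
    have lnu: "ln u / pi \<le> 0" using u by (intro divide_nonpos_pos) auto
    have "u \<le> gauss_plateau a y \<longleftrightarrow> ln u \<le> - (pi * (max 0 (\<bar>y\<bar> - a))\<^sup>2)"
      unfolding gauss_plateau_def by (rule exp_le_cancel_iff[of "ln u", unfolded exp_ln[OF u(1)]])
    also have "\<dots> \<longleftrightarrow> (max 0 (\<bar>y\<bar> - a))\<^sup>2 \<le> (sqrt (- ln u / pi))\<^sup>2"
      using u by (simp add: field_simps) linarith
    also have "\<dots> \<longleftrightarrow> max 0 (\<bar>y\<bar> - a) \<le> sqrt (- ln u / pi)"
      using lnu by (intro power_mono_iff) auto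
    also have "\<dots> \<longleftrightarrow> y \<in> {- r u..r u}"
      using lnu by (auto simp: r_def abs_le_iff)
    finally show ?thesis .
  qed
  define \<Phi> where "\<Phi> u y = indicator {0<..<1} u * indicator {(u, y). u \<le> gauss_plateau a y} (u, y) * cos (s * y)"
    for u y :: real
  have \<Phi>_meas [measurable]: "case_prod \<Phi> \<in> borel_measurable (lborel \<Otimes>\<^sub>M lborel)"
    unfolding \<Phi>_def by measurable
  have inner_u: "(LINT u|lborel. \<Phi> u y) = gauss_plateau a y * cos (s * y)" for y
  proof -
    have "(LINT u|lborel. \<Phi> u y) = (LINT u|lborel. indicator {0<..gauss_plateau a y} u * cos (s * y))"
    proof (rule integral_cong_AE)
      show "AE u in lborel. \<Phi> u y = indicator {0<..gauss_plateau a y} u * cos (s * y)"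
        by (rule AE_mp[OF AE_lborel_singleton[of 1]], rule AE_I2)
          (use gauss_plateau_bounds(2)[of a y] in \<open>auto simp: \<Phi>_def indicator_def\<close>)
      show "(\<lambda>u. \<Phi> u y) \<in> borel_measurable lborel"
        unfolding \<Phi>_def by measurable
    qed auto
    then show ?thesis
      using gauss_plateau_bounds(1)[of a y] by simp
  qed
  have norm_u: "(\<integral>\<^sup>+u. ennreal (norm (\<Phi> u y)) \<partial>lborel) \<le> ennreal (gauss_plateau a y)" for y
  proof -
    have "(\<integral>\<^sup>+u. ennreal (norm (\<Phi> u y)) \<partial>lborel) \<le> (\<integral>\<^sup>+u. indicator {0<..gauss_plateau a y} u \<partial>lborel)"
      by (intro nn_integral_mono) (auto simp: \<Phi>_def indicator_def abs_mult)
    then show ?thesis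
      using gauss_plateau_bounds(1)[of a y] by simp
  qed
  have int: "integrable (lborel \<Otimes>\<^sub>M lborel) (case_prod \<Phi>)"
  proof (rule integrableI_bounded)
    have "(\<integral>\<^sup>+x. ennreal (norm (case_prod \<Phi> x)) \<partial>(lborel \<Otimes>\<^sub>M lborel))
        = (\<integral>\<^sup>+y. (\<integral>\<^sup>+u. ennreal (norm (\<Phi> u y)) \<partial>lborel) \<partial>lborel)"
      by (subst lborel_pair.nn_integral_snd[symmetric]) auto
    also have "\<dots> \<le> (\<integral>\<^sup>+y. ennreal (gauss_plateau a y) \<partial>lborel)"
      by (intro nn_integral_mono norm_u)
    also have "\<dots> < \<infinity>"
      using integrable_gauss_plateau[OF a] gauss_plateau_bounds(1)[of a]
      by (subst nn_integral_eq_integral) (auto intro: less_imp_le)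
    finally show "(\<integral>\<^sup>+x. ennreal (norm (case_prod \<Phi> x)) \<partial>(lborel \<Otimes>\<^sub>M lborel)) < \<infinity>" .
  qed measurable
  have "plateau_hat a s = (LINT y|lborel. LINT u|lborel. \<Phi> u y)"
    by (simp add: plateau_hat_def inner_u)
  also have "\<dots> = (LINT u|lborel. LINT y|lborel. \<Phi> u y)"
    by (rule lborel_pair.Fubini_integral[OF int])
  finally have "\<bar>plateau_hat a s\<bar> \<le> (LINT u|lborel. \<bar>LINT y|lborel. \<Phi> u y\<bar>)"
    by (simp add: integral_abs_bound)
  also have "\<dots> \<le> (LINT u|lborel. indicator {0<..<1::real} u * (2 / \<bar>s\<bar>))"
  proof (rule integral_mono)
    show "integrable lborel (\<lambda>u. \<bar>LINT y|lborel. \<Phi> u y\<bar>)"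
      using lborel_pair.integrable_fst'[OF int] by (intro integrable_abs) simp
    show "integrable lborel (\<lambda>u. indicator {0<..<1::real} u * (2 / \<bar>s\<bar>))"
      by simp
    fix u :: real
    show "\<bar>LINT y|lborel. \<Phi> u y\<bar> \<le> indicator {0<..<1} u * (2 / \<bar>s\<bar>)"
    proof (cases "u \<in> {0<..<1}")
      case True
      then have "ln u / pi \<le> 0" by (intro divide_nonpos_pos) auto
      then have "r u \<ge> 0" using a by (simp add: r_def)
      have "(LINT y|lborel. \<Phi> u y) = (LINT y|lborel. indicator {- r u..r u} y * cos (s * y))"
        using True level[of u] by (intro Bochner_Integration.integral_cong) (auto simp: \<Phi>_def indicator_def)
      also have "\<dots> = 2 * sin (r u * s) / s"
        by (rule integral_cos_Icc[OF \<open>r u \<ge> 0\<close> s])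
      also have "\<bar>\<dots>\<bar> \<le> 2 / \<bar>s\<bar>"
        using abs_sin_le_one[of "r u * s"] by (simp add: abs_mult divide_right_mono)
      finally show ?thesis using True by simp
    next
      case False
      then show ?thesis by (simp add: \<Phi>_def)
    qed
  qed
  also have "\<dots> = 2 / \<bar>s\<bar>" by simp
  finally show ?thesis .
qed

lemma continuous_plateau_hat:
  assumes a: "a \<ge> 0"
  shows "continuous_on UNIV (plateau_hat a)"
proof (intro continuous_at_imp_continuous_on ballI continuous_at_sequentiallyI)
  fix x :: real and u :: "nat \<Rightarrow> real" assume u: "u \<longlonglongrightarrow> x"
  show "(\<lambda>n. plateau_hat a (u n)) \<longlonglongrightarrow> plateau_hat a x"
    unfolding plateau_hat_def
  proof (rule integral_dominated_convergence[OF _ _ integrable_gauss_plateau[OF a]])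
    show "AE y in lborel. (\<lambda>n. gauss_plateau a y * cos (u n * y)) \<longlonglongrightarrow> gauss_plateau a y * cos (x * y)"
      by (intro AE_I2 tendsto_intros u)
    show "AE y in lborel. norm (gauss_plateau a y * cos (u n * y)) \<le> gauss_plateau a y" for n
    proof (rule AE_I2)
      fix y
      show "norm (gauss_plateau a y * cos (u n * y)) \<le> gauss_plateau a y"
        using gauss_plateau_bounds[of a y] by (simp add: abs_mult mult_left_le)
    qed
  qed auto
qed

lemma plateau_fourier:
  assumes a: "a \<ge> 0"
  shows "integrable lborel (\<lambda>y. complex_of_real (gauss_plateau a y) * cis (s * y))"
    and "(LINT y|lborel. complex_of_real (gauss_plateau a y) * cis (s * y)) = complex_of_real (plateau_hat a s)"
proof -
  show int: "integrable lborel (\<lambda>y. complex_of_real (gauss_plateau a y) * cis (s * y))"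
    by (rule Bochner_Integration.integrable_bound[OF integrable_gauss_plateau[OF a]])
      (auto simp: norm_mult cis_conv_exp)
  have "Im (LINT y|lborel. complex_of_real (gauss_plateau a y) * cis (s * y)) = (LINT y|lborel. gauss_plateau a y * sin (s * y))"
    using integral_Im[OF int] by simp
  moreover have "(LINT y|lborel. gauss_plateau a y * sin (s * y)) = - (LINT y|lborel. gauss_plateau a y * sin (s * y))"
    by (subst (1) lborel_integral_real_affine[of "-1" _ 0]) (auto simp: gauss_plateau_even)
  ultimately have "Im (LINT y|lborel. complex_of_real (gauss_plateau a y) * cis (s * y)) = 0" by simp
  moreover have "Re (LINT y|lborel. complex_of_real (gauss_plateau a y) * cis (s * y)) = plateau_hat a s"
    using integral_Re[OF int] by (simp add: plateau_hat_def)
  ultimately show "(LINT y|lborel. complex_of_real (gauss_plateau a y) * cis (s * y)) = complex_of_real (plateau_hat a s)"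
    by (simp add: complex_eq_iff)
qed

text \<open>Boundedness near 0 and decay of order \<open>1 / \<bar>s\<bar>\<close> suffice, as
  \<open>p > 1\<close>. Without this, the integral in the bound would be 0 by convention.\<close>

lemma integrable_plateau_hat_powr:
  assumes a: "a \<ge> 0" and p: "p > 1"
  shows "integrable lborel (\<lambda>s. \<bar>plateau_hat a s\<bar> powr p)"
proof -
  have [measurable]: "plateau_hat a \<in> borel_measurable borel"
    by (rule borel_measurable_continuous_onI[OF continuous_plateau_hat[OF a]])
  have tail: "integrable lborel (\<lambda>s. indicator {1..} s * s powr (- p))"
  proof (rule integrableI_nonneg)
    have "(\<integral>\<^sup>+s. ennreal (s powr (- p)) * indicator {1..} s \<partial>lborel) = ennreal (0 - (1 powr (1 - p) / (1 - p)))"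
    proof (rule nn_integral_FTC_atLeast[where F = "\<lambda>x. x powr (1 - p) / (1 - p)"])
      show "((\<lambda>x::real. x powr (1 - p) / (1 - p)) \<longlongrightarrow> 0) at_top"
        using p by (auto intro!: tendsto_divide_0 tendsto_neg_powr filterlim_ident tendsto_divide_zero)
      show "((\<lambda>x. x powr (1 - p) / (1 - p)) has_real_derivative x powr (- p)) (at x)" if "1 \<le> x" for x
        using p that by (auto intro!: derivative_eq_intros)
    qed auto
    also have "\<dots> < \<infinity>" by simp
    finally have "(\<integral>\<^sup>+s. ennreal (s powr (- p)) * indicator {1..} s \<partial>lborel) < \<infinity>" .
    also have "(\<integral>\<^sup>+s. ennreal (s powr (- p)) * indicator {1..} s \<partial>lborel) = (\<integral>\<^sup>+s. ennreal (indicator {1..} s * s powr (- p)) \<partial>lborel)"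
      by (intro nn_integral_cong) (auto simp: indicator_def)
    finally show "(\<integral>\<^sup>+s. ennreal (indicator {1..} s * s powr (- p)) \<partial>lborel) < \<infinity>" .
  qed auto
  have tail': "integrable lborel (\<lambda>s. indicator {1..} (- s) * (- s) powr (- p))"
    using lborel_integrable_real_affine[OF tail, of "-1" 0] by simp
  have mid: "integrable lborel (\<lambda>s. (2 * a + 1) powr p * indicator {-1..1::real} s)"
    by (intro integrable_mult_right integrable_indicator_Icc)
  show ?thesis
  proof (rule Bochner_Integration.integrable_bound)
    show "integrable lborel (\<lambda>s. (2 * a + 1) powr p * indicator {-1..1} s
      + (2 powr p * (indicator {1..} s * s powr (- p)) + 2 powr p * (indicator {1..} (- s) * (- s) powr (- p))))"
      by (intro Bochner_Integration.integrable_add mid integrable_mult_right tail tail')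
    show "AE s in lborel. norm (\<bar>plateau_hat a s\<bar> powr p) \<le> norm ((2 * a + 1) powr p * indicator {-1..1} s
      + (2 powr p * (indicator {1..} s * s powr (- p)) + 2 powr p * (indicator {1..} (- s) * (- s) powr (- p))))"
    proof (rule AE_I2)
      fix s :: real
      let ?R = "(2 * a + 1) powr p * indicator {-1..1} s
        + (2 powr p * (indicator {1..} s * s powr (- p)) + 2 powr p * (indicator {1..} (- s) * (- s) powr (- p)))"
      have "\<bar>plateau_hat a s\<bar> powr p \<le> ?R"
      proof (cases "s \<in> {-1..1}")
        case True
        have "\<bar>plateau_hat a s\<bar> powr p \<le> (2 * a + 1) powr p"
          using abs_plateau_hat_le[OF a] p by (intro powr_mono2) auto
        moreover have "0 \<le> 2 powr p * (indicator {1..} s * s powr (- p)) + 2 powr p * (indicator {1..} (- s) * (- s) powr (- p))"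
          by (intro add_nonneg_nonneg mult_nonneg_nonneg) auto
        moreover have "indicator {-1..1} s = (1::real)" using True by simp
        ultimately show ?thesis by (simp only: mult_1_right)
      next
        case False
        have "\<bar>plateau_hat a s\<bar> powr p \<le> (2 / \<bar>s\<bar>) powr p"
          using plateau_hat_decay[OF a, of s] p False by (intro powr_mono2) auto
        also have "\<dots> = 2 powr p * \<bar>s\<bar> powr (- p)"
          by (simp add: powr_divide powr_minus_divide)
        also have "\<dots> = ?R"
          using False by (auto simp: indicator_def abs_if)
        finally show ?thesis .
      qed
      then show "norm (\<bar>plateau_hat a s\<bar> powr p) \<le> norm ?R" by simp
    qed
  qed measurable
qed

section \<open>Fourier inversion for products of plateaus\<close>

lemma integrable_mult_cis:
  assumes "integrable M f" "g \<in> borel_measurable M"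
  shows "integrable M (\<lambda>x. complex_of_real (f x) * cis (g x))"
proof (rule Bochner_Integration.integrable_bound[OF assms(1)])
  have [measurable]: "f \<in> borel_measurable M" "g \<in> borel_measurable M"
    using assms by auto
  show "(\<lambda>x. complex_of_real (f x) * cis (g x)) \<in> borel_measurable M"
    by measurable
qed (auto simp: norm_mult)

lemma prod_cis: "finite J \<Longrightarrow> (\<Prod>j\<in>J. cis (f j)) = cis (\<Sum>j\<in>J. f j)"
  by (induction J rule: finite_induct) (simp_all add: cis_mult)

text \<open>The convolution of the plateau with a centred Gaussian density of variance \<open>2 * \<eta>\<close>,
  after scaling the integration variable. It is used since it satisfies Fourier inversion with the
  absolutely convergent integral of
  \<open>plateau_hat a s * exp (- (\<eta> * s\<^sup>2))\<close>.\<close>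

definition plateau_smooth :: "real \<Rightarrow> real \<Rightarrow> real \<Rightarrow> real" where
  "plateau_smooth \<eta> a y = (LINT t|lborel. exp (- (pi * t\<^sup>2)) * gauss_plateau a (y + 2 * sqrt (pi * \<eta>) * t))"

lemma measurable_plateau_hat: "a \<ge> 0 \<Longrightarrow> plateau_hat a \<in> borel_measurable borel"
  by (rule borel_measurable_continuous_onI[OF continuous_plateau_hat])

lemma plateau_hat_even: "plateau_hat a (- s) = plateau_hat a s"
  by (simp add: plateau_hat_def)

lemma integrable_plateau_hat_gauss:
  assumes a: "a \<ge> 0" and \<eta>: "\<eta> > 0"
  shows "integrable lborel (\<lambda>s. plateau_hat a s * exp (- (\<eta> * s\<^sup>2)))"
proof -
  have [measurable]: "plateau_hat a \<in> borel_measurable borel"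
    by (rule measurable_plateau_hat[OF a])
  have "integrable lborel (\<lambda>s. (2 * a + 1) * exp (- (\<eta> * s\<^sup>2)))"
    using gaussian_integral(1)[OF \<eta>] by simp
  then show ?thesis
    by (rule Bochner_Integration.integrable_bound)
      (use abs_plateau_hat_le[OF a] a in \<open>auto simp: abs_mult intro!: mult_right_mono\<close>)
qed

lemma plateau_smooth_fourier:
  assumes a: "a \<ge> 0" and \<eta>: "\<eta> > 0"
  shows "complex_of_real (plateau_smooth \<eta> a y) = complex_of_real (1 / (2 * pi)) *
    (LINT s|lborel. complex_of_real (plateau_hat a s * exp (- (\<eta> * s\<^sup>2))) * cis (y * s))"
proof -
  define \<Psi> where "\<Psi> s u = complex_of_real (gauss_plateau a u * exp (- (\<eta> * s\<^sup>2))) * cis ((y - u) * s)" for s u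
  have meas [measurable]: "case_prod \<Psi> \<in> borel_measurable (lborel \<Otimes>\<^sub>M lborel)"
    unfolding \<Psi>_def by measurable
  have int_u: "integrable lborel (\<lambda>u. \<Psi> s u)" for s
    unfolding \<Psi>_def by (intro integrable_mult_cis) (auto simp: integrable_gauss_plateau[OF a])
  have norm_\<Psi>: "norm (\<Psi> s u) = gauss_plateau a u * exp (- (\<eta> * s\<^sup>2))" for s u
    using gauss_plateau_bounds(1)[of a u] by (simp add: \<Psi>_def norm_mult)
  have int: "integrable (lborel \<Otimes>\<^sub>M lborel) (case_prod \<Psi>)"
  proof (rule lborel_pair.Fubini_integrable)
    show "integrable lborel (\<lambda>s. LINT u|lborel. norm (case_prod \<Psi> (s, u)))"
      using gaussian_integral(1)[OF \<eta>] by (simp add: norm_\<Psi>)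
    show "AE s in lborel. integrable lborel (\<lambda>u. case_prod \<Psi> (s, u))"
      using int_u by simp
  qed (rule meas)
  have inner_u: "(LINT u|lborel. \<Psi> s u) = complex_of_real (plateau_hat a s * exp (- (\<eta> * s\<^sup>2))) * cis (y * s)" for s
  proof -
    have "\<Psi> s u = (complex_of_real (exp (- (\<eta> * s\<^sup>2))) * cis (y * s)) * (complex_of_real (gauss_plateau a u) * cis (- s * u))" for u
    proof -
      have "cis ((y - u) * s) = cis (y * s) * cis (- s * u)"
        by (simp add: cis_mult algebra_simps)
      then show ?thesis by (simp only: \<Psi>_def of_real_mult mult_ac)
    qed
    then have "(LINT u|lborel. \<Psi> s u) = (complex_of_real (exp (- (\<eta> * s\<^sup>2))) * cis (y * s)) * (LINT u|lborel. complex_of_real (gauss_plateau a u) * cis (- s * u))"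
      by simp
    also have "(LINT u|lborel. complex_of_real (gauss_plateau a u) * cis (- s * u)) = complex_of_real (plateau_hat a s)"
      using plateau_fourier(2)[OF a, of "- s"] by (simp add: plateau_hat_even)
    finally show ?thesis by (simp add: mult_ac)
  qed
  have inner_s: "(LINT s|lborel. \<Psi> s u) = complex_of_real (gauss_plateau a u * (sqrt (pi / \<eta>) * exp (- ((y - u)\<^sup>2 / (4 * \<eta>)))))" for u
  proof -
    have "(LINT s|lborel. \<Psi> s u) = complex_of_real (gauss_plateau a u) * (LINT s|lborel. complex_of_real (exp (- (\<eta> * s\<^sup>2))) * cis ((y - u) * s))"
      by (simp add: \<Psi>_def mult.assoc)
    then show ?thesis
      unfolding gaussian_fourier(2)[OF \<eta>] by simp
  qed
  define r where "r = 2 * sqrt (pi * \<eta>)"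
  have r: "r > 0" "r\<^sup>2 = 4 * pi * \<eta>" using \<eta> by (auto simp: r_def power_mult_distrib)
  have "(LINT s|lborel. complex_of_real (plateau_hat a s * exp (- (\<eta> * s\<^sup>2))) * cis (y * s))
      = (LINT s|lborel. LINT u|lborel. \<Psi> s u)"
    by (simp add: inner_u)
  also have "\<dots> = (LINT u|lborel. LINT s|lborel. \<Psi> s u)"
    by (rule lborel_pair.Fubini_integral[OF int, symmetric])
  also have "\<dots> = complex_of_real (LINT u|lborel. gauss_plateau a u * (sqrt (pi / \<eta>) * exp (- ((y - u)\<^sup>2 / (4 * \<eta>)))))"
    unfolding inner_s by (rule integral_complex_of_real)
  also have "(LINT u|lborel. gauss_plateau a u * (sqrt (pi / \<eta>) * exp (- ((y - u)\<^sup>2 / (4 * \<eta>)))))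
      = \<bar>r\<bar> *\<^sub>R (LINT t|lborel. gauss_plateau a (y + r * t) * (sqrt (pi / \<eta>) * exp (- ((y - (y + r * t))\<^sup>2 / (4 * \<eta>)))))"
    using r by (intro lborel_integral_real_affine) auto
  also have "\<dots> = r * (LINT t|lborel. sqrt (pi / \<eta>) * (exp (- (pi * t\<^sup>2)) * gauss_plateau a (y + r * t)))"
    using r \<eta> by (simp add: power_mult_distrib mult_ac)
  also have "\<dots> = r * sqrt (pi / \<eta>) * plateau_smooth \<eta> a y"
    by (simp add: plateau_smooth_def r_def mult_ac)
  also have "r * sqrt (pi / \<eta>) = 2 * pi"
    using \<eta> by (simp add: r_def real_sqrt_mult real_sqrt_divide)
  finally show ?thesis by simp
qed

lemma plateau_smooth_nonneg: "plateau_smooth \<eta> a y \<ge> 0"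
  unfolding plateau_smooth_def using gauss_plateau_bounds(1)
  by (intro integral_nonneg_AE AE_I2 mult_nonneg_nonneg) (auto intro: less_imp_le)

lemma plateau_smooth_tendsto:
  assumes "\<eta> \<longlonglongrightarrow> 0"
  shows "(\<lambda>n. plateau_smooth (\<eta> n) a y) \<longlonglongrightarrow> gauss_plateau a y"
proof -
  have "(\<lambda>n. plateau_smooth (\<eta> n) a y) \<longlonglongrightarrow> (LINT t|lborel. exp (- (pi * t\<^sup>2)) * gauss_plateau a (y + 2 * sqrt (pi * 0) * t))"
    unfolding plateau_smooth_def
  proof (rule integral_dominated_convergence)
    show "integrable lborel (\<lambda>t. exp (- (pi * t\<^sup>2)) :: real)"
      by (rule gaussian_integral) simp
    show "AE t in lborel. (\<lambda>n. exp (- (pi * t\<^sup>2)) * gauss_plateau a (y + 2 * sqrt (pi * \<eta> n) * t))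
        \<longlonglongrightarrow> exp (- (pi * t\<^sup>2)) * gauss_plateau a (y + 2 * sqrt (pi * 0) * t)"
    proof (rule AE_I2, rule tendsto_mult[OF tendsto_const])
      fix t
      have "isCont (gauss_plateau a) z" for z
        using continuous_gauss_plateau by (simp add: continuous_on_eq_continuous_at)
      moreover have "(\<lambda>n. y + 2 * sqrt (pi * \<eta> n) * t) \<longlonglongrightarrow> y + 2 * sqrt (pi * 0) * t"
        by (intro tendsto_intros assms)
      ultimately show "(\<lambda>n. gauss_plateau a (y + 2 * sqrt (pi * \<eta> n) * t)) \<longlonglongrightarrow> gauss_plateau a (y + 2 * sqrt (pi * 0) * t)"
        by (rule isCont_tendsto_compose)
    qed
    show "AE t in lborel. norm (exp (- (pi * t\<^sup>2)) * gauss_plateau a (y + 2 * sqrt (pi * \<eta> n) * t)) \<le> exp (- (pi * t\<^sup>2))" for n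
    proof (rule AE_I2)
      fix t
      show "norm (exp (- (pi * t\<^sup>2)) * gauss_plateau a (y + 2 * sqrt (pi * \<eta> n) * t)) \<le> exp (- (pi * t\<^sup>2))"
        using gauss_plateau_bounds[of a "y + 2 * sqrt (pi * \<eta> n) * t"] by (simp add: abs_mult mult_left_le)
    qed
  qed measurable
  then show ?thesis
    using gaussian_integral(2)[of pi] by simp
qed

lemma
  fixes f :: "'a::euclidean_space \<Rightarrow> real \<Rightarrow> complex"
  assumes f: "\<And>b. b \<in> Basis \<Longrightarrow> integrable lborel (f b)"
  shows integrable_prod_Basis: "integrable lborel (\<lambda>x. \<Prod>b\<in>Basis. f b (x \<bullet> b))"
    and integral_prod_Basis: "(LINT x|lborel. (\<Prod>b\<in>Basis. f b (x \<bullet> b))) = (\<Prod>b\<in>Basis. LINT t|lborel. f b t)"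
proof -
  interpret L: product_sigma_finite "\<lambda>_::'a. lborel :: real measure"
    by (rule product_sigma_finite_lborel)
  have [measurable]: "f b \<in> borel_measurable borel" if "b \<in> Basis" for b
    using borel_measurable_integrable[OF f[OF that]] by simp
  let ?T = "\<lambda>g. \<Sum>b\<in>Basis. g b *\<^sub>R (b::'a)"
  have T: "?T \<in> measurable (PiM Basis (\<lambda>_. lborel)) borel" by measurable
  have F: "(\<lambda>x. \<Prod>b\<in>Basis. f b (x \<bullet> b)) \<in> borel_measurable borel" by measurable
  have eq: "(\<Prod>b\<in>Basis. f b (?T g \<bullet> b)) = (\<Prod>b\<in>Basis. f b (g b))" for g
    by (intro prod.cong) (auto simp: inner_sum_left inner_Basis if_distrib cong: if_cong)
  show "integrable lborel (\<lambda>x. \<Prod>b\<in>Basis. f b (x \<bullet> b))"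
    unfolding lborel_eq[where 'a = 'a] integrable_distr_eq[OF T F] eq
    by (rule L.product_integrable_prod) (auto intro: f)
  have "(LINT x|lborel. (\<Prod>b\<in>Basis. f b (x \<bullet> b))) = (LINT g|PiM Basis (\<lambda>_. lborel). (\<Prod>b\<in>Basis. f b (?T g \<bullet> b)))"
    unfolding lborel_eq[where 'a = 'a] by (rule integral_distr[OF T F])
  also have "\<dots> = (\<Prod>b\<in>Basis. LINT t|lborel. f b t)"
    unfolding eq by (rule L.product_integral_prod) (auto intro: f)
  finally show "(LINT x|lborel. (\<Prod>b\<in>Basis. f b (x \<bullet> b))) = (\<Prod>b\<in>Basis. LINT t|lborel. f b t)" .
qed

text \<open>The Fourier transform of \<open>exp (- (\<epsilon> * (norm x)\<^sup>2))\<close>, kept as a product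
  over coordinates.\<close>

definition gauss_kernel :: "real \<Rightarrow> 'a::euclidean_space \<Rightarrow> real" where
  "gauss_kernel \<epsilon> z = (\<Prod>b\<in>Basis. sqrt (pi / \<epsilon>) * exp (- (1 / (4 * \<epsilon>) * (z \<bullet> b)\<^sup>2)))"

lemma gauss_kernel_nonneg: "\<epsilon> > 0 \<Longrightarrow> gauss_kernel \<epsilon> z \<ge> 0"
  unfolding gauss_kernel_def by (intro prod_nonneg) auto

lemma gauss_kernel_fourier:
  fixes z :: "'a::euclidean_space"
  assumes \<epsilon>: "\<epsilon> > 0"
  shows "integrable lborel (\<lambda>x::'a. exp (- (\<epsilon> * (norm x)\<^sup>2)))"
    and "(LINT x|lborel. complex_of_real (exp (- (\<epsilon> * (norm x)\<^sup>2))) * cis (z \<bullet> x)) = complex_of_real (gauss_kernel \<epsilon> z)"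
proof -
  have eq: "complex_of_real (exp (- (\<epsilon> * (norm x)\<^sup>2))) * cis (z \<bullet> x)
      = (\<Prod>b\<in>Basis. complex_of_real (exp (- (\<epsilon> * (x \<bullet> b)\<^sup>2))) * cis ((z \<bullet> b) * (x \<bullet> b)))" for x z :: 'a
    by (simp add: exp_norm_square_prod_Basis prod.distrib prod_cis euclidean_inner[of z x])
  have "integrable lborel (\<lambda>x::'a. complex_of_real (exp (- (\<epsilon> * (norm x)\<^sup>2))) * cis (0 \<bullet> x))"
    unfolding eq by (intro integrable_prod_Basis gaussian_fourier(1) \<epsilon>)
  then show "integrable lborel (\<lambda>x::'a. exp (- (\<epsilon> * (norm x)\<^sup>2)))"
    by (simp add: complex_of_real_integrable_eq)
  have "(LINT x|lborel. complex_of_real (exp (- (\<epsilon> * (norm x)\<^sup>2))) * cis (z \<bullet> x))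
      = (\<Prod>b\<in>Basis. LINT t|lborel. complex_of_real (exp (- (\<epsilon> * t\<^sup>2))) * cis ((z \<bullet> b) * t))"
    unfolding eq by (intro integral_prod_Basis gaussian_fourier(1) \<epsilon>)
  then show "(LINT x|lborel. complex_of_real (exp (- (\<epsilon> * (norm x)\<^sup>2))) * cis (z \<bullet> x)) = complex_of_real (gauss_kernel \<epsilon> z)"
    unfolding gaussian_fourier(2)[OF \<epsilon>] by (simp add: gauss_kernel_def)
qed

lemma nn_integral_gauss_kernel:
  assumes \<epsilon>: "\<epsilon> > 0"
  shows "(\<integral>\<^sup>+z. ennreal (gauss_kernel \<epsilon> (z::'a::euclidean_space)) \<partial>lborel) = ennreal ((2 * pi) ^ DIM('a))"
proof -
  have "(\<integral>\<^sup>+z. ennreal (gauss_kernel \<epsilon> (z::'a)) \<partial>lborel)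
      = (\<integral>\<^sup>+z. (\<Prod>b\<in>Basis. ennreal (sqrt (pi / \<epsilon>) * exp (- (1 / (4 * \<epsilon>) * ((z::'a) \<bullet> b)\<^sup>2)))) \<partial>lborel)"
    using \<epsilon> by (simp add: gauss_kernel_def prod_ennreal)
  also have "\<dots> = (\<Prod>b\<in>(Basis::'a set). (\<integral>\<^sup>+t. ennreal (sqrt (pi / \<epsilon>) * exp (- (1 / (4 * \<epsilon>) * t\<^sup>2))) \<partial>lborel))"
    by (rule nn_integral_lborel_prod) auto
  also have "(\<integral>\<^sup>+t. ennreal (sqrt (pi / \<epsilon>) * exp (- (1 / (4 * \<epsilon>) * t\<^sup>2))) \<partial>lborel) = ennreal (2 * pi)"
  proof -
    have "(\<integral>\<^sup>+t. ennreal (sqrt (pi / \<epsilon>) * exp (- (1 / (4 * \<epsilon>) * t\<^sup>2))) \<partial>lborel)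
        = ennreal (sqrt (pi / \<epsilon>)) * (\<integral>\<^sup>+t. ennreal (exp (- (1 / (4 * \<epsilon>) * t\<^sup>2))) \<partial>lborel)"
      using \<epsilon> by (subst nn_integral_cmult[symmetric]) (auto simp: ennreal_mult')
    also have "\<dots> = ennreal (sqrt (pi / \<epsilon>) * sqrt (pi / (1 / (4 * \<epsilon>))))"
      using \<epsilon> by (subst nn_integral_gaussian) (auto simp: ennreal_mult')
    also have "sqrt (pi / \<epsilon>) * sqrt (pi / (1 / (4 * \<epsilon>))) = sqrt ((2 * pi)\<^sup>2)"
      using \<epsilon> by (subst real_sqrt_mult[symmetric]) (simp add: power2_eq_square)
    also have "sqrt ((2 * pi)\<^sup>2) = 2 * pi"
      by (subst real_sqrt_abs) simp
    finally show ?thesis by simp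
  qed
  finally show ?thesis
    by (simp add: ennreal_power)
qed

lemma integrable_gauss_kernel:
  assumes \<epsilon>: "\<epsilon> > 0"
  shows "integrable lborel (gauss_kernel \<epsilon> :: 'a::euclidean_space \<Rightarrow> real)"
proof (rule integrableI_nonneg)
  show "(gauss_kernel \<epsilon> :: 'a \<Rightarrow> real) \<in> borel_measurable lborel"
    unfolding gauss_kernel_def by measurable
qed (use \<epsilon> in \<open>auto simp: nn_integral_gauss_kernel gauss_kernel_nonneg\<close>)

lemma ennreal_norm_integral_le:
  fixes f :: "'a \<Rightarrow> 'b::{banach, second_countable_topology}"
  shows "ennreal (norm (integral\<^sup>L M f)) \<le> (\<integral>\<^sup>+x. ennreal (norm (f x)) \<partial>M)"
  by (cases "integrable M f") (auto simp: integral_norm_bound_ennreal not_integrable_integral_eq)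

text \<open>Insert Fourier inversion for every factor and integrate over \<open>x\<close> first: the Gaussian in
  \<open>x\<close> becomes the kernel at \<open>\<Sum>j. \<xi> j w j\<close>.\<close>

lemma smooth_product_le_fourier:
  fixes w :: "'i \<Rightarrow> real^'n"
  assumes J: "finite J" and a: "\<And>j. j \<in> J \<Longrightarrow> a j \<ge> 0" and \<eta>: "\<eta> > 0" and \<epsilon>: "\<epsilon> > 0"
  shows "(\<integral>\<^sup>+x. ennreal (exp (- (\<epsilon> * (norm x)\<^sup>2)) * (\<Prod>j\<in>J. plateau_smooth \<eta> (a j) (w j \<bullet> x))) \<partial>lborel)
    \<le> ennreal ((1 / (2 * pi)) ^ card J) *
      (\<integral>\<^sup>+\<xi>. ennreal ((\<Prod>j\<in>J. \<bar>plateau_hat (a j) (\<xi> j)\<bar>) * gauss_kernel \<epsilon> (\<Sum>j\<in>J. \<xi> j *\<^sub>R w j)) \<partial>PiM J (\<lambda>_. lborel))"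
proof -
  let ?P = "PiM J (\<lambda>_. lborel :: real measure)"
  interpret L: product_sigma_finite "\<lambda>_::'i. lborel :: real measure"
    by (rule product_sigma_finite_lborel)
  interpret P: sigma_finite_measure ?P
    using J by (rule L.sigma_finite)
  interpret PP: pair_sigma_finite "lborel :: (real^'n) measure" ?P ..
  define H where "H j s = plateau_hat (a j) s * exp (- (\<eta> * s\<^sup>2))" for j s
  have [measurable]: "plateau_hat (a j) \<in> borel_measurable borel" if "j \<in> J" for j
    by (rule measurable_plateau_hat[OF a[OF that]])
  have H_meas [measurable]: "H j \<in> borel_measurable borel" if "j \<in> J" for j
    unfolding H_def using that by measurable
  have H_int: "integrable lborel (H j)" if "j \<in> J" for j
    unfolding H_def by (rule integrable_plateau_hat_gauss[OF a[OF that] \<eta>])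
  define \<phi> where "\<phi> x = exp (- (\<epsilon> * (norm x)\<^sup>2))" for x :: "real^'n"
  have \<phi>_int: "integrable lborel \<phi>"
    unfolding \<phi>_def by (rule gauss_kernel_fourier[OF \<epsilon>])
  have \<phi>0: "\<phi> x \<ge> 0" for x by (simp add: \<phi>_def)
  have [measurable]: "\<phi> \<in> borel_measurable borel"
    unfolding \<phi>_def by measurable
  define W where "W \<xi> = (\<Sum>j\<in>J. \<xi> j *\<^sub>R w j)" for \<xi> :: "'i \<Rightarrow> real"
  have [measurable]: "W \<in> borel_measurable ?P"
    unfolding W_def by measurable
  define \<Omega> where "\<Omega> x \<xi> = complex_of_real (\<phi> x * (\<Prod>j\<in>J. H j (\<xi> j))) * cis (W \<xi> \<bullet> x)" for x \<xi>
  have meas [measurable]: "case_prod \<Omega> \<in> borel_measurable (lborel \<Otimes>\<^sub>M ?P)"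
    unfolding \<Omega>_def by measurable
  have HP_int: "integrable ?P (\<lambda>\<xi>. \<Prod>j\<in>J. H j (\<xi> j))"
    by (rule L.product_integrable_prod[OF J H_int])
  have int: "integrable (lborel \<Otimes>\<^sub>M ?P) (case_prod \<Omega>)"
  proof (rule PP.Fubini_integrable)
    have "norm (\<Omega> x \<xi>) = \<phi> x * norm (\<Prod>j\<in>J. H j (\<xi> j))" for x \<xi>
      using \<phi>0[of x] by (simp add: \<Omega>_def norm_mult abs_mult del: of_real_prod)
    then show "integrable lborel (\<lambda>x. LINT \<xi>|?P. norm (case_prod \<Omega> (x, \<xi>)))"
      using \<phi>_int by simp
    show "AE x in lborel. integrable ?P (\<lambda>\<xi>. case_prod \<Omega> (x, \<xi>))"
    proof (rule AE_I2)
      fix x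
      have "integrable ?P (\<lambda>\<xi>. complex_of_real (\<phi> x * (\<Prod>j\<in>J. H j (\<xi> j))) * cis (W \<xi> \<bullet> x))"
        by (intro integrable_mult_cis integrable_mult_right HP_int) measurable
      then show "integrable ?P (\<lambda>\<xi>. case_prod \<Omega> (x, \<xi>))"
        by (simp add: \<Omega>_def)
    qed
  qed (rule meas)
  define A where "A x = \<phi> x * (\<Prod>j\<in>J. plateau_smooth \<eta> (a j) (w j \<bullet> x))" for x
  have A0: "A x \<ge> 0" for x
    unfolding A_def using \<phi>0 plateau_smooth_nonneg by (intro mult_nonneg_nonneg prod_nonneg) auto
  let ?c = "complex_of_real ((1 / (2 * pi)) ^ card J)"
  have inner_\<xi>: "complex_of_real (A x) = ?c * (LINT \<xi>|?P. \<Omega> x \<xi>)" for x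
  proof -
    have "complex_of_real (\<Prod>j\<in>J. plateau_smooth \<eta> (a j) (w j \<bullet> x))
        = (\<Prod>j\<in>J. complex_of_real (1 / (2 * pi)) * (LINT s|lborel. complex_of_real (H j s) * cis ((w j \<bullet> x) * s)))"
      unfolding of_real_prod H_def
      by (intro prod.cong refl plateau_smooth_fourier a \<eta>)
    also have "\<dots> = ?c * (\<Prod>j\<in>J. LINT s|lborel. complex_of_real (H j s) * cis ((w j \<bullet> x) * s))"
      by (simp only: prod.distrib prod_constant of_real_power)
    also have "(\<Prod>j\<in>J. LINT s|lborel. complex_of_real (H j s) * cis ((w j \<bullet> x) * s))
        = (LINT \<xi>|?P. (\<Prod>j\<in>J. complex_of_real (H j (\<xi> j)) * cis ((w j \<bullet> x) * \<xi> j)))"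
      by (rule L.product_integral_prod[OF J, symmetric]) (intro integrable_mult_cis H_int, auto)
    also have "\<dots> = (LINT \<xi>|?P. complex_of_real (\<Prod>j\<in>J. H j (\<xi> j)) * cis (W \<xi> \<bullet> x))"
      by (simp add: prod.distrib prod_cis J W_def inner_sum_left mult.commute)
    finally show ?thesis
      by (simp add: A_def \<Omega>_def mult_ac)
  qed
  have inner_x: "(LINT x|lborel. \<Omega> x \<xi>) = complex_of_real ((\<Prod>j\<in>J. H j (\<xi> j)) * gauss_kernel \<epsilon> (W \<xi>))" for \<xi>
  proof -
    have "(LINT x|lborel. \<Omega> x \<xi>) = complex_of_real (\<Prod>j\<in>J. H j (\<xi> j)) * (LINT x|lborel. complex_of_real (\<phi> x) * cis (W \<xi> \<bullet> x))"
      by (simp add: \<Omega>_def mult_ac flip: integral_mult_right_zero)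
    then show ?thesis
      unfolding \<phi>_def gauss_kernel_fourier(2)[OF \<epsilon>] by simp
  qed
  have A_int: "integrable lborel A"
  proof -
    have "integrable lborel (\<lambda>x. ?c * (LINT \<xi>|?P. \<Omega> x \<xi>))"
      using PP.integrable_fst'[OF int] by simp
    then have "integrable lborel (\<lambda>x. complex_of_real (A x))"
      by (simp only: inner_\<xi>)
    then show ?thesis
      by (simp add: complex_of_real_integrable_eq)
  qed
  have "complex_of_real (LINT x|lborel. A x) = (LINT x|lborel. complex_of_real (A x))"
    by simp
  also have "\<dots> = ?c * (LINT x|lborel. LINT \<xi>|?P. \<Omega> x \<xi>)"
    unfolding inner_\<xi> by (rule integral_mult_right_zero)
  also have "(LINT x|lborel. LINT \<xi>|?P. \<Omega> x \<xi>) = (LINT \<xi>|?P. LINT x|lborel. \<Omega> x \<xi>)"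
    by (rule PP.Fubini_integral[OF int, symmetric])
  also have "\<dots> = (LINT \<xi>|?P. complex_of_real ((\<Prod>j\<in>J. H j (\<xi> j)) * gauss_kernel \<epsilon> (W \<xi>)))"
    unfolding inner_x ..
  finally have eq: "complex_of_real (LINT x|lborel. A x)
      = ?c * (LINT \<xi>|?P. complex_of_real ((\<Prod>j\<in>J. H j (\<xi> j)) * gauss_kernel \<epsilon> (W \<xi>)))" .
  have "(\<integral>\<^sup>+x. ennreal (A x) \<partial>lborel) = ennreal (LINT x|lborel. A x)"
    using A_int A0 by (intro nn_integral_eq_integral) auto
  also have "(LINT x|lborel. A x) = norm (complex_of_real (LINT x|lborel. A x))"
    using A0 by (simp add: integral_nonneg_AE)
  also have "\<dots> = (1 / (2 * pi)) ^ card J * norm (LINT \<xi>|?P. complex_of_real ((\<Prod>j\<in>J. H j (\<xi> j)) * gauss_kernel \<epsilon> (W \<xi>)))"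
    unfolding eq by (simp add: norm_mult norm_power norm_divide)
  also have "ennreal \<dots> \<le> ennreal ((1 / (2 * pi)) ^ card J) *
      (\<integral>\<^sup>+\<xi>. ennreal (norm (complex_of_real ((\<Prod>j\<in>J. H j (\<xi> j)) * gauss_kernel \<epsilon> (W \<xi>)))) \<partial>?P)"
    by (subst ennreal_mult') (auto intro!: mult_left_mono ennreal_norm_integral_le)
  also have "\<dots> \<le> ennreal ((1 / (2 * pi)) ^ card J) *
      (\<integral>\<^sup>+\<xi>. ennreal ((\<Prod>j\<in>J. \<bar>plateau_hat (a j) (\<xi> j)\<bar>) * gauss_kernel \<epsilon> (\<Sum>j\<in>J. \<xi> j *\<^sub>R w j)) \<partial>?P)"
  proof (intro mult_left_mono nn_integral_mono ennreal_leI)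
    fix \<xi> :: "'i \<Rightarrow> real"
    have "norm (complex_of_real ((\<Prod>j\<in>J. H j (\<xi> j)) * gauss_kernel \<epsilon> (W \<xi>))) = (\<Prod>j\<in>J. \<bar>H j (\<xi> j)\<bar>) * gauss_kernel \<epsilon> (W \<xi>)"
      using gauss_kernel_nonneg[OF \<epsilon>, of "W \<xi>"] by (simp add: norm_mult abs_prod abs_mult del: of_real_mult of_real_prod)
    also have "\<dots> \<le> (\<Prod>j\<in>J. \<bar>plateau_hat (a j) (\<xi> j)\<bar>) * gauss_kernel \<epsilon> (W \<xi>)"
      using gauss_kernel_nonneg[OF \<epsilon>] \<eta>
      by (intro mult_right_mono prod_mono) (auto simp: H_def abs_mult mult_left_le)
    finally show "norm (complex_of_real ((\<Prod>j\<in>J. H j (\<xi> j)) * gauss_kernel \<epsilon> (W \<xi>)))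
        \<le> (\<Prod>j\<in>J. \<bar>plateau_hat (a j) (\<xi> j)\<bar>) * gauss_kernel \<epsilon> (\<Sum>j\<in>J. \<xi> j *\<^sub>R w j)"
      by (simp add: W_def)
  qed simp
  finally show ?thesis by (simp add: A_def \<phi>_def)
qed

section \<open>The integral of a product of plateaus\<close>

text \<open>The transform may vanish, while transport requires positive densities; so
  \<open>brascamp_lieb_kernel\<close> is applied after adding a Gaussian of mass \<open>\<delta>\<close>
  to \<open>\<bar>plateau_hat\<bar> powr (1 / (1 - (norm (w j))\<^sup>2))\<close>, and then
  \<open>\<delta>\<close> tends to 0.\<close>

lemma plateau_hat_kernel_bound:
  fixes w :: "'i \<Rightarrow> real^'n"
  assumes J: "finite J" and id: "\<And>x. (\<Sum>j\<in>J. (w j \<bullet> x) *\<^sub>R w j) = x"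
    and a: "\<And>j. j \<in> J \<Longrightarrow> a j \<ge> 0" and w0: "\<And>j. j \<in> J \<Longrightarrow> w j \<noteq> 0" and \<epsilon>: "\<epsilon> > 0"
  shows "(\<integral>\<^sup>+\<xi>. ennreal ((\<Prod>j\<in>J. \<bar>plateau_hat (a j) (\<xi> j)\<bar>) * gauss_kernel \<epsilon> (\<Sum>j\<in>J. \<xi> j *\<^sub>R w j)) \<partial>PiM J (\<lambda>_. lborel))
    \<le> ennreal ((\<Prod>j\<in>J. if norm (w j) = 1 then 2 * a j + 1
         else ((LINT s|lborel. \<bar>plateau_hat (a j) s\<bar> powr (1 / (1 - (norm (w j))\<^sup>2))) / sqrt (1 - (norm (w j))\<^sup>2))
           powr (1 - (norm (w j))\<^sup>2)) * (2 * pi) ^ CARD('n))"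
proof -
  define q where "q j = 1 - (norm (w j))\<^sup>2" for j
  define I where "I j = (LINT s|lborel. \<bar>plateau_hat (a j) s\<bar> powr (1 / q j))" for j
  define X where "X = (\<integral>\<^sup>+\<xi>. ennreal ((\<Prod>j\<in>J. \<bar>plateau_hat (a j) (\<xi> j)\<bar>) * gauss_kernel \<epsilon> (\<Sum>j\<in>J. \<xi> j *\<^sub>R w j)) \<partial>PiM J (\<lambda>_. lborel))"
  have q: "0 < q j" "q j < 1" if "j \<in> J" "norm (w j) < 1" for j
    using that w0 by (auto simp: q_def abs_square_less_1)
  have I0: "I j \<ge> 0" for j
    unfolding I_def by (intro integral_nonneg_AE AE_I2) auto
  define B where "B \<delta> = (\<Prod>j\<in>J. if norm (w j) = 1 then 2 * a j + 1 else ((I j + \<delta>) / sqrt (q j)) powr q j) * (2 * pi) ^ CARD('n)" for \<delta>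
  have XB: "X \<le> ennreal (B \<delta>)" if \<delta>: "\<delta> > 0" for \<delta>
  proof -
    define f where "f j s = \<bar>plateau_hat (a j) s\<bar> powr (1 / q j) + \<delta> * exp (- (pi * s\<^sup>2))" for j s
    have int1: "integrable lborel (\<lambda>s. \<bar>plateau_hat (a j) s\<bar> powr (1 / q j))" if "j \<in> J" "norm (w j) < 1" for j
      using q[OF that] by (intro integrable_plateau_hat_powr a that) auto
    have int2: "integrable lborel (\<lambda>s::real. \<delta> * exp (- (pi * s\<^sup>2)))"
      using gaussian_integral(1)[of pi] by simp
    have int_f: "(LINT s|lborel. f j s) = I j + \<delta>" if "j \<in> J" "norm (w j) < 1" for j
      unfolding f_def I_def using int1[OF that] int2 gaussian_integral(2)[of pi] by simp
    have "X \<le> ennreal (\<Prod>j\<in>J. if norm (w j) = 1 then 2 * a j + 1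
          else ((LINT s|lborel. f j s) / sqrt (1 - (norm (w j))\<^sup>2)) powr (1 - (norm (w j))\<^sup>2)) *
      (\<integral>\<^sup>+x. ennreal (gauss_kernel \<epsilon> (x :: real^'n)) \<partial>lborel)"
      unfolding X_def
    proof (rule brascamp_lieb_kernel[OF J id])
      show "integrable lborel (f j)" if "j \<in> J" "norm (w j) < 1" for j
        unfolding f_def using int1[OF that] int2 by (rule Bochner_Integration.integrable_add)
      show "f j s > 0" for j s
        unfolding f_def using \<delta> by (intro add_nonneg_pos) auto
      show "continuous_on UNIV (f j)" if "j \<in> J" "norm (w j) < 1" for j
        unfolding f_def using q[OF that] a[OF that(1)]
        by (intro continuous_intros continuous_on_powr' continuous_plateau_hat) auto
      show "\<bar>plateau_hat (a j) s\<bar> \<le> f j s powr (1 - (norm (w j))\<^sup>2)" if "j \<in> J" "norm (w j) < 1" for j s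
      proof -
        have "\<bar>plateau_hat (a j) s\<bar> = (\<bar>plateau_hat (a j) s\<bar> powr (1 / q j)) powr q j"
          using q[OF that] by (simp add: powr_powr)
        also have "\<dots> \<le> f j s powr q j"
          unfolding f_def using q[OF that] \<delta> by (intro powr_mono2) auto
        finally show ?thesis by (simp add: q_def)
      qed
      show "\<bar>plateau_hat (a j) s\<bar> \<le> 2 * a j + 1" if "j \<in> J" for j s
        by (rule abs_plateau_hat_le[OF a[OF that]])
      show "integrable lborel (gauss_kernel \<epsilon> :: real^'n \<Rightarrow> real)"
        by (rule integrable_gauss_kernel[OF \<epsilon>])
      show "gauss_kernel \<epsilon> x \<ge> 0" for x :: "real^'n"
        by (rule gauss_kernel_nonneg[OF \<epsilon>])
    qed auto
    also have "(\<Prod>j\<in>J. if norm (w j) = 1 then 2 * a j + 1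
          else ((LINT s|lborel. f j s) / sqrt (1 - (norm (w j))\<^sup>2)) powr (1 - (norm (w j))\<^sup>2))
        = (\<Prod>j\<in>J. if norm (w j) = 1 then 2 * a j + 1 else ((I j + \<delta>) / sqrt (q j)) powr q j)"
      using frame_norm_le_1[OF J id] int_f
      by (intro prod.cong) (auto simp: q_def order.strict_iff_order)
    also have "ennreal \<dots> * (\<integral>\<^sup>+x. ennreal (gauss_kernel \<epsilon> (x :: real^'n)) \<partial>lborel) = ennreal (B \<delta>)"
      unfolding nn_integral_gauss_kernel[OF \<epsilon>] B_def
      using a by (subst ennreal_mult') (auto intro!: prod_nonneg)
    finally show ?thesis .
  qed
  have "(\<lambda>n. ennreal (B (1 / real (Suc n)))) \<longlonglongrightarrow> ennreal (B 0)"
  proof (rule tendsto_ennrealI)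
    have lim: "(\<lambda>n. 1 / real (Suc n)) \<longlonglongrightarrow> 0"
      by (rule LIMSEQ_Suc[OF lim_1_over_n])
    show "(\<lambda>n. B (1 / real (Suc n))) \<longlonglongrightarrow> B 0"
      unfolding B_def
    proof (intro tendsto_mult tendsto_const tendsto_prod)
      fix j assume j: "j \<in> J"
      show "(\<lambda>n. if norm (w j) = 1 then 2 * a j + 1 else ((I j + 1 / real (Suc n)) / sqrt (q j)) powr q j)
          \<longlonglongrightarrow> (if norm (w j) = 1 then 2 * a j + 1 else ((I j + 0) / sqrt (q j)) powr q j)"
      proof (cases "norm (w j) = 1")
        case True
        then show ?thesis by simp
      next
        case False
        then have "norm (w j) < 1"
          using frame_norm_le_1[OF J id j] by simp
        note q = q[OF j this]
        have "(\<lambda>n. ((I j + 1 / real (Suc n)) / sqrt (q j)) powr q j) \<longlonglongrightarrow> ((I j + 0) / sqrt (q j)) powr q j"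
        proof (rule tendsto_powr2)
          show "(\<lambda>n. (I j + 1 / real (Suc n)) / sqrt (q j)) \<longlonglongrightarrow> (I j + 0) / sqrt (q j)"
            using q by (intro tendsto_intros lim) auto
          show "\<forall>\<^sub>F n in sequentially. 0 \<le> (I j + 1 / real (Suc n)) / sqrt (q j)"
            using q I0[of j] by (intro always_eventually allI divide_nonneg_nonneg add_nonneg_nonneg) auto
        qed (use q in auto)
        then show ?thesis using False by simp
      qed
    qed
  qed
  then have "X \<le> ennreal (B 0)"
    by (rule LIMSEQ_le_const) (auto intro!: exI[of _ 0] XB)
  then show ?thesis
    by (simp only: X_def B_def I_def q_def add_0_right)
qed

text \<open>The bounds for the smoothed plateaus do not depend on the smoothing, because the mass of the Gaussian
  kernel is always \<open>(2 * pi) ^ CARD('n)\<close>. So Fatou's lemma applies as the smoothing is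
  removed.\<close>

theorem plateau_product_bound:
  fixes w :: "'i \<Rightarrow> real^'n"
  assumes J: "finite J" and id: "\<And>x. (\<Sum>j\<in>J. (w j \<bullet> x) *\<^sub>R w j) = x"
    and a: "\<And>j. j \<in> J \<Longrightarrow> a j \<ge> 0" and w0: "\<And>j. j \<in> J \<Longrightarrow> w j \<noteq> 0"
  shows "(\<integral>\<^sup>+x. ennreal (\<Prod>j\<in>J. gauss_plateau (a j) (w j \<bullet> x)) \<partial>lborel)
    \<le> ennreal ((1 / (2 * pi)) ^ card J * ((\<Prod>j\<in>J. if norm (w j) = 1 then 2 * a j + 1
         else ((LINT s|lborel. \<bar>plateau_hat (a j) s\<bar> powr (1 / (1 - (norm (w j))\<^sup>2))) / sqrt (1 - (norm (w j))\<^sup>2))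
           powr (1 - (norm (w j))\<^sup>2)) * (2 * pi) ^ CARD('n)))"
    (is "_ \<le> ennreal (_ * ?B)")
proof -
  define \<epsilon> where "\<epsilon> n = 1 / real (Suc n)" for n
  have \<epsilon>: "\<epsilon> n > 0" for n by (simp add: \<epsilon>_def)
  have lim: "\<epsilon> \<longlonglongrightarrow> 0"
    unfolding \<epsilon>_def by (rule LIMSEQ_Suc[OF lim_1_over_n])
  define T where "T n x = exp (- (\<epsilon> n * (norm x)\<^sup>2)) * (\<Prod>j\<in>J. plateau_smooth (\<epsilon> n) (a j) (w j \<bullet> x))" for n x
  have [measurable]: "T n \<in> borel_measurable borel" for n
    unfolding T_def plateau_smooth_def by measurable
  have T_le: "(\<integral>\<^sup>+x. ennreal (T n x) \<partial>lborel) \<le> ennreal ((1 / (2 * pi)) ^ card J * ?B)" for n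
  proof -
    have "(\<integral>\<^sup>+x. ennreal (T n x) \<partial>lborel) \<le> ennreal ((1 / (2 * pi)) ^ card J) * ennreal ?B"
      unfolding T_def
      by (rule order_trans[OF smooth_product_le_fourier[OF J a \<epsilon> \<epsilon>]
          mult_left_mono[OF plateau_hat_kernel_bound[OF J id a w0 \<epsilon>]]]) auto
    then show ?thesis by (simp add: ennreal_mult')
  qed
  have T_lim: "(\<lambda>n. ennreal (T n x)) \<longlonglongrightarrow> ennreal (\<Prod>j\<in>J. gauss_plateau (a j) (w j \<bullet> x))" for x
  proof (rule tendsto_ennrealI)
    have "(\<lambda>n. T n x) \<longlonglongrightarrow> exp (- (0 * (norm x)\<^sup>2)) * (\<Prod>j\<in>J. gauss_plateau (a j) (w j \<bullet> x))"
      unfolding T_def by (intro tendsto_intros plateau_smooth_tendsto lim)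
    then show "(\<lambda>n. T n x) \<longlonglongrightarrow> (\<Prod>j\<in>J. gauss_plateau (a j) (w j \<bullet> x))" by simp
  qed
  have "(\<integral>\<^sup>+x. ennreal (\<Prod>j\<in>J. gauss_plateau (a j) (w j \<bullet> x)) \<partial>lborel)
      = (\<integral>\<^sup>+x. liminf (\<lambda>n. ennreal (T n x)) \<partial>lborel)"
    using lim_imp_Liminf[OF sequentially_bot T_lim] by simp
  also have "\<dots> \<le> liminf (\<lambda>n. \<integral>\<^sup>+x. ennreal (T n x) \<partial>lborel)"
    by (rule nn_integral_liminf) measurable
  also have "\<dots> \<le> ennreal ((1 / (2 * pi)) ^ card J * ?B)"
    by (intro Liminf_le sequentially_bot always_eventually allI T_le)
  finally show ?thesis .
qed

section \<open>The Wills functional of a section\<close>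

text \<open>For the point \<open>y\<close> of \<open>A\<close> nearest to \<open>x\<close>, Parseval's identity
  gives \<open>|x - y|\<^sup>2 = \<Sum>j. (w j \<bullet> (x - y))\<^sup>2\<close>, and each
  term is at least the squared distance of \<open>w j \<bullet> x\<close> to
  \<open>[- a j, a j]\<close>.\<close>

theorem wills_le_frame:
  fixes w :: "'i \<Rightarrow> real^'n" and A :: "(real^'n) set"
  assumes A: "compact A" "convex A" "A \<noteq> {}"
    and J: "finite J" and id: "\<And>x. (\<Sum>j\<in>J. (w j \<bullet> x) *\<^sub>R w j) = x"
    and w0: "\<And>j. j \<in> J \<Longrightarrow> w j \<noteq> 0"
    and slab: "\<And>j y. j \<in> J \<Longrightarrow> y \<in> A \<Longrightarrow> \<bar>w j \<bullet> y\<bar> \<le> a j"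
  shows "wills A \<le> (1 / (2 * pi)) ^ card J * ((\<Prod>j\<in>J. if norm (w j) = 1 then 2 * a j + 1
         else ((LINT s|lborel. \<bar>plateau_hat (a j) s\<bar> powr (1 / (1 - (norm (w j))\<^sup>2))) / sqrt (1 - (norm (w j))\<^sup>2))
           powr (1 - (norm (w j))\<^sup>2)) * (2 * pi) ^ CARD('n))"
    (is "_ \<le> ?R")
proof -
  have a: "a j \<ge> 0" if "j \<in> J" for j
    using A(3) slab[OF that] by (meson abs_ge_zero all_not_in_conv order_trans)
  have "ennreal (wills A) = (\<integral>\<^sup>+x. ennreal (exp (- (pi * (infdist x A)\<^sup>2))) \<partial>lborel)"
    by (rule wills_eq_integral[OF A, symmetric])
  also have "\<dots> \<le> (\<integral>\<^sup>+x. ennreal (\<Prod>j\<in>J. gauss_plateau (a j) (w j \<bullet> x)) \<partial>lborel)"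
  proof (intro nn_integral_mono ennreal_leI)
    fix x
    obtain y where y: "y \<in> A" "infdist x A = dist x y"
      using infdist_attains_inf[OF compact_imp_closed[OF A(1)] A(3)] by blast
    have "(\<Sum>j\<in>J. (max 0 (\<bar>w j \<bullet> x\<bar> - a j))\<^sup>2) \<le> (\<Sum>j\<in>J. (w j \<bullet> (x - y))\<^sup>2)"
    proof (rule sum_mono)
      fix j assume j: "j \<in> J"
      have "max 0 (\<bar>w j \<bullet> x\<bar> - a j) \<le> \<bar>w j \<bullet> (x - y)\<bar>"
        using slab[OF j y(1)] by (simp add: inner_diff_right)
      then have "(max 0 (\<bar>w j \<bullet> x\<bar> - a j))\<^sup>2 \<le> \<bar>w j \<bullet> (x - y)\<bar>\<^sup>2"
        by (intro power_mono) auto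
      then show "(max 0 (\<bar>w j \<bullet> x\<bar> - a j))\<^sup>2 \<le> (w j \<bullet> (x - y))\<^sup>2" by simp
    qed
    also have "\<dots> = (infdist x A)\<^sup>2"
      unfolding frame_Parseval[OF id] y(2) dist_norm ..
    finally have "exp (- (pi * (infdist x A)\<^sup>2)) \<le> exp (- (pi * (\<Sum>j\<in>J. (max 0 (\<bar>w j \<bullet> x\<bar> - a j))\<^sup>2)))"
      by simp
    also have "\<dots> = (\<Prod>j\<in>J. gauss_plateau (a j) (w j \<bullet> x))"
      using J by (simp add: gauss_plateau_def exp_sum[symmetric] sum_negf sum_distrib_left)
    finally show "exp (- (pi * (infdist x A)\<^sup>2)) \<le> (\<Prod>j\<in>J. gauss_plateau (a j) (w j \<bullet> x))" .
  qed
  also have "\<dots> \<le> ennreal ?R"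
    by (rule plateau_product_bound[OF J id a w0])
  finally have "ennreal (wills A) \<le> ennreal ?R" .
  moreover have "0 \<le> ?R"
    using a by (intro mult_nonneg_nonneg prod_nonneg) auto
  ultimately show ?thesis by (simp only: ennreal_le_iff)
qed

lemma orth_proj_orthonormal_basis:
  assumes H: "subspace H" and B: "finite B" "B \<subseteq> H" "pairwise orthogonal B" "\<And>b. b \<in> B \<Longrightarrow> norm b = 1" "span B = H"
  shows "orth_proj H x = (\<Sum>b\<in>B. (x \<bullet> b) *\<^sub>R b)"
  unfolding orth_proj_def
proof (rule the_equality)
  let ?p = "\<Sum>b\<in>B. (x \<bullet> b) *\<^sub>R b"
  have "?p \<in> span B"
    by (intro span_sum span_scale) (auto intro: span_base)
  moreover have "orthogonal (x - ?p) z" if z: "z \<in> H" for z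
  proof -
    have "orthogonal (x - ?p) b" if b: "b \<in> B" for b
    proof -
      have "?p \<bullet> b = (\<Sum>c\<in>B. if c = b then x \<bullet> b else 0)"
        unfolding inner_sum_left using B(3,4) b
        by (intro sum.cong) (auto simp: pairwise_def orthogonal_def norm_eq_1)
      then show ?thesis
        using B(1) b by (simp add: orthogonal_def inner_diff_left)
    qed
    moreover have "z \<in> span B" using z B(5) by simp
    ultimately show ?thesis by (intro orthogonal_to_span[of z B])
  qed
  ultimately show "?p \<in> H \<and> (\<forall>z\<in>H. orthogonal (x - ?p) z)"
    by (simp add: B(5))
next
  fix y assume y: "y \<in> H \<and> (\<forall>z\<in>H. orthogonal (x - y) z)"
  have "(\<Sum>b\<in>B. (x \<bullet> b) *\<^sub>R b) = y"
    by (rule orthonormal_projection_eq[OF B(1,3,4)]) (use y B(2,5) in auto)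
  then show "y = (\<Sum>b\<in>B. (x \<bullet> b) *\<^sub>R b)" by simp
qed

text \<open>A supporting hyperplane of \<open>K\<close> at a contact point also supports the unit ball, so it is
  orthogonal to \<open>v\<close>; central symmetry gives the bound on the other side.\<close>

lemma contact_point_slab:
  fixes K :: "'a::euclidean_space set"
  assumes K: "compact K" "convex K" "cball 0 1 \<subseteq> K" "uminus ` K = K"
    and v: "v \<in> frontier K" "norm v = 1" and y: "y \<in> K"
  shows "\<bar>v \<bullet> y\<bar> \<le> 1"
proof -
  have "interior K \<noteq> {}"
    using interior_mono[OF K(3)] by (auto simp: interior_cball)
  then have int: "rel_interior K = interior K"
    by (rule rel_interior_nonempty_interior)
  have vK: "v \<in> K" "v \<notin> rel_interior K"
    using v(1) compact_imp_closed[OF K(1)] by (auto simp: frontier_def int)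
  obtain u where u: "u \<noteq> 0" "\<And>y. y \<in> K \<Longrightarrow> u \<bullet> v \<le> u \<bullet> y"
    by (rule supporting_hyperplane_rel_boundary[OF K(2) vK]) (rule that)
  have "- ((1 / norm u) *\<^sub>R u) \<in> K"
    by (rule subsetD[OF K(3)]) (simp add: u(1))
  from u(2)[OF this] have "u \<bullet> v \<le> - norm u"
    using u(1) by (simp add: dot_square_norm power2_eq_square)
  moreover have "- norm u \<le> u \<bullet> v"
    using Cauchy_Schwarz_ineq2[of u v] v(2) by simp
  ultimately have uv: "u \<bullet> v = - norm u" by simp
  define r where "r = norm u"
  have "(norm (u + r *\<^sub>R v))\<^sup>2 = u \<bullet> u + 2 * r * (u \<bullet> v) + r\<^sup>2 * (v \<bullet> v)"
    unfolding power2_norm_eq_inner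
    by (simp add: inner_add_left inner_add_right inner_commute power2_eq_square algebra_simps)
  also have "\<dots> = 0"
    using v(2) by (simp add: uv r_def norm_eq_1 power2_norm_eq_inner[symmetric]) (simp add: power2_eq_square)
  finally have "u + norm u *\<^sub>R v = 0" by (simp add: r_def)
  then have u_eq: "u = - (norm u *\<^sub>R v)"
    by (simp add: add_eq_0_iff2)
  have le: "v \<bullet> y \<le> 1" if "y \<in> K" for y
  proof -
    have "- norm u \<le> u \<bullet> y" using u(2)[OF that] uv by simp
    also have "u \<bullet> y = - norm u * (v \<bullet> y)"
      using arg_cong[OF u_eq, of "\<lambda>x. x \<bullet> y"] by simp
    finally show ?thesis using u(1) by simp
  qed
  have "- y \<in> K" using y K(4) by blast
  from le[OF this] le[OF y] show ?thesis by simp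
qed

lemma decomposition_of_identity_apply:
  fixes v :: "nat \<Rightarrow> real^'n"
  assumes "mat 1 = (\<Sum>j=1..m. c j *\<^sub>R (v j \<otimes>\<^sub>v v j))"
  shows "(\<Sum>j=1..m. (c j * (v j \<bullet> x)) *\<^sub>R v j) = x"
proof -
  have "x = (\<Sum>j=1..m. c j *\<^sub>R (v j \<otimes>\<^sub>v v j)) *v x"
    unfolding assms[symmetric] by simp
  also have "\<dots> = (\<Sum>j=1..m. (c j * (v j \<bullet> x)) *\<^sub>R v j)"
  proof (subst vec_eq_iff, rule allI)
    fix i
    have "((\<Sum>j=1..m. c j *\<^sub>R (v j \<otimes>\<^sub>v v j)) *v x) $ i
        = (\<Sum>k\<in>UNIV. \<Sum>j=1..m. c j * (v j $ i * v j $ k) * x $ k)"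
      by (simp add: matrix_vector_mult_def tensor_def sum_distrib_right)
    also have "\<dots> = (\<Sum>j=1..m. \<Sum>k\<in>UNIV. c j * (v j $ i * v j $ k) * x $ k)"
      by (rule sum.swap)
    also have "\<dots> = (\<Sum>j=1..m. (c j * (v j \<bullet> x)) *\<^sub>R v j) $ i"
      by (simp add: inner_vec_def sum_distrib_left sum_distrib_right mult_ac)
    finally show "((\<Sum>j=1..m. c j *\<^sub>R (v j \<otimes>\<^sub>v v j)) *v x) $ i = (\<Sum>j=1..m. (c j * (v j \<bullet> x)) *\<^sub>R v j) $ i" .
  qed
  finally show ?thesis by simp
qed

lemma wills_h_eq_plateau_hat:
  assumes "l * sqrt c * t \<ge> 0"
  shows "wills_h l c t s = \<bar>plateau_hat (l * sqrt c * t) s\<bar> powr (1 / (1 - c))"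
proof (cases "s = 0")
  case True
  then show ?thesis
    using plateau_hat_0[OF assms] assms by (simp add: wills_h_def mult.assoc)
next
  case False
  then show ?thesis
    unfolding wills_h_def plateau_hat_formula[OF assms False] by simp
qed

theorem proposition24:
  fixes K H :: "(real ^ 'n) set" and k m m0 :: nat
    and c ct t :: "nat \<Rightarrow> real" and v :: "nat \<Rightarrow> real ^ 'n"
    and J :: "nat set" and l :: real
  assumes "convex_body K" and "centrally_symmetric K" and "john_position K"
    and "subspace H" and "dim H = k"
    and "decomposition_of_identity K m c v"
    and "J = {j \<in> {1..m}. orth_proj H (v j) \<noteq> 0}" and "m0 = card J"
    and "\<And>j. j \<in> J \<Longrightarrow> ct j = c j * (norm (orth_proj H (v j)))\<^sup>2"
    and "\<And>j. j \<in> J \<Longrightarrow> t j = 1 / norm (orth_proj H (v j))"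
    and "l > 0"
  shows "(\<forall>j\<in>J. ct j = 1 \<longrightarrow>
            c j = 1 \<and> norm (orth_proj H (v j)) = 1 \<and> 2 * l * sqrt (ct j) * t j + 1 = 2 * l + 1) \<and>
         wills ((\<lambda>x. l *\<^sub>R x) ` (K \<inter> H)) \<le>
           1 / (2 * pi) powi (int m0 - int k) *
           (\<Prod>j\<in>J. if ct j = 1 then 2 * l * sqrt (ct j) * t j + 1
                   else ((LINT s|lborel. wills_h l (ct j) (t j) s) / sqrt (1 - ct j)) powr (1 - ct j))"
proof -
  note H = \<open>subspace H\<close>
  have K: "compact K" "convex K" "cball 0 1 \<subseteq> K" "uminus ` K = K"
    using assms(1-3) by (auto simp: convex_body_def centrally_symmetric_def john_position_def)
  have cv: "0 < c j" "c j \<le> 1" "v j \<in> frontier K" "norm (v j) = 1" if "j \<in> J" for j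
    using that assms(6,7) by (auto simp: decomposition_of_identity_def)
  have id_m: "(\<Sum>j=1..m. (c j * (v j \<bullet> x)) *\<^sub>R v j) = x" for x
    using assms(6) by (intro decomposition_of_identity_apply) (simp add: decomposition_of_identity_def)
  have finJ: "finite J" using assms(7) by simp
  obtain B where B: "B \<subseteq> H" "pairwise orthogonal B" "\<And>b. b \<in> B \<Longrightarrow> norm b = 1"
    "independent B" "span B = H"
    by (rule orthonormal_basis_subspace[OF H]) (rule that)
  have finB: "finite B" using B(4) by (rule independent_imp_finite)
  define P where "P = orth_proj H"
  have P: "P x = (\<Sum>b\<in>B. (x \<bullet> b) *\<^sub>R b)" for x
    unfolding P_def by (rule orth_proj_orthonormal_basis[OF H finB B(1-3,5)])
  have linP: "linear P"
    unfolding P by (rule linear_orthonormal_projection)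
  have symP: "P x \<bullet> y = x \<bullet> P y" for x y
    by (simp add: P inner_sum_left inner_sum_right inner_commute mult.commute)
  have PH: "P x \<in> H" for x
    unfolding P B(5)[symmetric] by (intro span_sum span_scale) (rule span_base)
  have P_fix: "P x = x" if "x \<in> H" for x
    unfolding P by (rule orthonormal_projection_eq[OF finB B(2,3)]) (use that B(5) in \<open>auto simp: orthogonal_def\<close>)
  define N where "N = {y. \<forall>x\<in>H. orthogonal x y}"
  have N: "subspace N"
    unfolding N_def by (rule subspace_orthogonal_to_vectors)
  have dimN: "dim N + k = CARD('n)"
    using dim_subspace_orthogonal_to_vectors[OF H subspace_UNIV] assms(5) by (simp add: N_def dim_UNIV)
  obtain B' where B': "B' \<subseteq> N" "pairwise orthogonal B'" "\<And>b. b \<in> B' \<Longrightarrow> norm b = 1"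
    "independent B'" "card B' = dim N" "span B' = N"
    by (rule orthonormal_basis_subspace[OF N]) (rule that)
  have finB': "finite B'" using B'(4) by (rule independent_imp_finite)
  have complement: "(\<Sum>b\<in>B'. (b \<bullet> x) *\<^sub>R b) = x - P x" for x
  proof -
    have "(\<Sum>b\<in>B'. (x \<bullet> b) *\<^sub>R b) = x - P x"
    proof (rule orthonormal_projection_eq[OF finB' B'(2,3)])
      have "orthogonal h (x - P x)" if "h \<in> H" for h
        using symP[of h x] P_fix[OF that] that by (simp add: orthogonal_def inner_diff_right)
      then show "x - P x \<in> span B'"
        unfolding B'(6) N_def by blast
      show "orthogonal (x - (x - P x)) b" if "b \<in> B'" for b
        using that B'(1) PH[of x] by (auto simp: N_def)
    qed
    then show ?thesis by (simp add: inner_commute)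
  qed
  \<comment> \<open>The vectors \<open>sqrt (c j) P v\<^sub>j\<close> form a Parseval frame of
    \<open>H\<close>. An orthonormal basis of the complement, with slabs of width 0, completes it to one of the
    whole space; these unit vectors contribute factors 1.\<close>
  define w where "w i = (case i of Inl j \<Rightarrow> sqrt (c j) *\<^sub>R P (v j) | Inr b \<Rightarrow> b)" for i :: "nat + real^'n"
  define a where "a i = (case i of Inl j \<Rightarrow> l * sqrt (c j) | Inr b \<Rightarrow> 0)" for i :: "nat + real^'n"
  let ?I = "J <+> B'"
  let ?A = "(\<lambda>x. l *\<^sub>R x) ` (K \<inter> H)"
  have frame: "(\<Sum>i\<in>?I. (w i \<bullet> x) *\<^sub>R w i) = x" for x
  proof -
    have "(\<Sum>j\<in>J. (w (Inl j) \<bullet> x) *\<^sub>R w (Inl j)) = (\<Sum>j\<in>J. (c j * (P (v j) \<bullet> x)) *\<^sub>R P (v j))"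
    proof (rule sum.cong)
      fix j assume "j \<in> J"
      then have "sqrt (c j) * sqrt (c j) = c j" using cv(1)[of j] by simp
      then show "(w (Inl j) \<bullet> x) *\<^sub>R w (Inl j) = (c j * (P (v j) \<bullet> x)) *\<^sub>R P (v j)"
        by (simp add: w_def mult.commute[of _ "P (v j) \<bullet> x"] mult.assoc)
    qed simp
    also have "\<dots> = (\<Sum>j=1..m. (c j * (P (v j) \<bullet> x)) *\<^sub>R P (v j))"
      using assms(7) by (intro sum.mono_neutral_left) (auto simp: P_def)
    also have "\<dots> = P (\<Sum>j=1..m. (c j * (v j \<bullet> P x)) *\<^sub>R v j)"
      by (simp add: linear_sum[OF linP] linear_scale[OF linP] symP)
    also have "\<dots> = P x"
      unfolding id_m by (rule P_fix[OF PH])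
    finally have J_part: "(\<Sum>j\<in>J. (w (Inl j) \<bullet> x) *\<^sub>R w (Inl j)) = P x" .
    have "(\<Sum>i\<in>?I. (w i \<bullet> x) *\<^sub>R w i) = (\<Sum>j\<in>J. (w (Inl j) \<bullet> x) *\<^sub>R w (Inl j)) + (\<Sum>b\<in>B'. (w (Inr b) \<bullet> x) *\<^sub>R w (Inr b))"
      by (simp only: sum.Plus[OF finJ finB'] o_def)
    also have "\<dots> = x"
      unfolding J_part using complement[of x] by (simp add: w_def)
    finally show ?thesis .
  qed
  have Pv: "P (v j) \<noteq> 0" "norm (P (v j)) \<le> 1" if "j \<in> J" for j
  proof -
    show "P (v j) \<noteq> 0" using that assms(7) by (simp add: P_def)
    have "(norm (P (v j)))\<^sup>2 = P (v j) \<bullet> v j"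
      using symP[of "P (v j)" "v j"] P_fix[OF PH[of "v j"]] by (simp add: power2_norm_eq_inner)
    also have "\<dots> \<le> norm (P (v j)) * norm (v j)"
      by (rule norm_cauchy_schwarz)
    finally have "norm (P (v j)) * norm (P (v j)) \<le> norm (P (v j)) * 1"
      using cv(4)[OF that] by (simp add: power2_eq_square)
    then show "norm (P (v j)) \<le> 1"
      using \<open>P (v j) \<noteq> 0\<close> by simp
  qed
  have ct: "ct j = c j * (norm (P (v j)))\<^sup>2" "t j = 1 / norm (P (v j))" if "j \<in> J" for j
    using assms(9,10)[OF that] by (simp_all add: P_def)
  have norm_w: "(norm (w (Inl j)))\<^sup>2 = ct j" if "j \<in> J" for j
    using cv(1)[OF that] by (simp add: w_def ct(1)[OF that] power_mult_distrib)
  have a_eq: "l * sqrt (ct j) * t j = l * sqrt (c j)" if "j \<in> J" for j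
    using Pv(1)[OF that] by (simp add: ct[OF that] real_sqrt_mult)
  have unit: "norm (w (Inl j)) = 1 \<longleftrightarrow> ct j = 1" if "j \<in> J" for j
    using norm_w[OF that] by (metis norm_ge_zero one_power2 power2_eq_imp_eq zero_le_one)
  have degenerate: "c j = 1 \<and> norm (P (v j)) = 1 \<and> 2 * l * sqrt (ct j) * t j + 1 = 2 * l + 1"
    if j: "j \<in> J" "ct j = 1" for j
  proof -
    have "c j * (norm (P (v j)))\<^sup>2 \<le> c j * 1"
      using Pv(2)[OF j(1)] cv(1)[OF j(1)] by (intro mult_left_mono) (auto simp: power_le_one)
    then have c1: "c j = 1" using cv(2)[OF j(1)] ct(1)[OF j(1)] j(2) by simp
    then have "(norm (P (v j)))\<^sup>2 = 1" using ct(1)[OF j(1)] j(2) by simp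
    then have "norm (P (v j)) = 1" by (simp add: power2_eq_1_iff) (use norm_ge_zero[of "P (v j)"] in linarith)
    then show ?thesis using c1 a_eq[OF j(1)] by simp
  qed
  have "wills ?A \<le> (1 / (2 * pi)) ^ card ?I * ((\<Prod>i\<in>?I. if norm (w i) = 1 then 2 * a i + 1
         else ((LINT s|lborel. \<bar>plateau_hat (a i) s\<bar> powr (1 / (1 - (norm (w i))\<^sup>2))) / sqrt (1 - (norm (w i))\<^sup>2))
           powr (1 - (norm (w i))\<^sup>2)) * (2 * pi) ^ CARD('n))" (is "_ \<le> _ * (prod ?f _ * _)")
  proof (rule wills_le_frame)
    show "compact ?A"
      using K(1) closed_subspace[OF H] by (intro compact_scaling compact_Int_closed)
    show "convex ?A"
      using K(2) subspace_imp_convex[OF H] by (intro convex_scaling convex_Int)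
    show "?A \<noteq> {}"
    proof -
      have "0 \<in> K" by (rule subsetD[OF K(3)]) simp
      then show ?thesis using subspace_0[OF H] by blast
    qed
    show "finite ?I" using finJ finB' by simp
    show "w i \<noteq> 0" if "i \<in> ?I" for i
      using that cv(1) Pv(1) B'(3) by (force simp: w_def)
    show "\<bar>w i \<bullet> y\<bar> \<le> a i" if i: "i \<in> ?I" and y: "y \<in> ?A" for i y
    proof -
      obtain z where z: "y = l *\<^sub>R z" "z \<in> K" "z \<in> H" using y by auto
      show ?thesis
      proof (cases i)
        case (Inl j)
        then have j: "j \<in> J" using i by auto
        have "\<bar>v j \<bullet> z\<bar> \<le> 1"
          by (rule contact_point_slab[OF K cv(3,4)[OF j] z(2)])
        then have "l * sqrt (c j) * \<bar>v j \<bullet> z\<bar> \<le> l * sqrt (c j) * 1"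
          using assms(11) cv(1)[OF j] by (intro mult_left_mono) auto
        then show ?thesis
          using assms(11) cv(1)[OF j] by (simp add: Inl w_def a_def z(1) symP P_fix[OF z(3)] abs_mult mult_ac)
      next
        case (Inr b)
        then have "b \<in> N" using i B'(1) by auto
        then have "z \<bullet> b = 0" using z(3) by (simp add: N_def orthogonal_def)
        then show ?thesis by (simp add: Inr w_def a_def z(1) inner_commute)
      qed
    qed
  qed (rule frame)
  also have "prod ?f ?I = (\<Prod>j\<in>J. ?f (Inl j)) * (\<Prod>b\<in>B'. ?f (Inr b))"
    by (simp only: prod.Plus[OF finJ finB'] o_def)
  also have "(\<Prod>b\<in>B'. ?f (Inr b)) = 1"
    using B'(3) by (intro prod.neutral) (simp add: w_def a_def)
  also have "(\<Prod>j\<in>J. ?f (Inl j)) = (\<Prod>j\<in>J. if ct j = 1 then 2 * l * sqrt (ct j) * t j + 1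
                   else ((LINT s|lborel. wills_h l (ct j) (t j) s) / sqrt (1 - ct j)) powr (1 - ct j))"
    (is "_ = ?Q")
  proof (rule prod.cong)
    fix j assume j: "j \<in> J"
    have aj: "a (Inl j) = l * sqrt (ct j) * t j"
      by (simp add: a_def a_eq[OF j])
    have "l * sqrt (ct j) * t j \<ge> 0"
      unfolding a_eq[OF j] using assms(11) cv(1)[OF j] by simp
    then have "wills_h l (ct j) (t j) s = \<bar>plateau_hat (a (Inl j)) s\<bar> powr (1 / (1 - (norm (w (Inl j)))\<^sup>2))" for s
      unfolding aj norm_w[OF j] by (rule wills_h_eq_plateau_hat)
    then show "?f (Inl j) = (if ct j = 1 then 2 * l * sqrt (ct j) * t j + 1
                   else ((LINT s|lborel. wills_h l (ct j) (t j) s) / sqrt (1 - ct j)) powr (1 - ct j))"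
      using unit[OF j] norm_w[OF j] aj by (simp add: mult.assoc)
  qed simp
  also have "(1 / (2 * pi)) ^ card ?I * (?Q * 1 * (2 * pi) ^ CARD('n)) = 1 / (2 * pi) powi (int m0 - int k) * ?Q"
  proof -
    have "card ?I = m0 + dim N"
      using finJ finB' B'(5) assms(8) by (simp add: card_Plus)
    moreover have "(2 * pi) powi (int m0 - int k) = (2 * pi) ^ m0 / (2 * pi) ^ k"
      by (simp add: power_int_diff)
    moreover have "(2 * pi) ^ CARD('n) = (2 * pi) ^ dim N * (2 * pi) ^ k"
      unfolding dimN[symmetric] by (rule power_add)
    moreover have "(2 * pi) ^ dim N \<noteq> 0" by simp
    ultimately show ?thesis
      by (simp only: power_add power_one_over) (simp add: field_simps)
  qed
  finally show ?thesis
    using degenerate by (simp add: P_def)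
qed

end
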